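(* Let $G$ be a group with a finite symmetric set of generators $S$, $e\notin S$, and suppose that $G$ is $\delta$-hyperbolic with respect to the word metric $d_S$, for some real $\delta\ge 0$. Let $d\in\mathbb{N}$ with $d\geq 32\delta+20$, let $P_d(G,S)$ be the Rips complex, and let $P$ be the second barycentric subdivision of $P_d(G,S)$. Then $P$ is a finite $G$-$CW$-model for the universal space $\underline{E}G$ for proper actions of $G$; that is, $P$ is a $G$-$CW$-complex consisting of finitely many $G$-equivariant cells, $P$ has only finite stabilizers, and the fixed point set $P^H$ is contractible for every finite subgroup $H\subset G$.
   Context: Word metric: $S$ is a finite generating set of $G$ with $S=S^{-1}$ and $e\notin S$. For $x,y\in G$, $d_S(x,y)$ is the minimal number $n$ such that $x^{-1}y=s_1\cdots s_n$ with $s_i\in S$. This is a left-invariant metric on $G$. Hyperbolicity: A metric space $X$ with metric $d(\cdot,\cdot)$ is $\delta$-hyperbolic ($\delta\ge 0$) if for all $x,y,z,t\in X$, $d(x,y)+d(z,t)\le\max\{d(x,z)+d(y,t),\,d(x,t)+d(y,z)\}+2\delta$. The group $G$ is $\delta$-hyperbolic (relative to $S$) if the metric space $(G,d_S)$ is $\delta$-hyperbolic. Rips complex: For $d\in\mathbb{N}$, $P_d(G,S)$ is the simplicial complex with vertex set $G$ whose $k$-simplices are given by $(k+1)$-tuples $(g_0,\dots,g_k)$ (regarded as unordered sets of vertices) of pairwise distinct elements of $G$ with $\max_{0\le i,j\le k}d_S(g_i,g_j)\le d$. $G$ acts simplicially by $g\cdot(g_0,\dots,g_k)=(gg_0,\dots,gg_k)$.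 Simplicial complexes are identified with their geometric realizations when speaking of points, fixed point sets and contractibility. $G$-$CW$-complexes: $G$ is regarded as a discrete group. A $G$-$CW$-complex is a $CW$-complex $X$ with a cellular $G$-action such that whenever some $g\in G$ maps a cell to itself, the restriction of the action of $g$ to this cell is the identity. It is proper if all stabilizers $G_x=\{g\in G\mid gx=x\}$ are finite, and finite if $X/G$ is compact. A $G$-$CW$-model for the universal space $\underline{E}G$ for proper actions of $G$ is a proper $G$-$CW$-complex $X$ such that $X^H=\{x\in X\mid hx=x \text{ for all } h\in H\}$ is contractible for every finite subgroup $H$ of $G$. *)

theory Defs
  imports "HOL-Analysis.Abstract_Euclidean_Space" "HOL-Algebra.Group_Action"
    "HOL-Algebra.Generated_Groups"
begin

section \<open>Word metrics and hyperbolicity\<close>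

text \<open>Only meaningful for \<open>x, y\<close> in the carrier and \<open>S\<close> generating \<open>G\<close> as a monoid;
  otherwise the set under \<open>LEAST\<close> may be empty.\<close>

definition word_dist :: "('a, 'b) monoid_scheme \<Rightarrow> 'a set \<Rightarrow> 'a \<Rightarrow> 'a \<Rightarrow> nat" where
  "word_dist G S x y =
    (LEAST n. \<exists>ws. length ws = n \<and> set ws \<subseteq> S \<and>
      inv\<^bsub>G\<^esub> x \<otimes>\<^bsub>G\<^esub> y = foldr (\<otimes>\<^bsub>G\<^esub>) ws \<one>\<^bsub>G\<^esub>)"

definition hyperbolic :: "'a set \<Rightarrow> ('a \<Rightarrow> 'a \<Rightarrow> real) \<Rightarrow> real \<Rightarrow> bool" where
  "hyperbolic X dst \<delta> \<longleftrightarrow>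
    (\<forall>x\<in>X. \<forall>y\<in>X. \<forall>z\<in>X. \<forall>t\<in>X.
      dst x y + dst z t \<le> max (dst x z + dst y t) (dst x t + dst y z) + 2 * \<delta>)"


section \<open>Simplicial complexes\<close>

text \<open>A simplicial complex is represented by the set of its simplices, a simplex by the finite
  nonempty set of its vertices.\<close>

definition rips_complex :: "('a, 'b) monoid_scheme \<Rightarrow> 'a set \<Rightarrow> nat \<Rightarrow> 'a set set" where
  "rips_complex G S d =
    {\<sigma>. finite \<sigma> \<and> \<sigma> \<noteq> {} \<and> \<sigma> \<subseteq> carrier G \<and> (\<forall>g\<in>\<sigma>. \<forall>h\<in>\<sigma>. word_dist G S g h \<le> d)}"

definition barycentric_subdivision :: "'v set set \<Rightarrow> 'v set set set" where
  "barycentric_subdivision K =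
    {c. finite c \<and> c \<noteq> {} \<and> c \<subseteq> K \<and> (\<forall>\<sigma>\<in>c. \<forall>\<tau>\<in>c. \<sigma> \<subseteq> \<tau> \<or> \<tau> \<subseteq> \<sigma>)}"

text \<open>The vertices of the subdivision are the simplices of the complex, so an action on vertices
  induces one on the vertices of the subdivision by taking images.\<close>

definition subdivision_action :: "('g \<Rightarrow> 'v \<Rightarrow> 'v) \<Rightarrow> 'g \<Rightarrow> 'v set \<Rightarrow> 'v set" where
  "subdivision_action \<alpha> g \<sigma> = \<alpha> g ` \<sigma>"

text \<open>Points of the geometric realization are given by their barycentric coordinates.\<close>

definition support :: "('v \<Rightarrow> real) \<Rightarrow> 'v set" where
  "support t = {v. t v \<noteq> 0}"

definition closed_simplex :: "'v set \<Rightarrow> ('v \<Rightarrow> real) set" where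
  "closed_simplex \<sigma> = {t. (\<forall>v. 0 \<le> t v) \<and> support t \<subseteq> \<sigma> \<and> sum t \<sigma> = 1}"

definition open_simplex :: "'v set \<Rightarrow> ('v \<Rightarrow> real) set" where
  "open_simplex \<sigma> = {t. (\<forall>v. 0 \<le> t v) \<and> support t = \<sigma> \<and> sum t \<sigma> = 1}"

text \<open>The realization carries the weak topology determined by its closed simplices. Each closed
  simplex of a finite vertex set has its Euclidean topology, which is the topology of pointwise
  convergence of the barycentric coordinates.\<close>

definition realization :: "'v set set \<Rightarrow> ('v \<Rightarrow> real) topology" where
  "realization K = topology (\<lambda>U. U \<subseteq> (\<Union>\<sigma>\<in>K. closed_simplex \<sigma>) \<and>
     (\<forall>\<sigma>\<in>K. openin (top_of_set (closed_simplex \<sigma>)) (U \<inter> closed_simplex \<sigma>)))"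

lemma openin_realization:
  "openin (realization K) U \<longleftrightarrow> U \<subseteq> (\<Union>\<sigma>\<in>K. closed_simplex \<sigma>) \<and>
     (\<forall>\<sigma>\<in>K. openin (top_of_set (closed_simplex \<sigma>)) (U \<inter> closed_simplex \<sigma>))"
proof -
  let ?P = "\<lambda>U. U \<subseteq> (\<Union>\<sigma>\<in>K. closed_simplex \<sigma>) \<and>
     (\<forall>\<sigma>\<in>K. openin (top_of_set (closed_simplex \<sigma>)) (U \<inter> closed_simplex \<sigma>))"
  have "istopology ?P"
    unfolding istopology_def
  proof (rule conjI; intro allI impI)
    fix U V assume U: "?P U" and V: "?P V"
    have "U \<inter> V \<inter> closed_simplex \<sigma> = (U \<inter> closed_simplex \<sigma>) \<inter> (V \<inter> closed_simplex \<sigma>)" for \<sigma>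
      by blast
    then have "openin (top_of_set (closed_simplex \<sigma>)) (U \<inter> V \<inter> closed_simplex \<sigma>)" if "\<sigma> \<in> K" for \<sigma>
      using U V that openin_Int[of "top_of_set (closed_simplex \<sigma>)" "U \<inter> closed_simplex \<sigma>" "V \<inter> closed_simplex \<sigma>"]
      by simp
    with U show "?P (U \<inter> V)"
      by blast
  next
    fix \<U> assume \<U>: "\<forall>U\<in>\<U>. ?P U"
    have "\<Union>\<U> \<inter> closed_simplex \<sigma> = (\<Union>U\<in>\<U>. U \<inter> closed_simplex \<sigma>)" for \<sigma>
      by blast
    moreover have "openin (top_of_set (closed_simplex \<sigma>)) (\<Union>U\<in>\<U>. U \<inter> closed_simplex \<sigma>)"
      if "\<sigma> \<in> K" for \<sigma>
      using \<U> that by (intro openin_Union) blast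
    ultimately have "openin (top_of_set (closed_simplex \<sigma>)) (\<Union>\<U> \<inter> closed_simplex \<sigma>)"
      if "\<sigma> \<in> K" for \<sigma>
      using that by presburger
    then show "?P (\<Union>\<U>)"
      using \<U> by blast
  qed
  then show ?thesis
    unfolding realization_def by simp
qed

lemma topspace_realization: "topspace (realization K) = (\<Union>\<sigma>\<in>K. closed_simplex \<sigma>)"
proof (rule subset_antisym)
  show "topspace (realization K) \<subseteq> (\<Union>\<sigma>\<in>K. closed_simplex \<sigma>)"
    using openin_realization[of K "topspace (realization K)"] by simp
  have "openin (realization K) (\<Union>\<sigma>\<in>K. closed_simplex \<sigma>)"
    unfolding openin_realization
  proof (intro conjI ballI subset_refl)
    fix \<sigma> assume "\<sigma> \<in> K"
    then have "(\<Union>\<sigma>\<in>K. closed_simplex \<sigma>) \<inter> closed_simplex \<sigma> = closed_simplex \<sigma>"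
      by blast
    then show "openin (top_of_set (closed_simplex \<sigma>))
        ((\<Union>\<sigma>\<in>K. closed_simplex \<sigma>) \<inter> closed_simplex \<sigma>)"
      using openin_topspace[of "top_of_set (closed_simplex \<sigma>)"] by simp
  qed
  then show "(\<Union>\<sigma>\<in>K. closed_simplex \<sigma>) \<subseteq> topspace (realization K)"
    by (rule openin_subset)
qed

text \<open>The \<open>n\<close>-cells are the open simplices with \<open>n + 1\<close> vertices.\<close>

definition simplicial_cells :: "'v set set \<Rightarrow> nat \<Rightarrow> ('v \<Rightarrow> real) set set" where
  "simplicial_cells K n = open_simplex ` {\<sigma> \<in> K. card \<sigma> = Suc n}"

text \<open>Affine extension of a vertex map \<open>f\<close>: the point with barycentric coordinates \<open>t\<close> goes to the
  convex combination of the \<open>f v\<close> with weights \<open>t v\<close>.\<close>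

definition affine_extension :: "('v \<Rightarrow> 'w) \<Rightarrow> ('v \<Rightarrow> real) \<Rightarrow> 'w \<Rightarrow> real" where
  "affine_extension f t = (\<lambda>w. \<Sum>v\<in>{v \<in> support t. f v = w}. t v)"

text \<open>Restricted to the realization because \<open>group_action\<close> demands extensional functions.\<close>

definition realization_action ::
    "'v set set \<Rightarrow> ('g \<Rightarrow> 'v \<Rightarrow> 'v) \<Rightarrow> 'g \<Rightarrow> ('v \<Rightarrow> real) \<Rightarrow> 'v \<Rightarrow> real" where
  "realization_action K \<alpha> g = restrict (affine_extension (\<alpha> g)) (topspace (realization K))"


section \<open>\<open>G\<close>-CW-complexes\<close>

definition unit_disc :: "nat \<Rightarrow> (nat \<Rightarrow> real) topology" where
  "unit_disc n = subtopology (Euclidean_space n) {x. (\<Sum>i<n. (x i)\<^sup>2) \<le> 1}"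

definition disc_interior :: "nat \<Rightarrow> (nat \<Rightarrow> real) set" where
  "disc_interior n = {x \<in> topspace (unit_disc n). (\<Sum>i<n. (x i)\<^sup>2) < 1}"

definition disc_boundary :: "nat \<Rightarrow> (nat \<Rightarrow> real) set" where
  "disc_boundary n = {x \<in> topspace (unit_disc n). (\<Sum>i<n. (x i)\<^sup>2) = 1}"

text \<open>\<open>C n\<close> is the set of open \<open>n\<close>-cells. The last two conditions are closure finiteness (as part
  of the existence of characteristic maps) and the weak topology.\<close>

definition characteristic_map ::
    "'x topology \<Rightarrow> (nat \<Rightarrow> 'x set set) \<Rightarrow> nat \<Rightarrow> 'x set \<Rightarrow> ((nat \<Rightarrow> real) \<Rightarrow> 'x) \<Rightarrow> bool" where
  "characteristic_map X C n e \<Phi> \<longleftrightarrow>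
     continuous_map (unit_disc n) X \<Phi> \<and>
     homeomorphic_map (subtopology (unit_disc n) (disc_interior n)) (subtopology X e) \<Phi> \<and>
     (\<exists>F. finite F \<and> F \<subseteq> (\<Union>m<n. C m) \<and> \<Phi> ` disc_boundary n \<subseteq> \<Union>F)"

definition CW_complex :: "'x topology \<Rightarrow> (nat \<Rightarrow> 'x set set) \<Rightarrow> bool" where
  "CW_complex X C \<longleftrightarrow>
     Hausdorff_space X \<and>
     (\<Union>n. \<Union>(C n)) = topspace X \<and>
     (\<forall>m n. \<forall>e\<in>C m. \<forall>e'\<in>C n. (m, e) \<noteq> (n, e') \<longrightarrow> e \<inter> e' = {}) \<and>
     (\<forall>n. \<forall>e\<in>C n. \<exists>\<Phi>. characteristic_map X C n e \<Phi>) \<and>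
     (\<forall>A\<subseteq>topspace X. (\<forall>n. \<forall>e\<in>C n. closedin X (A \<inter> X closure_of e)) \<longrightarrow> closedin X A)"

definition GCW_complex ::
    "('g, 'b) monoid_scheme \<Rightarrow> 'x topology \<Rightarrow> (nat \<Rightarrow> 'x set set) \<Rightarrow> ('g \<Rightarrow> 'x \<Rightarrow> 'x) \<Rightarrow> bool" where
  "GCW_complex G X C \<phi> \<longleftrightarrow>
     CW_complex X C \<and>
     group_action G (topspace X) \<phi> \<and>
     (\<forall>g\<in>carrier G. homeomorphic_map X X (\<phi> g)) \<and>
     (\<forall>g\<in>carrier G. \<forall>n. \<forall>e\<in>C n. \<phi> g ` e \<in> C n) \<and>
     (\<forall>g\<in>carrier G. \<forall>n. \<forall>e\<in>C n. \<phi> g ` e = e \<longrightarrow> (\<forall>x\<in>e. \<phi> g x = x))"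

definition proper_action ::
    "('g, 'b) monoid_scheme \<Rightarrow> 'x topology \<Rightarrow> ('g \<Rightarrow> 'x \<Rightarrow> 'x) \<Rightarrow> bool" where
  "proper_action G X \<phi> \<longleftrightarrow> (\<forall>x\<in>topspace X. finite (stabilizer G \<phi> x))"

text \<open>The quotient topology on the set of orbits.\<close>

definition orbit_space ::
    "('g, 'b) monoid_scheme \<Rightarrow> 'x topology \<Rightarrow> ('g \<Rightarrow> 'x \<Rightarrow> 'x) \<Rightarrow> 'x set topology" where
  "orbit_space G X \<phi> = topology (\<lambda>U. U \<subseteq> orbits G (topspace X) \<phi> \<and>
     openin X {x \<in> topspace X. orbit G \<phi> x \<in> U})"

lemma openin_orbit_space:
  "openin (orbit_space G X \<phi>) U \<longleftrightarrow>
     U \<subseteq> orbits G (topspace X) \<phi> \<and> openin X {x \<in> topspace X. orbit G \<phi> x \<in> U}"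
proof -
  let ?pre = "\<lambda>U. {x \<in> topspace X. orbit G \<phi> x \<in> U}"
  have "istopology (\<lambda>U. U \<subseteq> orbits G (topspace X) \<phi> \<and> openin X (?pre U))"
    unfolding istopology_def
  proof (intro conjI allI impI)
    fix U V
    assume U: "U \<subseteq> orbits G (topspace X) \<phi> \<and> openin X (?pre U)"
      and V: "V \<subseteq> orbits G (topspace X) \<phi> \<and> openin X (?pre V)"
    show "U \<inter> V \<subseteq> orbits G (topspace X) \<phi>"
      using U by blast
    have "?pre (U \<inter> V) = ?pre U \<inter> ?pre V"
      by blast
    then show "openin X (?pre (U \<inter> V))"
      using U V openin_Int[of X "?pre U" "?pre V"] by simp
  next
    fix \<U> assume \<U>: "\<forall>U\<in>\<U>. U \<subseteq> orbits G (topspace X) \<phi> \<and> openin X (?pre U)"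
    show "\<Union>\<U> \<subseteq> orbits G (topspace X) \<phi>"
      using \<U> by blast
    have "?pre (\<Union>\<U>) = (\<Union>U\<in>\<U>. ?pre U)"
      by auto
    moreover have "openin X (\<Union>U\<in>\<U>. ?pre U)"
      using \<U> by (intro openin_Union) auto
    ultimately show "openin X (?pre (\<Union>\<U>))"
      by (simp only:)
  qed
  then show ?thesis
    unfolding orbit_space_def by simp
qed

definition fixed_points ::
    "'x topology \<Rightarrow> ('g \<Rightarrow> 'x \<Rightarrow> 'x) \<Rightarrow> 'g set \<Rightarrow> 'x set" where
  "fixed_points X \<phi> H = {x \<in> topspace X. \<forall>h\<in>H. \<phi> h x = x}"

text \<open>\<open>contractible_space\<close> holds for the empty space, hence the explicit nonemptiness.\<close>

definition model_EG ::
    "('g, 'b) monoid_scheme \<Rightarrow> 'x topology \<Rightarrow> (nat \<Rightarrow> 'x set set) \<Rightarrow> ('g \<Rightarrow> 'x \<Rightarrow> 'x) \<Rightarrow> bool" where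
  "model_EG G X C \<phi> \<longleftrightarrow>
     GCW_complex G X C \<phi> \<and>
     proper_action G X \<phi> \<and>
     (\<forall>H. subgroup H G \<and> finite H \<longrightarrow>
        fixed_points X \<phi> H \<noteq> {} \<and>
        contractible_space (subtopology X (fixed_points X \<phi> H)))"

definition finite_model_EG ::
    "('g, 'b) monoid_scheme \<Rightarrow> 'x topology \<Rightarrow> (nat \<Rightarrow> 'x set set) \<Rightarrow> ('g \<Rightarrow> 'x \<Rightarrow> 'x) \<Rightarrow> bool" where
  "finite_model_EG G X C \<phi> \<longleftrightarrow> model_EG G X C \<phi> \<and> compact_space (orbit_space G X \<phi>)"

text \<open>An equivariant cell is the \<open>G\<close>-orbit of a cell.\<close>

definition equivariant_cells ::
    "('g, 'b) monoid_scheme \<Rightarrow> (nat \<Rightarrow> 'x set set) \<Rightarrow> ('g \<Rightarrow> 'x \<Rightarrow> 'x) \<Rightarrow> 'x set set set" where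
  "equivariant_cells G C \<phi> = orbits G (\<Union>n. C n) (\<lambda>g e. \<phi> g ` e)"

end

theory Submission
  imports Defs
begin

text \<open>Write \<open>K\<close> for the Rips complex and \<open>P\<close> for its second barycentric subdivision. All complexes
  that occur are locally finite, because balls in the word metric are finite, and on a locally
  finite complex the weak topology is the topology of pointwise convergence of barycentric
  coordinates (\<open>realization_locally_finite\<close>). Continuity can therefore be checked one coordinate
  at a time, and the realization of a subcomplex is a subspace.

  The equivariant cell structure rests on a rigidity property of barycentric subdivisions: if \<open>g\<close>
  maps a chain of finite sets to itself, it fixes each member, since comparable sets of equal
  cardinality coincide (\<open>subdivision_rigid\<close>). Stabilizers are finite because \<open>G\<close> acts freely on the
  vertices of \<open>K\<close>, and there are finitely many orbits of simplices because every simplex of \<open>K\<close> has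
  a translate containing \<open>\<one>\<close>.

  By rigidity again, the fixed points of a finite subgroup \<open>H\<close> form the realization of the second
  subdivision (order complex, then subdivision) of the poset \<open>Q\<close> of \<open>H\<close>-invariant simplices of \<open>K\<close>,
  and it remains to contract it. The points of \<open>G\<close> from which the whole of \<open>H\<close> is seen within the
  smallest possible radius form an \<open>H\<close>-invariant set \<open>Z\<close>, the centre, which hyperbolicity forces to
  have diameter at most \<open>4\<delta> + 1\<close>. Moving the vertices at maximal distance \<open>n\<close> from \<open>Z\<close> a fixed number
  \<open>k\<close> of steps along geodesics towards \<open>Z\<close> takes every simplex \<open>\<sigma>\<close> of \<open>K\<close> in the \<open>n\<close>-ball around \<open>Z\<close> to a
  simplex of a smaller ball, and \<open>\<sigma>\<close> and its image lie in a common simplex of \<open>K\<close> (\<open>descent_close\<close>).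
  As \<open>G\<close> acts freely on the vertices, these moves can be chosen \<open>H\<close>-equivariantly. Composing them
  retracts \<open>K\<close> to smaller and smaller balls, and the ball of radius \<open>k\<close> is so small that its
  simplices can be coned off to \<open>Z\<close>.

  This gives a sequence of monotone self-maps of \<open>Q\<close>, from a constant map to the identity, in
  which consecutive maps are comparable and every simplex is eventually fixed. Changing such
  maps one cardinality at a time turns the sequence into one of contiguous simplicial maps of
  the order complex; images of simplices turn the latter into a sequence of the former kind on
  the next poset (\<open>contractible_double_subdivision\<close>). Contiguous maps are joined by straight
  lines. Placing the \<open>n\<close>-th map at time \<open>1/(n+1)\<close> and the identity at time \<open>0\<close> gives a contraction; it
  is continuous because every vertex is eventually stationary and the complex is locally finite
  (\<open>contractible_contiguous_contraction\<close>).\<close>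

section \<open>Locally finite simplicial complexes\<close>

text \<open>The notion is meant also for posets of finite sets such as the invariant simplices of an
  action, which lack faces but whose subdivisions are complexes.\<close>

definition locally_finite_complex :: "'v set set \<Rightarrow> bool" where
  "locally_finite_complex K \<longleftrightarrow>
     (\<forall>\<sigma>\<in>K. finite \<sigma> \<and> \<sigma> \<noteq> {}) \<and> (\<forall>v. finite {\<sigma> \<in> K. v \<in> \<sigma>})"

abbreviation underlying_set :: "'v set set \<Rightarrow> ('v \<Rightarrow> real) set" where
  "underlying_set K \<equiv> \<Union>\<sigma>\<in>K. closed_simplex \<sigma>"

lemma locally_finite_complexD:
  assumes "locally_finite_complex K"
  shows "\<sigma> \<in> K \<Longrightarrow> finite \<sigma>" "\<sigma> \<in> K \<Longrightarrow> \<sigma> \<noteq> {}" "finite {\<sigma> \<in> K. v \<in> \<sigma>}"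
  using assms unfolding locally_finite_complex_def by auto

lemma locally_finite_complex_subset:
  assumes "locally_finite_complex K" "L \<subseteq> K"
  shows "locally_finite_complex L"
  unfolding locally_finite_complex_def
proof (intro conjI ballI allI)
  fix v
  have "{\<sigma> \<in> L. v \<in> \<sigma>} \<subseteq> {\<sigma> \<in> K. v \<in> \<sigma>}" using assms(2) by blast
  then show "finite {\<sigma> \<in> L. v \<in> \<sigma>}"
    using locally_finite_complexD(3)[OF assms(1)] finite_subset by blast
qed (use assms locally_finite_complexD in blast)+

text \<open>A simplex comparable with \<open>\<sigma>\<close> shares a vertex with \<open>\<sigma>\<close>, so only finitely many simplices occur
  in chains through \<open>\<sigma>\<close>.\<close>

lemma locally_finite_barycentric_subdivision:
  assumes "locally_finite_complex K"
  shows "locally_finite_complex (barycentric_subdivision K)"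
  unfolding locally_finite_complex_def
proof (intro conjI ballI allI)
  fix \<sigma>
  show "finite {c \<in> barycentric_subdivision K. \<sigma> \<in> c}"
  proof (cases "\<sigma> \<in> K")
    case True
    let ?N = "\<Union>v\<in>\<sigma>. {\<tau> \<in> K. v \<in> \<tau>}"
    have "finite ?N"
      using locally_finite_complexD[OF assms] True by blast
    moreover have "{c \<in> barycentric_subdivision K. \<sigma> \<in> c} \<subseteq> Pow ?N"
    proof clarify
      fix c \<tau> assume c: "c \<in> barycentric_subdivision K" "\<sigma> \<in> c" and \<tau>: "\<tau> \<in> c"
      then have "\<tau> \<in> K" "\<sigma> \<subseteq> \<tau> \<or> \<tau> \<subseteq> \<sigma>"
        unfolding barycentric_subdivision_def by blast+
      then show "\<tau> \<in> ?N"
        using True locally_finite_complexD(2)[OF assms] by blast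
    qed
    ultimately show ?thesis
      by (meson finite_Pow_iff finite_subset)
  next
    case False
    then have "{c \<in> barycentric_subdivision K. \<sigma> \<in> c} = {}"
      unfolding barycentric_subdivision_def by blast
    then show ?thesis by (metis finite.emptyI)
  qed
qed (auto simp: barycentric_subdivision_def)

lemma closed_simplex_alt:
  "closed_simplex \<sigma> = {t. (\<forall>v. 0 \<le> t v) \<and> (\<forall>v. v \<notin> \<sigma> \<longrightarrow> t v = 0) \<and> sum t \<sigma> = 1}"
  unfolding closed_simplex_def support_def by blast

lemma closed_simplexD:
  assumes "t \<in> closed_simplex \<sigma>"
  shows "0 \<le> t v" "v \<notin> \<sigma> \<Longrightarrow> t v = 0" "sum t \<sigma> = 1" "support t \<subseteq> \<sigma>"
  using assms unfolding closed_simplex_alt support_def by blast+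

lemma sum_support:
  fixes t :: "'v \<Rightarrow> real"
  assumes "finite \<sigma>" "support t \<subseteq> \<sigma>"
  shows "(\<Sum>v\<in>support t. t v * f v) = (\<Sum>v\<in>\<sigma>. t v * f v)"
  using assms by (intro sum.mono_neutral_left) (auto simp: support_def)

lemma support_nonempty:
  assumes "t \<in> closed_simplex \<sigma>"
  shows "support t \<noteq> {}"
proof
  assume "support t = {}"
  then have "sum t \<sigma> = 0" unfolding support_def by (intro sum.neutral) blast
  then show False using closed_simplexD(3)[OF assms] by simp
qed

lemma mem_closed_simplex_support:
  assumes "finite \<sigma>" "t \<in> closed_simplex \<sigma>"
  shows "t \<in> closed_simplex (support t)" "t \<in> open_simplex (support t)"
proof -
  have "sum t (support t) = sum t \<sigma>"
    using assms(1) closed_simplexD(4)[OF assms(2)]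
    by (intro sum.mono_neutral_left) (auto simp: support_def)
  then show "t \<in> closed_simplex (support t)" "t \<in> open_simplex (support t)"
    using assms(2) unfolding closed_simplex_def open_simplex_def by auto
qed

lemma open_simplex_subset_closed: "open_simplex \<sigma> \<subseteq> closed_simplex \<sigma>"
  unfolding open_simplex_def closed_simplex_def by blast

lemma closed_closed_simplex: "closed (closed_simplex \<sigma>)"
proof -
  have "closed_simplex \<sigma> =
      (\<Inter>v. {t. 0 \<le> t v}) \<inter> (\<Inter>v\<in>-\<sigma>. {t. t v = 0}) \<inter> {t. (\<Sum>v\<in>\<sigma>. t v) = 1}"
    unfolding closed_simplex_alt by blast
  also have "closed \<dots>"
    by (intro closed_Int closed_INT ballI closed_Collect_le closed_Collect_eq continuous_intros
        continuous_on_product_coordinates)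
  finally show ?thesis .
qed

lemma compact_closed_simplex:
  assumes "finite \<sigma>"
  shows "compact (closed_simplex \<sigma>)"
proof -
  have "compactin (product_topology (\<lambda>v::'a. euclidean) UNIV) (PiE UNIV (\<lambda>v. {0..1::real}))"
    unfolding compactin_PiE by auto
  then have cpt: "compact (PiE UNIV (\<lambda>v::'a. {0..1::real}))"
    by (simp add: euclidean_product_topology)
  have "t v \<le> 1" if t: "t \<in> closed_simplex \<sigma>" for t v
  proof (cases "v \<in> \<sigma>")
    case True
    have "t v \<le> sum t \<sigma>"
      using True assms closed_simplexD(1)[OF t] by (intro member_le_sum) auto
    then show ?thesis using closed_simplexD(3)[OF t] by simp
  qed (use closed_simplexD(2)[OF t] in simp)
  then have "closed_simplex \<sigma> \<subseteq> PiE UNIV (\<lambda>v. {0..1::real})"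
    using closed_simplexD(1) by fastforce
  then have "PiE UNIV (\<lambda>v. {0..1}) \<inter> closed_simplex \<sigma> = closed_simplex \<sigma>" by blast
  then show ?thesis
    using compact_Int_closed[OF cpt closed_closed_simplex[of \<sigma>]] by simp
qed

text \<open>If \<open>t v \<noteq> 0\<close>, then the points with nonzero coordinate at \<open>v\<close> are a pointwise neighbourhood of
  \<open>t\<close> that meets only the finitely many simplices containing \<open>v\<close>. A weakly open set is, near \<open>t\<close>, the
  complement of finitely many closed subsets of closed simplices.\<close>

theorem realization_locally_finite:
  assumes "locally_finite_complex K"
  shows "realization K = top_of_set (underlying_set K)"
  unfolding topology_eq
proof (intro allI iffI)
  fix U
  assume "openin (top_of_set (underlying_set K)) U"
  then obtain T where T: "open T" "U = underlying_set K \<inter> T"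
    unfolding openin_open by blast
  have "U \<inter> closed_simplex \<sigma> = closed_simplex \<sigma> \<inter> T" if "\<sigma> \<in> K" for \<sigma>
    using that T(2) by blast
  then show "openin (realization K) U"
    unfolding openin_realization using T by (auto simp: openin_open)
next
  fix U
  assume "openin (realization K) U"
  then have U: "U \<subseteq> underlying_set K"
    "\<And>\<sigma>. \<sigma> \<in> K \<Longrightarrow> openin (top_of_set (closed_simplex \<sigma>)) (U \<inter> closed_simplex \<sigma>)"
    unfolding openin_realization by blast+
  show "openin (top_of_set (underlying_set K)) U"
  proof (subst openin_subopen, intro ballI)
    fix t assume "t \<in> U"
    then obtain \<sigma> where \<sigma>: "\<sigma> \<in> K" "t \<in> closed_simplex \<sigma>" using U(1) by blast
    obtain v where v: "t v \<noteq> 0"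
      using support_nonempty[OF \<sigma>(2)] unfolding support_def by blast
    let ?star = "{\<sigma> \<in> K. v \<in> \<sigma>}"
    let ?B = "\<Union>\<sigma>\<in>?star. closed_simplex \<sigma> - U"
    have "closed (closed_simplex \<sigma> - U)" if "\<sigma> \<in> K" for \<sigma>
    proof -
      have "closedin (top_of_set (closed_simplex \<sigma>)) (closed_simplex \<sigma> - U \<inter> closed_simplex \<sigma>)"
        using U(2)[OF that] unfolding openin_closedin_eq by simp
      moreover have "closed_simplex \<sigma> - U \<inter> closed_simplex \<sigma> = closed_simplex \<sigma> - U" by blast
      ultimately show ?thesis
        using closedin_closed_trans[OF _ closed_closed_simplex] by simp
    qed
    then have "closed ?B"
      using locally_finite_complexD(3)[OF assms] by (intro closed_UN) auto
    moreover have "open {s :: 'a \<Rightarrow> real. s v \<noteq> 0}"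
      by (intro open_Collect_neq continuous_intros continuous_on_product_coordinates)
    ultimately have "open ({s. s v \<noteq> 0} - ?B)"
      by (rule open_Diff[rotated])
    then have "openin (top_of_set (underlying_set K)) (underlying_set K \<inter> ({s. s v \<noteq> 0} - ?B))"
      by (auto simp: openin_open)
    moreover have "underlying_set K \<inter> ({s. s v \<noteq> 0} - ?B) \<subseteq> U"
    proof
      fix s assume s: "s \<in> underlying_set K \<inter> ({s. s v \<noteq> 0} - ?B)"
      then obtain \<tau> where \<tau>: "\<tau> \<in> K" "s \<in> closed_simplex \<tau>" by blast
      then have "v \<in> \<tau>" using s closed_simplexD(2)[OF \<tau>(2)] by blast
      then show "s \<in> U" using s \<tau> by blast
    qed
    moreover have "t \<in> underlying_set K \<inter> ({s. s v \<noteq> 0} - ?B)"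
      using \<open>t \<in> U\<close> U(1) v by blast
    ultimately show "\<exists>T. openin (top_of_set (underlying_set K)) T \<and> t \<in> T \<and> T \<subseteq> U"
      by blast
  qed
qed

text \<open>Maps out of a realization and homotopies on it are given by sums over the support, whose
  size varies with the point; on the set of points with nonzero coordinate at \<open>v\<close> it may be
  replaced by the fixed finite union of the simplices containing \<open>v\<close>.\<close>

lemma continuous_on_weighted_sum:
  fixes F :: "'v \<Rightarrow> 'x::topological_space \<Rightarrow> real"
  assumes K: "locally_finite_complex K"
    and \<tau>: "continuous_on X \<tau>" "\<tau> ` X \<subseteq> underlying_set K"
    and F: "\<And>v. continuous_on X (F v)"
  shows "continuous_on X (\<lambda>x. \<Sum>v\<in>support (\<tau> x). \<tau> x v * F v x)"
proof -
  define T where "T v = X \<inter> {x. \<tau> x v \<noteq> 0}" for v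
  define W where "W v = \<Union>{\<sigma> \<in> K. v \<in> \<sigma>}" for v
  have coord: "continuous_on X (\<lambda>x. \<tau> x v)" for v
    using \<tau>(1) by (rule continuous_on_product_then_coordinatewise)
  have supp: "finite (W v)" "support (\<tau> x) \<subseteq> W v" if "x \<in> T v" for x v
  proof -
    show "finite (W v)" unfolding W_def using locally_finite_complexD[OF K] by auto
    have "x \<in> X" "\<tau> x v \<noteq> 0" using that unfolding T_def by simp_all
    then obtain \<sigma> where \<sigma>: "\<sigma> \<in> K" "\<tau> x \<in> closed_simplex \<sigma>"
      using image_subset_iff[THEN iffD1, OF \<tau>(2)] by blast
    have "v \<in> \<sigma>" using \<open>\<tau> x v \<noteq> 0\<close> closed_simplexD(2)[OF \<sigma>(2)] by metis
    then show "support (\<tau> x) \<subseteq> W v"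
      using closed_simplexD(4)[OF \<sigma>(2)] \<sigma>(1) unfolding W_def by blast
  qed
  have eq: "(\<Sum>u\<in>support (\<tau> x). \<tau> x u * F u x) = (\<Sum>u\<in>W v. \<tau> x u * F u x)"
    if "x \<in> T v" for x v
    using supp[OF that] by (rule sum_support)
  have "continuous_map (top_of_set X) euclidean (\<lambda>x. \<Sum>v\<in>support (\<tau> x). \<tau> x v * F v x)"
  proof (rule pasting_lemma[where I = UNIV and T = T
        and f = "\<lambda>v x. \<Sum>u\<in>W v. \<tau> x u * F u x"])
    fix v :: 'v assume "v \<in> UNIV"
    have "continuous_on (T v) (\<lambda>x. \<Sum>u\<in>W v. \<tau> x u * F u x)"
      by (intro continuous_intros continuous_on_subset[OF coord] continuous_on_subset[OF F])
        (auto simp: T_def)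
    moreover have "X \<inter> T v = T v" unfolding T_def by blast
    ultimately show "continuous_map (subtopology (top_of_set X) (T v)) euclidean
        (\<lambda>x. \<Sum>u\<in>W v. \<tau> x u * F u x)"
      by (simp add: subtopology_subtopology)
    have "openin (top_of_set X) (X \<inter> (\<lambda>x. \<tau> x v) -` (- {0}))"
      by (rule continuous_openin_preimage_gen[OF coord]) auto
    moreover have "X \<inter> (\<lambda>x. \<tau> x v) -` (- {0}) = T v" unfolding T_def by blast
    ultimately show "openin (top_of_set X) (T v)" by simp
  next
    fix u v x assume "x \<in> topspace (top_of_set X) \<inter> T u \<inter> T v"
    then have "x \<in> T u" "x \<in> T v" by auto
    then show "(\<Sum>w\<in>W u. \<tau> x w * F w x) = (\<Sum>w\<in>W v. \<tau> x w * F w x)"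
      using eq[of x u] eq[of x v] by simp
  next
    fix x assume "x \<in> topspace (top_of_set X)"
    then have "x \<in> X" by simp
    then obtain \<sigma> where \<sigma>: "\<tau> x \<in> closed_simplex \<sigma>"
      using image_subset_iff[THEN iffD1, OF \<tau>(2)] by blast
    obtain v where "\<tau> x v \<noteq> 0"
      using support_nonempty[OF \<sigma>] unfolding support_def by blast
    with \<open>x \<in> X\<close> have "x \<in> T v" unfolding T_def by simp
    then show "\<exists>v. v \<in> UNIV \<and> x \<in> T v \<and>
        (\<Sum>v\<in>support (\<tau> x). \<tau> x v * F v x) = (\<Sum>u\<in>W v. \<tau> x u * F u x)"
      using eq[OF \<open>x \<in> T v\<close>] \<open>x \<in> T v\<close> by blast
  qed
  then show ?thesis by simp
qed


section \<open>Contractions through contiguous simplicial maps\<close>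

text \<open>A contraction in discrete time that runs from \<open>\<infinity>\<close>, where every vertex has become
  stationary, down to \<open>0\<close>, where all vertices have the same image. Consecutive maps are contiguous
  simplicial maps.\<close>

definition contiguous_contraction :: "'v set set \<Rightarrow> (nat \<Rightarrow> 'v \<Rightarrow> 'v) \<Rightarrow> bool" where
  "contiguous_contraction L g \<longleftrightarrow>
     (\<forall>n. \<forall>\<sigma>\<in>L. g n ` \<sigma> \<union> g (Suc n) ` \<sigma> \<in> L) \<and>
     (\<forall>v\<in>\<Union>L. \<exists>N. \<forall>n\<ge>N. g n v = v) \<and>
     (\<exists>a. \<forall>v\<in>\<Union>L. g 0 v = a)"

text \<open>The function that is \<open>0\<close> up to \<open>1/(n+2)\<close>, is \<open>1\<close> from \<open>1/(n+1)\<close> on, and is affine in between.\<close>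

definition ramp :: "nat \<Rightarrow> real \<Rightarrow> real" where
  "ramp n s = min 1 (max 0 ((real n + 1) * (real n + 2) * s - (real n + 1)))"

lemma ramp_bounds: "0 \<le> ramp n s" "ramp n s \<le> 1"
  unfolding ramp_def by auto

lemma ramp_eq_0: "s * (real n + 2) \<le> 1 \<Longrightarrow> ramp n s = 0"
proof -
  assume "s * (real n + 2) \<le> 1"
  then have "(real n + 1) * (s * (real n + 2)) \<le> (real n + 1) * 1"
    by (intro mult_left_mono) auto
  then show ?thesis unfolding ramp_def by (simp add: mult_ac)
qed

lemma ramp_eq_1: "1 \<le> s * (real n + 1) \<Longrightarrow> ramp n s = 1"
proof -
  assume "1 \<le> s * (real n + 1)"
  then have "(real n + 2) * 1 \<le> (real n + 2) * (s * (real n + 1))"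
    by (intro mult_left_mono) auto
  also have "\<dots> = (real n + 1) * (real n + 2) * s"
    by (simp only: mult_ac)
  finally have "(real n + 1) + 1 \<le> (real n + 1) * (real n + 2) * s"
    by (simp only: mult_1_right add.assoc one_add_one)
  then have "1 \<le> (real n + 1) * (real n + 2) * s - (real n + 1)"
    by (simp only: le_diff_eq add.commute)
  then show ?thesis unfolding ramp_def by simp
qed

lemma continuous_on_ramp: "continuous_on X f \<Longrightarrow> continuous_on X (\<lambda>x. ramp n (f x))"
  unfolding ramp_def by (intro continuous_intros)

text \<open>The path that is at \<open>g n v\<close> at time \<open>1/(n+1)\<close> and moves along straight lines in between.
  For a vertex that becomes stationary, writing it as \<open>v\<close> plus the corrections that have begun by
  time \<open>s\<close> gives a finite sum with continuous terms, which makes continuity at \<open>s = 0\<close> evident.\<close>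

definition vertex_path :: "(nat \<Rightarrow> 'v \<Rightarrow> 'v) \<Rightarrow> 'v \<Rightarrow> real \<Rightarrow> 'v \<Rightarrow> real" where
  "vertex_path g v s w = of_bool (w = v) +
     (\<Sum>n | g n v \<noteq> g (Suc n) v. ramp n s * (of_bool (w = g n v) - of_bool (w = g (Suc n) v)))"

lemma continuous_on_vertex_path:
  "continuous_on X f \<Longrightarrow> continuous_on X (\<lambda>x. vertex_path g v (f x) w)"
  unfolding vertex_path_def by (intro continuous_intros continuous_on_ramp)

lemma vertex_path_0: "vertex_path g v 0 w = of_bool (w = v)"
  unfolding vertex_path_def by (simp add: ramp_eq_0)

text \<open>In this time interval the corrections with index below \<open>m\<close> have not begun, and those above
  \<open>m\<close> are complete and telescope.\<close>

lemma vertex_path_between: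
  assumes N: "\<forall>n\<ge>N. g n v = v"
    and s: "1 \<le> s * (real m + 2)" "s * (real m + 1) \<le> 1"
  shows "vertex_path g v s w =
    (1 - ramp m s) * of_bool (w = g (Suc m) v) + ramp m s * of_bool (w = g m v)"
proof -
  define a :: "nat \<Rightarrow> real" where "a n = of_bool (w = g n v)" for n
  define M where "M = max N (Suc m)"
  have "s \<ge> 0"
  proof (rule ccontr)
    assume "\<not> 0 \<le> s"
    then have "s * (real m + 2) \<le> 0" by (simp add: mult_nonpos_nonneg)
    then show False using s(1) by simp
  qed
  have sum_to: "(\<Sum>n<k. ramp n s * (a n - a (Suc n))) =
      ramp m s * (a m - a (Suc m)) + a (Suc m) - a k" if "Suc m \<le> k" for k
    using that
  proof (induction k rule: dec_induct)
    case base
    have "ramp n s = 0" if "n < m" for n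
    proof (rule ramp_eq_0)
      have "s * (real n + 2) \<le> s * (real m + 1)"
        using that \<open>s \<ge> 0\<close> by (intro mult_left_mono) auto
      then show "s * (real n + 2) \<le> 1" using s(2) by linarith
    qed
    then show ?case by simp
  next
    case (step k)
    have "s * (real m + 2) \<le> s * (real k + 1)"
      using step.hyps \<open>s \<ge> 0\<close> by (intro mult_left_mono) auto
    then have "ramp k s = 1" using s(1) by (intro ramp_eq_1) linarith
    then show ?case using step.IH by simp
  qed
  have "(\<Sum>n | g n v \<noteq> g (Suc n) v. ramp n s * (a n - a (Suc n))) =
      (\<Sum>n<M. ramp n s * (a n - a (Suc n)))"
  proof (rule sum.mono_neutral_left)
    have "n < N" if "g n v \<noteq> g (Suc n) v" for n
      using N that by (metis le_SucI not_less)
    then show "{n. g n v \<noteq> g (Suc n) v} \<subseteq> {..<M}" unfolding M_def by fastforce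
  qed (auto simp: a_def)
  also have "\<dots> = ramp m s * (a m - a (Suc m)) + a (Suc m) - a M"
    by (rule sum_to) (simp add: M_def)
  also have "a M = of_bool (w = v)" using N unfolding a_def M_def by simp
  finally have "vertex_path g v s w = ramp m s * (a m - a (Suc m)) + a (Suc m)"
    unfolding vertex_path_def a_def by simp
  then show ?thesis unfolding a_def by (simp only: algebra_simps)
qed

lemma unit_interval_cover:
  fixes s :: real
  assumes "0 < s" "s \<le> 1"
  obtains m :: nat where "1 \<le> s * (real m + 2)" "s * (real m + 1) \<le> 1"
proof
  define m where "m = nat (\<lfloor>1 / s\<rfloor> - 1)"
  have "1 \<le> 1 / s" using assms by simp
  then have "1 \<le> \<lfloor>1 / s\<rfloor>" by simp
  then have m: "real m = of_int \<lfloor>1 / s\<rfloor> - 1" unfolding m_def by simp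
  have "1 / s \<le> real m + 2" using m by linarith
  then show "1 \<le> s * (real m + 2)" using assms(1) by (simp add: field_simps)
  have "real m + 1 \<le> 1 / s" using m by linarith
  then show "s * (real m + 1) \<le> 1" using assms(1) by (simp add: field_simps)
qed

text \<open>An affine map is determined by the images \<open>E v\<close> of the vertices. This is the common source
  of the statements that a stage of a homotopy, or the extension of a vertex map, stays in the
  complex.\<close>

lemma convex_combination_in_closed_simplex:
  assumes "finite \<sigma>" "t \<in> closed_simplex \<sigma>"
    and E: "\<And>v. v \<in> \<sigma> \<Longrightarrow> E v \<in> closed_simplex \<tau>"
  shows "(\<lambda>w. \<Sum>v\<in>support t. t v * E v w) \<in> closed_simplex \<tau>"
proof -
  have eq: "(\<Sum>v\<in>support t. t v * E v w) = (\<Sum>v\<in>\<sigma>. t v * E v w)" for w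
    using assms(1) closed_simplexD(4)[OF assms(2)] by (rule sum_support)
  have "(\<Sum>w\<in>\<tau>. \<Sum>v\<in>\<sigma>. t v * E v w) = (\<Sum>v\<in>\<sigma>. t v * (\<Sum>w\<in>\<tau>. E v w))"
    by (subst sum.swap) (simp add: sum_distrib_left)
  also have "\<dots> = 1"
    using closed_simplexD(3)[OF E] closed_simplexD(3)[OF assms(2)] by simp
  finally show ?thesis
    unfolding eq closed_simplex_alt
    using closed_simplexD(1)[OF assms(2)] closed_simplexD(1,2)[OF E] by (auto intro!: sum_nonneg)
qed

lemma vertex_in_closed_simplex:
  assumes "finite \<sigma>" "v \<in> \<sigma>"
  shows "(\<lambda>w. of_bool (w = v)) \<in> closed_simplex \<sigma>"
proof -
  have "(\<Sum>w\<in>\<sigma>. of_bool (w = v) :: real) = 1"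
    using assms by (subst sum.remove[of _ v]) auto
  then show ?thesis using assms(2) unfolding closed_simplex_alt by auto
qed

lemma segment_in_closed_simplex:
  assumes "p \<in> closed_simplex \<sigma>" "q \<in> closed_simplex \<sigma>" "0 \<le> r" "r \<le> 1"
  shows "(\<lambda>w. (1 - r) * p w + r * q w) \<in> closed_simplex \<sigma>"
proof -
  have "(\<Sum>w\<in>\<sigma>. (1 - r) * p w + r * q w) = (1 - r) * sum p \<sigma> + r * sum q \<sigma>"
    by (simp only: sum.distrib sum_distrib_left)
  then have "(\<Sum>w\<in>\<sigma>. (1 - r) * p w + r * q w) = 1"
    using closed_simplexD(3)[OF assms(1)] closed_simplexD(3)[OF assms(2)] by simp
  then show ?thesis
    using assms(3,4) closed_simplexD(1,2)[OF assms(1)] closed_simplexD(1,2)[OF assms(2)]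
    unfolding closed_simplex_alt by auto
qed

text \<open>The vertex paths extend affinely to all points. At a time between \<open>1/(m+2)\<close> and \<open>1/(m+1)\<close>
  they send the vertices of \<open>\<sigma>\<close> into the simplex \<open>g m ` \<sigma> \<union> g (Suc m) ` \<sigma>\<close>, so the extension stays
  inside the complex.\<close>

theorem contractible_contiguous_contraction:
  assumes L: "locally_finite_complex L" and g: "contiguous_contraction L g"
  shows "contractible (underlying_set L)"
proof -
  let ?X = "underlying_set L"
  define H where "H = (\<lambda>(s, t) w. \<Sum>v\<in>support t. t v * vertex_path g v s w)"
  have contig: "g n ` \<sigma> \<union> g (Suc n) ` \<sigma> \<in> L" if "\<sigma> \<in> L" for n \<sigma>
    using g that unfolding contiguous_contraction_def by blast
  have stable: "\<exists>N. \<forall>n\<ge>N. g n v = v" if "v \<in> \<sigma>" "\<sigma> \<in> L" for v \<sigma>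
    using g that unfolding contiguous_contraction_def by blast
  obtain a where "\<forall>v\<in>\<Union>L. g 0 v = a"
    using g unfolding contiguous_contraction_def by (elim conjE exE)
  then have a: "g 0 v = a" if "v \<in> \<sigma>" "\<sigma> \<in> L" for v \<sigma>
    using that by blast
  have cont: "continuous_on ({0..1} \<times> ?X) H"
  proof (rule continuous_on_coordinatewise_then_product)
    fix w
    have "continuous_on ({0..1} \<times> ?X)
        (\<lambda>x. \<Sum>v\<in>support (snd x). snd x v * vertex_path g v (fst x) w)"
      by (rule continuous_on_weighted_sum[OF L])
        (auto intro!: continuous_on_fst continuous_on_snd continuous_on_id continuous_on_vertex_path)
    then show "continuous_on ({0..1} \<times> ?X) (\<lambda>x. H x w)"
      by (simp add: H_def case_prod_unfold)
  qed
  have into: "H (s, t) \<in> ?X" if s: "s \<in> {0..1}" and t: "t \<in> ?X" for s t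
  proof -
    obtain \<sigma> where \<sigma>: "\<sigma> \<in> L" "t \<in> closed_simplex \<sigma>" using t by blast
    have fin: "finite \<sigma>" using locally_finite_complexD(1)[OF L \<sigma>(1)] .
    obtain \<tau> where \<tau>: "\<tau> \<in> L" "\<And>v. v \<in> \<sigma> \<Longrightarrow> vertex_path g v s \<in> closed_simplex \<tau>"
    proof (cases "s = 0")
      case True
      have "vertex_path g v s \<in> closed_simplex \<sigma>" if "v \<in> \<sigma>" for v
        using vertex_in_closed_simplex[OF fin that] vertex_path_0[of g v] True by presburger
      then show ?thesis using that \<sigma>(1) by blast
    next
      case False
      with s have "0 < s" "s \<le> 1" by auto
      then obtain m where m: "1 \<le> s * (real m + 2)" "s * (real m + 1) \<le> 1"
        by (rule unit_interval_cover)
      let ?\<tau> = "g m ` \<sigma> \<union> g (Suc m) ` \<sigma>"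
      have "vertex_path g v s \<in> closed_simplex ?\<tau>" if v: "v \<in> \<sigma>" for v
      proof -
        obtain N where N: "\<forall>n\<ge>N. g n v = v" using stable[OF v \<sigma>(1)] by blast
        have "vertex_path g v s =
            (\<lambda>w. (1 - ramp m s) * of_bool (w = g (Suc m) v) + ramp m s * of_bool (w = g m v))"
          using vertex_path_between[where g = g and v = v and N = N, OF N m] by (rule ext)
        also have "\<dots> \<in> closed_simplex ?\<tau>"
          using fin v by (intro segment_in_closed_simplex vertex_in_closed_simplex ramp_bounds) auto
        finally show ?thesis .
      qed
      then show ?thesis using that contig[OF \<sigma>(1)] by blast
    qed
    have "H (s, t) \<in> closed_simplex \<tau>"
      unfolding H_def using convex_combination_in_closed_simplex[OF fin \<sigma>(2) \<tau>(2)] by simp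
    then show ?thesis using \<tau>(1) by blast
  qed
  have start: "H (0, t) = t" if t: "t \<in> ?X" for t
  proof
    fix w
    obtain \<sigma> where \<sigma>: "\<sigma> \<in> L" "t \<in> closed_simplex \<sigma>" using t by blast
    have fin: "finite \<sigma>" using locally_finite_complexD(1)[OF L \<sigma>(1)] .
    have "H (0, t) w = (\<Sum>v\<in>insert w \<sigma>. t v * of_bool (w = v))"
      unfolding H_def prod.case vertex_path_0
      using fin closed_simplexD(4)[OF \<sigma>(2)] by (intro sum_support) auto
    also have "\<dots> = t w"
      using fin by (subst sum.remove[of _ w]) auto
    finally show "H (0, t) w = t w" .
  qed
  have stop: "H (1, t) = (\<lambda>w. of_bool (w = a))" if t: "t \<in> ?X" for t
  proof
    fix w
    obtain \<sigma> where \<sigma>: "\<sigma> \<in> L" "t \<in> closed_simplex \<sigma>" using t by blast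
    have fin: "finite \<sigma>" using locally_finite_complexD(1)[OF L \<sigma>(1)] .
    have vp: "vertex_path g v 1 w = of_bool (w = a)" if v: "v \<in> \<sigma>" for v
    proof -
      obtain N where N: "\<forall>n\<ge>N. g n v = v" using stable[OF v \<sigma>(1)] by blast
      show ?thesis
        using vertex_path_between[where g = g and v = v and N = N, OF N, of 1 0 w] a[OF v \<sigma>(1)] by (simp add: ramp_eq_1)
    qed
    have "H (1, t) w = (\<Sum>v\<in>\<sigma>. t v * vertex_path g v 1 w)"
      unfolding H_def prod.case using fin closed_simplexD(4)[OF \<sigma>(2)] by (intro sum_support) auto
    also have "\<dots> = sum t \<sigma> * of_bool (w = a)" unfolding sum_distrib_right by (simp add: vp)
    finally show "H (1, t) w = of_bool (w = a)" using closed_simplexD(3)[OF \<sigma>(2)] by simp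
  qed
  have "H ` ({0..1} \<times> ?X) \<subseteq> ?X"
  proof (rule image_subsetI)
    fix x assume "x \<in> {0..1::real} \<times> ?X"
    then show "H x \<in> ?X"
      using into[of "fst x" "snd x"] by (simp only: mem_Times_iff prod.collapse)
  qed
  then have "homotopic_with_canon (\<lambda>x. True) ?X ?X id (\<lambda>x w. of_bool (w = a))"
    using cont start stop
    by (subst homotopic_with) (simp_all only: id_apply topspace_euclidean_subtopology
      prod_topology_subtopology_eu continuous_map_subtopology_eu image_subset_iff_funcset, blast)
  then show ?thesis unfolding contractible_def by blast
qed

text \<open>The order-theoretic counterpart: self-maps of a poset of sets, consecutive ones
  comparable, hence homotopic on the order complex.\<close>

definition monotone_contraction :: "'v set set \<Rightarrow> (nat \<Rightarrow> 'v set \<Rightarrow> 'v set) \<Rightarrow> bool" where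
  "monotone_contraction Q G \<longleftrightarrow>
     (\<forall>n. \<forall>x\<in>Q. G n x \<in> Q) \<and>
     (\<forall>n. \<forall>x\<in>Q. \<forall>y\<in>Q. x \<subseteq> y \<longrightarrow> G n x \<subseteq> G n y) \<and>
     (\<forall>n. (\<forall>x\<in>Q. G n x \<subseteq> G (Suc n) x) \<or> (\<forall>x\<in>Q. G (Suc n) x \<subseteq> G n x)) \<and>
     (\<forall>x\<in>Q. \<exists>N. \<forall>n\<ge>N. G n x = x) \<and>
     (\<exists>a. \<forall>x\<in>Q. G 0 x = a)"

lemma monotone_contractionD:
  assumes "monotone_contraction Q G"
  shows "x \<in> Q \<Longrightarrow> G n x \<in> Q"
    and "x \<in> Q \<Longrightarrow> y \<in> Q \<Longrightarrow> x \<subseteq> y \<Longrightarrow> G n x \<subseteq> G n y"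
    and "(\<forall>x\<in>Q. G n x \<subseteq> G (Suc n) x) \<or> (\<forall>x\<in>Q. G (Suc n) x \<subseteq> G n x)"
    and "x \<in> Q \<Longrightarrow> \<exists>N. \<forall>n\<ge>N. G n x = x"
    and "\<exists>a. \<forall>x\<in>Q. G 0 x = a"
  using assms unfolding monotone_contraction_def by (elim conjE; simp)+

text \<open>Contiguous maps become comparable on the face poset once the map \<open>\<sigma> \<mapsto> g n ` \<sigma> \<union> g (Suc n)
  ` \<sigma>\<close>, which is above both of them, is inserted.\<close>

lemma contiguous_imp_monotone_contraction:
  assumes L: "\<And>\<sigma>. \<sigma> \<in> L \<Longrightarrow> finite \<sigma> \<and> \<sigma> \<noteq> {}"
    and faces: "\<And>\<sigma> \<tau>. \<sigma> \<in> L \<Longrightarrow> \<tau> \<subseteq> \<sigma> \<Longrightarrow> \<tau> \<noteq> {} \<Longrightarrow> \<tau> \<in> L"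
    and g: "contiguous_contraction L g"
  shows "monotone_contraction L
    (\<lambda>n \<sigma>. if even n then g (n div 2) ` \<sigma> else g (n div 2) ` \<sigma> \<union> g (Suc (n div 2)) ` \<sigma>)"
    (is "monotone_contraction L ?G")
  unfolding monotone_contraction_def
proof (intro conjI allI ballI impI)
  have contig: "g n ` \<sigma> \<union> g (Suc n) ` \<sigma> \<in> L" if "\<sigma> \<in> L" for n \<sigma>
    using g that unfolding contiguous_contraction_def by blast
  show "?G n \<sigma> \<in> L" if "\<sigma> \<in> L" for n \<sigma>
    using contig[OF that, of "n div 2"] faces[OF contig[OF that, of "n div 2"], of "g (n div 2) ` \<sigma>"]
      L[OF that] by auto
  show "?G n \<sigma> \<subseteq> ?G n \<tau>" if "\<sigma> \<subseteq> \<tau>" for n \<sigma> \<tau>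
    using that by auto
  show "(\<forall>\<sigma>\<in>L. ?G n \<sigma> \<subseteq> ?G (Suc n) \<sigma>) \<or> (\<forall>\<sigma>\<in>L. ?G (Suc n) \<sigma> \<subseteq> ?G n \<sigma>)" for n
    by (cases "even n") (auto elim: oddE)
  show "\<exists>N. \<forall>n\<ge>N. ?G n \<sigma> = \<sigma>" if \<sigma>: "\<sigma> \<in> L" for \<sigma>
  proof -
    have "\<forall>v\<in>\<Union>L. \<exists>N. \<forall>n\<ge>N. g n v = v"
      using g unfolding contiguous_contraction_def by (elim conjE)
    then have "\<forall>v\<in>\<sigma>. \<exists>N. \<forall>n\<ge>N. g n v = v"
      using \<sigma> by auto
    then have "\<exists>N. \<forall>v\<in>\<sigma>. \<forall>n\<ge>N v. g n v = v" by (rule bchoice)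
    then obtain N where N: "\<And>v n. v \<in> \<sigma> \<Longrightarrow> n \<ge> N v \<Longrightarrow> g n v = v" by blast
    define M where "M = Max (N ` \<sigma>)"
    have fix_v: "g n v = v" if "v \<in> \<sigma>" "n \<ge> M" for n v
      using N that L[OF \<sigma>] unfolding M_def by simp
    have "g n ` \<sigma> = \<sigma>" if "n \<ge> M" for n
      using fix_v that by force
    then have "?G n \<sigma> = \<sigma>" if "n \<ge> 2 * M" for n
      using that by (simp add: le_SucI)
    then show ?thesis by blast
  qed
  obtain a where a: "\<forall>v\<in>\<Union>L. g 0 v = a"
    using g unfolding contiguous_contraction_def by (elim conjE exE)
  have "?G 0 \<sigma> = {a}" if "\<sigma> \<in> L" for \<sigma>
    using a L[OF that] that by (auto simp: image_iff)
  then show "\<exists>a. \<forall>\<sigma>\<in>L. ?G 0 \<sigma> = a" by blast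
qed

lemma bary_chainD:
  assumes "c \<in> barycentric_subdivision K"
  shows "finite c" "c \<noteq> {}" "\<sigma> \<in> c \<Longrightarrow> \<sigma> \<in> K" "\<sigma> \<in> c \<Longrightarrow> \<tau> \<in> c \<Longrightarrow> \<sigma> \<subseteq> \<tau> \<or> \<tau> \<subseteq> \<sigma>"
  using assms unfolding barycentric_subdivision_def by blast+

lemma bary_subset_closed:
  assumes "c \<in> barycentric_subdivision K" "b \<subseteq> c" "b \<noteq> {}"
  shows "b \<in> barycentric_subdivision K"
proof -
  have "finite b" using bary_chainD(1)[OF assms(1)] assms(2) by (rule finite_subset[rotated])
  moreover have "b \<subseteq> K" using bary_chainD(3)[OF assms(1)] assms(2) by blast
  moreover have "\<forall>\<sigma>\<in>b. \<forall>\<tau>\<in>b. \<sigma> \<subseteq> \<tau> \<or> \<tau> \<subseteq> \<sigma>"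
    using bary_chainD(4)[OF assms(1)] assms(2) by (meson subsetD)
  ultimately show ?thesis using assms(3) unfolding barycentric_subdivision_def by simp
qed

text \<open>The members of a chain have distinct cardinalities.\<close>

lemma card_chain_le:
  assumes K: "\<And>\<sigma>. \<sigma> \<in> K \<Longrightarrow> finite \<sigma> \<and> \<sigma> \<noteq> {} \<and> card \<sigma> \<le> M"
    and c: "c \<in> barycentric_subdivision K"
  shows "card c \<le> M"
proof -
  have "inj_on card c"
  proof (rule inj_onI)
    fix \<sigma> \<tau> assume "\<sigma> \<in> c" "\<tau> \<in> c" "card \<sigma> = card \<tau>"
    then show "\<sigma> = \<tau>"
      using bary_chainD(4)[OF c, of \<sigma> \<tau>] bary_chainD(3)[OF c] K
        card_subset_eq[of \<sigma> \<tau>] card_subset_eq[of \<tau> \<sigma>] by metis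
  qed
  moreover have "card ` c \<subseteq> {1..M}"
    using bary_chainD(3)[OF c] K by (auto simp: Suc_le_eq card_gt_0_iff)
  ultimately have "card c \<le> card {1..M}"
    by (intro card_inj_on_le) auto
  then show ?thesis by simp
qed

text \<open>Two comparable monotone maps need not be contiguous on the order complex: on a chain
  their images may be incomparable. They are joined by maps that already agree with the new one
  on sets of large (or small) cardinality and still agree with the old one elsewhere. Passing to
  the next of these maps changes the value at no more than one member of each chain, and
  contiguity follows.\<close>

lemma monotone_imp_contiguous_contraction:
  assumes Q: "\<And>x. x \<in> Q \<Longrightarrow> finite x \<and> card x \<le> M"
    and G: "monotone_contraction Q G"
  shows "\<exists>g. contiguous_contraction (barycentric_subdivision Q) g"
proof -
  define up where "up i \<longleftrightarrow> (\<forall>x\<in>Q. G i x \<subseteq> G (Suc i) x)" for i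
  \<comment> \<open>Between stages \<open>i\<close> and \<open>Suc i\<close> there are \<open>Suc M\<close> steps. Monotonicity is kept by changing
    large sets first if the values grow, and small sets first if they shrink.\<close>
  define T where "T i j x = (if (if up i then M < card x + j else card x < j)
    then G (Suc i) x else G i x)" for i j x
  define g where "g n = T (n div Suc M) (n mod Suc M)" for n
  note closed = monotone_contractionD(1)[OF G] and mono = monotone_contractionD(2)[OF G]
  have down: "G (Suc i) x \<subseteq> G i x" if "\<not> up i" "x \<in> Q" for i x
    using monotone_contractionD(3)[OF G, of i] that unfolding up_def by blast
  have T_cases: "T i j x = G i x \<or> T i j x = G (Suc i) x" for i j x
    unfolding T_def by simp
  have g_Suc: "g (Suc n) x = T (n div Suc M) (Suc (n mod Suc M)) x" if "x \<in> Q" for n x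
  proof (cases "Suc (n mod Suc M) = Suc M")
    case True
    then have "Suc n div Suc M = Suc (n div Suc M)" "Suc n mod Suc M = 0"
      by (simp_all add: div_Suc mod_Suc)
    then show ?thesis
      using Q[OF that] True unfolding g_def T_def by auto
  next
    case False
    then have "Suc n div Suc M = n div Suc M" "Suc n mod Suc M = Suc (n mod Suc M)"
      by (simp_all add: div_Suc mod_Suc)
    then show ?thesis unfolding g_def by simp
  qed
  have comparable: "T i j' x \<subseteq> T i j'' y \<or> T i j'' y \<subseteq> T i j' x"
    if xy: "x \<in> Q" "y \<in> Q" "x \<subseteq> y" and j: "j' = j \<or> j' = Suc j" "j'' = j \<or> j'' = Suc j"
    for i j j' j'' x y
  proof -
    have card: "card x \<le> card y" "card y \<le> card x \<Longrightarrow> x = y"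
      using Q[OF xy(2)] xy(3) card_mono[of y x] card_seteq[of y x] by simp_all
    show ?thesis
    proof (cases "up i")
      case True
      then have inc: "G i x \<subseteq> G (Suc i) x" "G i y \<subseteq> G (Suc i) y"
        using xy unfolding up_def by blast+
      \<comment> \<open>The smaller set can be ahead of the larger one only if both have the same
        cardinality.\<close>
      have "T i j' x \<subseteq> T i j'' y \<or> x = y"
      proof (cases "M < card x + j' \<and> \<not> M < card y + j''")
        case True
        then have "card y \<le> card x" using j by linarith
        then show ?thesis using card(2) by blast
      next
        case False
        then show ?thesis
          using inc mono[OF xy, of i] mono[OF xy, of "Suc i"] \<open>up i\<close> unfolding T_def by auto
      qed
      then show ?thesis
        using T_cases[of i j' x] T_cases[of i j'' x] inc by auto
    next
      case False
      then have dec: "G (Suc i) x \<subseteq> G i x" "G (Suc i) y \<subseteq> G i y"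
        using xy down by blast+
      have "T i j' x \<subseteq> T i j'' y \<or> x = y"
      proof (cases "\<not> card x < j' \<and> card y < j''")
        case True
        then have "card y \<le> card x" using j by linarith
        then show ?thesis using card(2) by blast
      next
        case False
        then show ?thesis
          using dec mono[OF xy, of i] mono[OF xy, of "Suc i"] \<open>\<not> up i\<close> unfolding T_def by auto
      qed
      then show ?thesis
        using T_cases[of i j' x] T_cases[of i j'' x] dec by auto
    qed
  qed
  have "contiguous_contraction (barycentric_subdivision Q) g"
    unfolding contiguous_contraction_def
  proof (intro conjI allI ballI)
    fix n c assume c: "c \<in> barycentric_subdivision Q"
    define i j where "i = n div Suc M" and "j = n mod Suc M"
    have "g (Suc n) ` c = T i (Suc j) ` c"
      using g_Suc bary_chainD(3)[OF c] unfolding i_def j_def by (intro image_cong) auto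
    then have eq: "g n ` c \<union> g (Suc n) ` c = T i j ` c \<union> T i (Suc j) ` c"
      unfolding g_def i_def j_def by simp
    have mem: "\<exists>j' x. x \<in> c \<and> (j' = j \<or> j' = Suc j) \<and> y = T i j' x"
      if "y \<in> T i j ` c \<union> T i (Suc j) ` c" for y
      using that by blast
    show "g n ` c \<union> g (Suc n) ` c \<in> barycentric_subdivision Q"
      unfolding eq barycentric_subdivision_def mem_Collect_eq
    proof (intro conjI ballI)
      show "T i j ` c \<union> T i (Suc j) ` c \<subseteq> Q"
        using T_cases closed bary_chainD(3)[OF c] by (smt (verit, best) UnE imageE subsetI)
      fix y z assume "y \<in> T i j ` c \<union> T i (Suc j) ` c" "z \<in> T i j ` c \<union> T i (Suc j) ` c"
      then obtain j1 j2 u v where uv: "u \<in> c" "v \<in> c" "j1 = j \<or> j1 = Suc j" "j2 = j \<or> j2 = Suc j"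
        "y = T i j1 u" "z = T i j2 v"
        using mem by metis
      have "u \<subseteq> v \<or> v \<subseteq> u" using bary_chainD(4)[OF c uv(1,2)] .
      then show "y \<subseteq> z \<or> z \<subseteq> y"
        using comparable[of u v j1 j j2 i] comparable[of v u j2 j j1 i] uv
          bary_chainD(3)[OF c] by blast
    qed (use bary_chainD(1,2)[OF c] in auto)
  next
    fix x assume "x \<in> \<Union>(barycentric_subdivision Q)"
    then have "x \<in> Q" using bary_chainD(3) by blast
    then obtain N where N: "\<forall>n\<ge>N. G n x = x"
      using monotone_contractionD(4)[OF G] by blast
    have "g n x = x" if "n \<ge> N * Suc M" for n
    proof -
      have "n div Suc M \<ge> N" using that by (simp add: less_eq_div_iff_mult_less_eq)
      then show ?thesis
        using T_cases[of "n div Suc M" "n mod Suc M" x] N unfolding g_def by auto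
    qed
    then show "\<exists>N. \<forall>n\<ge>N. g n x = x" by blast
  next
    obtain a where a: "\<forall>x\<in>Q. G 0 x = a"
      using monotone_contractionD(5)[OF G] by blast
    have "g 0 x = a" if "x \<in> \<Union>(barycentric_subdivision Q)" for x
    proof -
      from that have "x \<in> Q" using bary_chainD(3) by blast
      then show ?thesis using bspec[OF a] Q[of x] unfolding g_def T_def by simp
    qed
    then show "\<exists>a. \<forall>x\<in>\<Union>(barycentric_subdivision Q). g 0 x = a" by (intro exI ballI)
  qed
  then show ?thesis by blast
qed

text \<open>The bound on cardinalities passes to the order complex, so that the two preceding lemmas
  can be alternated.\<close>

theorem contractible_double_subdivision:
  assumes lf: "locally_finite_complex Q" and card: "\<And>x. x \<in> Q \<Longrightarrow> card x \<le> M"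
    and G: "monotone_contraction Q G"
  shows "contractible (underlying_set (barycentric_subdivision (barycentric_subdivision Q)))"
proof -
  note lf1 = locally_finite_barycentric_subdivision[OF lf]
  note lf2 = locally_finite_barycentric_subdivision[OF lf1]
  have Q: "finite x \<and> x \<noteq> {} \<and> card x \<le> M" if "x \<in> Q" for x
    using card[OF that] locally_finite_complexD(1,2)[OF lf that] by simp
  have "\<exists>g. contiguous_contraction (barycentric_subdivision Q) g"
    by (rule monotone_imp_contiguous_contraction[OF _ G, of M]) (simp add: Q)
  then obtain g where g: "contiguous_contraction (barycentric_subdivision Q) g" ..
  have simplex: "finite c \<and> c \<noteq> {}" if "c \<in> barycentric_subdivision Q" for c
    using bary_chainD(1,2)[OF that] by simp
  note G1 = contiguous_imp_monotone_contraction[OF simplex bary_subset_closed g]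
  have card1: "finite c \<and> card c \<le> M" if "c \<in> barycentric_subdivision Q" for c
    using card_chain_le[OF Q that] simplex[OF that] by simp
  have "\<exists>g. contiguous_contraction (barycentric_subdivision (barycentric_subdivision Q)) g"
    by (rule monotone_imp_contiguous_contraction[OF card1 G1])
  then obtain g2 where
    "contiguous_contraction (barycentric_subdivision (barycentric_subdivision Q)) g2" ..
  then show ?thesis
    by (rule contractible_contiguous_contraction[OF lf2])
qed


section \<open>Word metrics\<close>

locale word_metric_group = group G for G (structure) +
  fixes S :: "'a set"
  assumes finite_generators: "finite S" and generators_closed: "S \<subseteq> carrier G"
    and generate_carrier: "generate G S = carrier G"
    and symmetric: "(\<lambda>s. inv s) ` S = S"
begin

abbreviation word_product :: "'a list \<Rightarrow> 'a" where
  "word_product ws \<equiv> foldr (\<otimes>) ws \<one>"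

abbreviation dst :: "'a \<Rightarrow> 'a \<Rightarrow> nat" where
  "dst \<equiv> word_dist G S"

lemma word_product_closed: "set ws \<subseteq> S \<Longrightarrow> word_product ws \<in> carrier G"
  using generators_closed by (induction ws) auto

lemma word_product_append:
  "set us \<subseteq> S \<Longrightarrow> set vs \<subseteq> S \<Longrightarrow>
    word_product (us @ vs) = word_product us \<otimes> word_product vs"
proof (induction us)
  case Nil
  then show ?case using word_product_closed by simp
next
  case (Cons u us)
  then have "u \<in> carrier G" "set us \<subseteq> S" using generators_closed by auto
  then show ?case using Cons word_product_closed by (simp add: m_assoc)
qed

lemma word_product_inverse:
  assumes "set ws \<subseteq> S"
  shows "\<exists>us. length us = length ws \<and> set us \<subseteq> S \<and> word_product us = inv (word_product ws)"
  using assms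
proof (induction ws)
  case Nil
  then show ?case by simp
next
  case (Cons w ws)
  then obtain us where us: "length us = length ws" "set us \<subseteq> S"
    "word_product us = inv (word_product ws)" by auto
  have w: "w \<in> carrier G" "inv w \<in> S" using Cons.prems generators_closed symmetric by auto
  have "word_product (us @ [inv w]) = word_product us \<otimes> word_product [inv w]"
    by (rule word_product_append) (use us w in auto)
  also have "\<dots> = inv (word_product (w # ws))"
    using us(3) w Cons.prems word_product_closed[of ws] by (simp add: inv_mult_group)
  finally show ?case using us(1,2) w(2) by (intro exI[of _ "us @ [inv w]"]) simp
qed

text \<open>Words without inverses suffice because the generating set is symmetric.\<close>

lemma word_exists:
  assumes "g \<in> carrier G"
  shows "\<exists>ws. set ws \<subseteq> S \<and> word_product ws = g"
proof -
  have "g \<in> generate G S" using assms generate_carrier by simp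
  then show ?thesis
  proof (induction rule: generate.induct)
    case one
    show ?case by (rule exI[of _ "[]"]) simp
  next
    case (incl h)
    then show ?case using generators_closed by (intro exI[of _ "[h]"]) auto
  next
    case (inv h)
    then have "inv h \<in> S" using symmetric by blast
    then show ?case using generators_closed by (intro exI[of _ "[inv h]"]) auto
  next
    case (eng h1 h2)
    then obtain us vs where "set us \<subseteq> S" "word_product us = h1" "set vs \<subseteq> S" "word_product vs = h2"
      by blast
    then show ?case using word_product_append by (intro exI[of _ "us @ vs"]) auto
  qed
qed

lemma dst_word:
  assumes "x \<in> carrier G" "y \<in> carrier G"
  obtains ws where "length ws = dst x y" "set ws \<subseteq> S" "y = x \<otimes> word_product ws"
proof -
  let ?P = "\<lambda>n. \<exists>ws. length ws = n \<and> set ws \<subseteq> S \<and> inv x \<otimes> y = word_product ws"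
  obtain ws where "set ws \<subseteq> S" "word_product ws = inv x \<otimes> y"
    using word_exists[of "inv x \<otimes> y"] assms by auto
  then have "\<exists>n. ?P n" by (intro exI[of _ "length ws"] exI[of _ ws]) simp
  then have "?P (dst x y)" unfolding word_dist_def by (rule LeastI_ex)
  then obtain us where us: "length us = dst x y" "set us \<subseteq> S" "inv x \<otimes> y = word_product us"
    by blast
  have "y = x \<otimes> (inv x \<otimes> y)" using assms by (simp add: m_assoc[symmetric])
  then show thesis using that us by simp
qed

lemma dst_le:
  assumes "x \<in> carrier G" "set ws \<subseteq> S"
  shows "dst x (x \<otimes> word_product ws) \<le> length ws"
proof -
  have "inv x \<otimes> (x \<otimes> word_product ws) = word_product ws"
    using assms word_product_closed by (simp add: m_assoc[symmetric])
  then show ?thesis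
    unfolding word_dist_def using assms(2) by (intro Least_le) blast
qed

lemma dst_self: "x \<in> carrier G \<Longrightarrow> dst x x = 0"
  using dst_le[of x "[]"] by simp

lemma dst_triangle:
  assumes "x \<in> carrier G" "y \<in> carrier G" "z \<in> carrier G"
  shows "dst x z \<le> dst x y + dst y z"
proof -
  obtain us where us: "length us = dst x y" "set us \<subseteq> S" "y = x \<otimes> word_product us"
    using dst_word assms by metis
  obtain vs where vs: "length vs = dst y z" "set vs \<subseteq> S" "z = y \<otimes> word_product vs"
    using dst_word assms by metis
  have "z = (x \<otimes> word_product us) \<otimes> word_product vs" using us(3) vs(3) by simp
  also have "\<dots> = x \<otimes> word_product (us @ vs)"
    using word_product_append[OF us(2) vs(2)] word_product_closed us(2) vs(2) assms(1)
    by (simp add: m_assoc)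
  finally show ?thesis using dst_le[of x "us @ vs"] us vs assms by simp
qed

lemma dst_commute:
  assumes "x \<in> carrier G" "y \<in> carrier G"
  shows "dst x y = dst y x"
proof -
  have le: "dst b a \<le> dst a b" if ab: "a \<in> carrier G" "b \<in> carrier G" for a b
  proof -
    obtain ws where ws: "length ws = dst a b" "set ws \<subseteq> S" "b = a \<otimes> word_product ws"
      using dst_word ab by metis
    obtain us where us: "length us = length ws" "set us \<subseteq> S" "word_product us = inv (word_product ws)"
      using word_product_inverse[OF ws(2)] by blast
    have "a = b \<otimes> word_product us"
      unfolding us(3) ws(3) using ab word_product_closed[OF ws(2)] by (simp add: m_assoc)
    then show ?thesis using dst_le[OF ab(2) us(2)] us ws by simp
  qed
  show ?thesis using le assms by (simp add: le_antisym)
qed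

lemma dst_left_invariant:
  assumes "g \<in> carrier G" "x \<in> carrier G" "y \<in> carrier G"
  shows "dst (g \<otimes> x) (g \<otimes> y) = dst x y"
proof -
  have "inv (g \<otimes> x) \<otimes> (g \<otimes> y) = inv x \<otimes> (inv g \<otimes> (g \<otimes> y))"
    using assms by (simp add: inv_mult_group m_assoc)
  also have "inv g \<otimes> (g \<otimes> y) = y" using assms by (simp add: m_assoc[symmetric])
  finally show ?thesis unfolding word_dist_def by simp
qed

text \<open>Cut a shortest word from \<open>x\<close> to \<open>y\<close> after \<open>k\<close> letters; the triangle inequality makes both
  estimates sharp.\<close>

lemma geodesic_point:
  assumes "x \<in> carrier G" "y \<in> carrier G" "k \<le> dst x y"
  obtains m where "m \<in> carrier G" "dst x m = k" "dst m y = dst x y - k"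
proof -
  obtain ws where ws: "length ws = dst x y" "set ws \<subseteq> S" "y = x \<otimes> word_product ws"
    using dst_word assms by metis
  let ?m = "x \<otimes> word_product (take k ws)"
  have sub: "set (take k ws) \<subseteq> S" "set (drop k ws) \<subseteq> S"
    using order_trans[OF set_take_subset ws(2)] order_trans[OF set_drop_subset ws(2)] by simp_all
  have m: "?m \<in> carrier G" using assms word_product_closed[OF sub(1)] by simp
  have "x \<otimes> word_product (take k ws @ drop k ws) = ?m \<otimes> word_product (drop k ws)"
    unfolding word_product_append[OF sub]
    using assms(1) word_product_closed[OF sub(1)] word_product_closed[OF sub(2)]
    by (rule m_assoc[symmetric])
  then have "?m \<otimes> word_product (drop k ws) = y"
    unfolding append_take_drop_id ws(3)[symmetric] by (rule sym)
  then have "dst ?m y \<le> dst x y - k"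
    using dst_le[OF m sub(2)] by (simp only: length_drop ws(1))
  moreover have "dst x ?m \<le> k"
    using dst_le[OF assms(1) sub(1)] by (simp only: length_take min.bounded_iff)
  moreover have "dst x y \<le> dst x ?m + dst ?m y" using dst_triangle assms m by simp
  ultimately have "dst x ?m = k" "dst ?m y = dst x y - k" using assms(3) by linarith+
  then show thesis using that m by blast
qed

lemma finite_ball:
  assumes "x \<in> carrier G"
  shows "finite {y \<in> carrier G. dst x y \<le> n}"
proof -
  have "{y \<in> carrier G. dst x y \<le> n} \<subseteq>
      (\<lambda>ws. x \<otimes> word_product ws) ` {ws. set ws \<subseteq> S \<and> length ws \<le> n}"
  proof
    fix y assume y: "y \<in> {y \<in> carrier G. dst x y \<le> n}"
    then obtain ws where "length ws = dst x y" "set ws \<subseteq> S" "y = x \<otimes> word_product ws"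
      using dst_word[of x y] assms by blast
    with y show "y \<in> (\<lambda>ws. x \<otimes> word_product ws) ` {ws. set ws \<subseteq> S \<and> length ws \<le> n}"
      by (intro image_eqI[of _ _ ws]) auto
  qed
  then show ?thesis
    using finite_lists_length_le[OF finite_generators, of n] by (meson finite_imageI finite_subset)
qed

abbreviation rips :: "nat \<Rightarrow> 'a set set" where
  "rips \<equiv> rips_complex G S"

lemma ripsD:
  assumes "\<sigma> \<in> rips d"
  shows "finite \<sigma>" "\<sigma> \<noteq> {}" "\<sigma> \<subseteq> carrier G" "x \<in> \<sigma> \<Longrightarrow> y \<in> \<sigma> \<Longrightarrow> dst x y \<le> d"
  using assms unfolding rips_complex_def by auto

lemma ripsI:
  assumes "finite \<sigma>" "\<sigma> \<noteq> {}" "\<sigma> \<subseteq> carrier G" "\<And>x y. x \<in> \<sigma> \<Longrightarrow> y \<in> \<sigma> \<Longrightarrow> dst x y \<le> d"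
  shows "\<sigma> \<in> rips d"
  using assms unfolding rips_complex_def by auto

lemma rips_subset:
  assumes "\<sigma> \<in> rips d" "\<tau> \<subseteq> \<sigma>" "\<tau> \<noteq> {}"
  shows "\<tau> \<in> rips d"
proof (rule ripsI)
  show "finite \<tau>" using assms(2) ripsD(1)[OF assms(1)] by (rule finite_subset)
  show "\<tau> \<subseteq> carrier G" using assms(2) ripsD(3)[OF assms(1)] by (rule order_trans)
  show "dst x y \<le> d" if "x \<in> \<tau>" "y \<in> \<tau>" for x y
    using that assms(2) ripsD(4)[OF assms(1)] by (simp add: subset_iff)
qed (rule assms(3))

lemma locally_finite_rips: "locally_finite_complex (rips d)"
  unfolding locally_finite_complex_def
proof (intro conjI ballI allI)
  fix v
  show "finite {\<sigma> \<in> rips d. v \<in> \<sigma>}"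
  proof (cases "v \<in> carrier G")
    case True
    have "{\<sigma> \<in> rips d. v \<in> \<sigma>} \<subseteq> Pow {y \<in> carrier G. dst v y \<le> d}"
    proof (clarify)
      fix \<sigma> y assume "\<sigma> \<in> rips d" "v \<in> \<sigma>" "y \<in> \<sigma>"
      then show "y \<in> carrier G \<and> dst v y \<le> d"
        using ripsD(3)[of \<sigma> d] ripsD(4)[of \<sigma> d v y] by (simp add: subset_iff)
    qed
    then show ?thesis using finite_ball[OF True] by (meson finite_Pow_iff finite_subset)
  next
    case False
    then have "{\<sigma> \<in> rips d. v \<in> \<sigma>} = {}" using ripsD(3) by blast
    then show ?thesis by (simp only: finite.emptyI)
  qed
qed (use ripsD(1,2) in auto)

text \<open>By left invariance, every simplex has a translate in the ball around \<open>\<one>\<close>; so the dimension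
  of the Rips complex is bounded.\<close>

lemma card_rips_le:
  assumes "\<sigma> \<in> rips d"
  shows "card \<sigma> \<le> card {y \<in> carrier G. dst \<one> y \<le> d}"
proof -
  let ?B = "{y \<in> carrier G. dst \<one> y \<le> d}"
  obtain x where x: "x \<in> \<sigma>" "x \<in> carrier G" using ripsD(2,3)[OF assms] by blast
  have "\<sigma> \<subseteq> (\<lambda>y. x \<otimes> y) ` ?B"
  proof
    fix y assume y: "y \<in> \<sigma>"
    then have yc: "y \<in> carrier G" using ripsD(3)[OF assms] by blast
    have xy: "x \<otimes> (inv x \<otimes> y) = y" using x yc by (simp add: m_assoc[symmetric])
    have "dst \<one> (inv x \<otimes> y) = dst (x \<otimes> \<one>) (x \<otimes> (inv x \<otimes> y))"
      using x yc by (intro dst_left_invariant[symmetric]) auto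
    also have "\<dots> = dst x y" using x xy by simp
    finally have "inv x \<otimes> y \<in> ?B" using ripsD(4)[OF assms x(1) y] x yc by simp
    then show "y \<in> (\<lambda>y. x \<otimes> y) ` ?B" using xy by (intro image_eqI[of y _ "inv x \<otimes> y"]) simp_all
  qed
  then have "card \<sigma> \<le> card ((\<lambda>y. x \<otimes> y) ` ?B)"
    by (intro card_mono finite_imageI finite_ball) auto
  also have "\<dots> \<le> card ?B" by (intro card_image_le finite_ball) simp
  finally show ?thesis .
qed

lemma rips_translate:
  assumes "g \<in> carrier G" "\<sigma> \<in> rips d"
  shows "(\<otimes>) g ` \<sigma> \<in> rips d"
proof (rule ripsI)
  have "x \<in> carrier G" if "x \<in> \<sigma>" for x using that ripsD(3)[OF assms(2)] by blast
  then show "dst x y \<le> d" if "x \<in> (\<otimes>) g ` \<sigma>" "y \<in> (\<otimes>) g ` \<sigma>" for x y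
    using that ripsD(4)[OF assms(2)] assms(1) by (auto simp: dst_left_invariant)
qed (use ripsD[OF assms(2)] assms(1) in auto)

end


section \<open>Equivariant contraction of the Rips complex\<close>

locale hyperbolic_group = word_metric_group +
  fixes \<delta> :: real
  assumes delta_nonneg: "\<delta> \<ge> 0"
    and hyperbolic: "hyperbolic (carrier G) (\<lambda>x y. real (dst x y)) \<delta>"
begin

lemma four_point:
  assumes "x \<in> carrier G" "y \<in> carrier G" "z \<in> carrier G" "t \<in> carrier G"
  shows "real (dst x y) + real (dst z t) \<le>
    max (real (dst x z) + real (dst y t)) (real (dst x t) + real (dst y z)) + 2 * \<delta>"
  using hyperbolic assms unfolding hyperbolic_def by simp

context
  fixes H :: "'a set"
  assumes H: "subgroup H G" and finH: "finite H"
begin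

lemma H_closed: "h \<in> H \<Longrightarrow> h \<in> carrier G" "\<one> \<in> H" "h \<in> H \<Longrightarrow> inv h \<in> H"
  "h \<in> H \<Longrightarrow> h' \<in> H \<Longrightarrow> h \<otimes> h' \<in> H"
  using subgroup.mem_carrier[OF H] subgroup.one_closed[OF H] subgroup.m_inv_closed[OF H]
    subgroup.m_closed[OF H] by simp_all

text \<open>The smallest radius for which some ball of the group contains the orbit \<open>H\<close> of the unit
  element.\<close>

definition covering_radius :: nat where
  "covering_radius = (LEAST n. \<exists>x\<in>carrier G. \<forall>h\<in>H. dst x h \<le> n)"

text \<open>The centres of the smallest balls containing \<open>H\<close>. Being defined by distances to an orbit,
  this set is invariant under \<open>H\<close>. It takes the place of a fixed vertex, which a nontrivial \<open>H\<close> does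
  not have.\<close>

definition centre :: "'a set" where
  "centre = {x \<in> carrier G. \<forall>h\<in>H. dst x h \<le> covering_radius}"

lemma centre_carrier: "x \<in> centre \<Longrightarrow> x \<in> carrier G"
  unfolding centre_def by simp

lemma centre_nonempty: "centre \<noteq> {}"
proof -
  have "\<exists>x\<in>carrier G. \<forall>h\<in>H. dst x h \<le> Max (dst \<one> ` H)"
    using finH by (intro bexI[of _ \<one>]) auto
  then have "\<exists>n. \<exists>x\<in>carrier G. \<forall>h\<in>H. dst x h \<le> n" by blast
  then have "\<exists>x\<in>carrier G. \<forall>h\<in>H. dst x h \<le> covering_radius"
    unfolding covering_radius_def by (rule LeastI_ex)
  then show ?thesis unfolding centre_def by blast
qed

lemma covering_radius_attained:
  assumes "x \<in> carrier G"
  shows "\<exists>h\<in>H. covering_radius \<le> dst x h"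
proof (rule ccontr)
  assume "\<not> ?thesis"
  then have less: "\<And>h. h \<in> H \<Longrightarrow> dst x h < covering_radius" by force
  then have "\<forall>h\<in>H. dst x h \<le> covering_radius - 1" by fastforce
  then have "covering_radius \<le> covering_radius - 1"
    unfolding covering_radius_def using assms by (intro Least_le) blast
  then show False using less[OF H_closed(2)] by simp
qed

lemma centre_invariant:
  assumes "h \<in> H" "x \<in> centre"
  shows "h \<otimes> x \<in> centre"
proof -
  have x: "x \<in> carrier G" and h: "h \<in> carrier G"
    using assms centre_carrier H_closed by auto
  have "dst (h \<otimes> x) h' \<le> covering_radius" if h': "h' \<in> H" for h'
  proof -
    have h'c: "h' \<in> carrier G" using h' H_closed by simp
    have "h \<otimes> (inv h \<otimes> h') = h'" using h h'c by (simp add: m_assoc[symmetric])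
    then have "dst (h \<otimes> x) h' = dst x (inv h \<otimes> h')"
      using dst_left_invariant[of h x "inv h \<otimes> h'"] h h'c x by simp
    then show ?thesis using assms h' H_closed unfolding centre_def by simp
  qed
  then show ?thesis using x h unfolding centre_def by simp
qed

lemma finite_centre: "finite centre"
proof -
  have "centre \<subseteq> {y \<in> carrier G. dst \<one> y \<le> covering_radius}"
    using H_closed(2) dst_commute[of \<one>] unfolding centre_def by auto
  then show ?thesis using finite_ball[OF one_closed] finite_subset by blast
qed

text \<open>If \<open>x\<close> and \<open>y\<close> were far apart, then by the four-point condition the midpoint of a geodesic
  between them would be closer to every element of \<open>H\<close> than the covering radius allows.\<close>

lemma centre_diameter:
  assumes "x \<in> centre" "y \<in> centre"
  shows "real (dst x y) \<le> 4 * \<delta> + 1"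
proof -
  have x: "x \<in> carrier G" and y: "y \<in> carrier G" using assms centre_carrier by auto
  obtain m where m: "m \<in> carrier G" "dst x m = dst x y div 2" "dst m y = dst x y - dst x y div 2"
    using geodesic_point[OF x y, of "dst x y div 2"] by auto
  obtain h where h: "h \<in> H" "covering_radius \<le> dst m h"
    using covering_radius_attained[OF m(1)] by blast
  have hc: "h \<in> carrier G" using h H_closed by simp
  have "dst x h \<le> covering_radius" "dst y h \<le> covering_radius"
    using assms h(1) unfolding centre_def by auto
  moreover have "real (dst m h) + real (dst x y) \<le>
      max (real (dst m x) + real (dst h y)) (real (dst m y) + real (dst h x)) + 2 * \<delta>"
    using four_point[OF m(1) hc x y] .
  moreover have "dst m x = dst x m" "dst h y = dst y h" "dst h x = dst x h"
    using dst_commute m x y hc by auto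
  moreover have "2 * real (dst x y div 2) \<le> real (dst x y)"
    "2 * real (dst x y - dst x y div 2) \<le> real (dst x y) + 1"
    by linarith+
  ultimately show ?thesis using m h(2) by linarith
qed

definition height :: "'a \<Rightarrow> nat" where
  "height v = Min (dst v ` centre)"

lemma height_le: "z \<in> centre \<Longrightarrow> height v \<le> dst v z"
  unfolding height_def using finite_centre by simp

lemma height_attained: "\<exists>z\<in>centre. dst v z = height v"
proof -
  have "Min (dst v ` centre) \<in> dst v ` centre"
    using finite_centre centre_nonempty by (intro Min_in) auto
  then show ?thesis unfolding height_def by force
qed

lemma height_translate:
  assumes "h \<in> H" "v \<in> carrier G"
  shows "height (h \<otimes> v) = height v"
proof -
  have le: "height (g \<otimes> u) \<le> height u" if g: "g \<in> H" and u: "u \<in> carrier G" for g u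
  proof -
    obtain z where z: "z \<in> centre" "dst u z = height u" using height_attained by blast
    have "height (g \<otimes> u) \<le> dst (g \<otimes> u) (g \<otimes> z)"
      using centre_invariant[OF g z(1)] by (rule height_le)
    also have "\<dots> = height u"
      using z dst_left_invariant centre_carrier H_closed g u by simp
    finally show ?thesis .
  qed
  have "inv h \<otimes> (h \<otimes> v) = v" using assms H_closed by (simp add: m_assoc[symmetric])
  then show ?thesis
    using le[OF assms] le[of "inv h" "h \<otimes> v"] assms H_closed by simp
qed

lemma dst_centre_le:
  assumes "v \<in> carrier G" "z \<in> centre"
  shows "real (dst v z) \<le> real (height v) + 4 * \<delta> + 1"
proof -
  obtain z' where z': "z' \<in> centre" "dst v z' = height v" using height_attained by blast
  have "dst v z \<le> dst v z' + dst z' z"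
    using assms z' centre_carrier by (intro dst_triangle) auto
  then show ?thesis using centre_diameter[OF z'(1) assms(2)] z'(2) by linarith
qed

text \<open>The vertex \<open>u\<close> is reached from \<open>v\<close> by \<open>k\<close> steps on a geodesic towards a nearest point of the
  centre.\<close>

definition descends :: "nat \<Rightarrow> 'a \<Rightarrow> 'a \<Rightarrow> bool" where
  "descends k v u \<longleftrightarrow> u \<in> carrier G \<and> dst u v = k \<and>
     (\<exists>z\<in>centre. dst z v = height v \<and> dst z u = height v - k)"

lemma descends_exists:
  assumes "v \<in> carrier G" "k \<le> height v"
  shows "\<exists>u. descends k v u"
proof -
  obtain z where z: "z \<in> centre" "dst v z = height v" using height_attained by blast
  obtain u where "u \<in> carrier G" "dst v u = k" "dst u z = dst v z - k"
    using geodesic_point[OF assms(1) centre_carrier[OF z(1)], of k] assms(2) z(2) by metis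
  then have "descends k v u"
    unfolding descends_def using z assms dst_commute[OF assms(1)] dst_commute[OF centre_carrier[OF z(1)]]
    by (intro conjI bexI[of _ z]) simp_all
  then show ?thesis by blast
qed

lemma descends_translate:
  assumes "h \<in> H" "v \<in> carrier G" "descends k v u"
  shows "descends k (h \<otimes> v) (h \<otimes> u)"
proof -
  obtain z where z: "z \<in> centre" "dst z v = height v" "dst z u = height v - k"
    and u: "u \<in> carrier G" "dst u v = k"
    using assms(3) unfolding descends_def by blast
  then show ?thesis
    unfolding descends_def
    using assms centre_invariant[OF assms(1) z(1)] H_closed centre_carrier
    by (auto simp: height_translate dst_left_invariant intro!: bexI[of _ "h \<otimes> z"])
qed

lemma height_descends:
  assumes "v \<in> carrier G" "descends k v u" "k \<le> height v"
  shows "height u = height v - k"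
proof -
  obtain z where z: "z \<in> centre" "dst z u = height v - k" and u: "u \<in> carrier G" "dst u v = k"
    using assms(2) unfolding descends_def by blast
  have "height u \<le> height v - k"
    using height_le[OF z(1), of u] z u centre_carrier dst_commute by metis
  moreover obtain z' where z': "z' \<in> centre" "dst u z' = height u" using height_attained by blast
  moreover have "height v \<le> dst v u + dst u z'"
    using height_le[OF z'(1), of v] dst_triangle[OF assms(1) u(1) centre_carrier[OF z'(1)]] by simp
  ultimately show ?thesis using dst_commute[OF assms(1) u(1)] u(2) by simp
qed

text \<open>Choose a descent for one representative \<open>rep v\<close> of each \<open>H\<close>-orbit and transport it: \<open>H\<close> acts
  freely by left translation, so the element \<open>v \<otimes> inv (rep v)\<close> that carries the representative to
  \<open>v\<close> is unique and there is no compatibility to check.\<close>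

lemma equivariant_descent:
  "\<exists>f. (\<forall>v\<in>carrier G. f v \<in> carrier G) \<and>
       (\<forall>h\<in>H. \<forall>v\<in>carrier G. f (h \<otimes> v) = h \<otimes> f v) \<and>
       (\<forall>v\<in>carrier G. k \<le> height v \<longrightarrow> descends k v (f v))"
proof -
  define p where "p v = (if k \<le> height v then SOME u. descends k v u else v)" for v
  define rep where "rep v = (SOME u. \<exists>h\<in>H. u = h \<otimes> v)" for v
  define f where "f v = v \<otimes> inv (rep v) \<otimes> p (rep v)" for v
  have p: "descends k v (p v)" if "v \<in> carrier G" "k \<le> height v" for v
    using someI_ex[OF descends_exists[OF that]] that(2) unfolding p_def by simp
  have p_closed: "p v \<in> carrier G" if "v \<in> carrier G" for v
    using p[OF that] that unfolding p_def descends_def by auto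
  have rep: "\<exists>h\<in>H. rep v = h \<otimes> v" for v
  proof -
    have "\<exists>u. \<exists>h\<in>H. u = h \<otimes> v" using H_closed(2) by blast
    then show ?thesis unfolding rep_def by (rule someI_ex)
  qed
  have rep_closed: "rep v \<in> carrier G" if "v \<in> carrier G" for v
    using rep[of v] that H_closed by auto
  have f_alt: "\<exists>h\<in>H. v = h \<otimes> rep v \<and> f v = h \<otimes> p (rep v)" if v: "v \<in> carrier G" for v
  proof -
    obtain h where h: "h \<in> H" "rep v = h \<otimes> v" using rep by blast
    have hc: "h \<in> carrier G" using h H_closed by simp
    have eq: "v \<otimes> inv (rep v) = inv h"
      unfolding h(2) using hc v by (simp add: inv_mult_group m_assoc[symmetric])
    have "v = inv h \<otimes> rep v" unfolding h(2) using hc v by (simp add: m_assoc[symmetric])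
    moreover have "f v = inv h \<otimes> p (rep v)" unfolding f_def eq ..
    ultimately show ?thesis using H_closed(3)[OF h(1)] by blast
  qed
  have "f v \<in> carrier G" if "v \<in> carrier G" for v
    using that rep_closed p_closed unfolding f_def by simp
  moreover have "f (h \<otimes> v) = h \<otimes> f v" if h: "h \<in> H" and v: "v \<in> carrier G" for h v
  proof -
    have hc: "h \<in> carrier G" using h H_closed by simp
    have "(\<exists>g\<in>H. u = g \<otimes> (h \<otimes> v)) \<longleftrightarrow> (\<exists>g\<in>H. u = g \<otimes> v)" for u
    proof
      assume "\<exists>g\<in>H. u = g \<otimes> (h \<otimes> v)"
      then obtain g where "g \<in> H" "u = g \<otimes> (h \<otimes> v)" by blast
      then show "\<exists>g\<in>H. u = g \<otimes> v"
        using h v hc H_closed by (intro bexI[of _ "g \<otimes> h"]) (auto simp: m_assoc)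
    next
      assume "\<exists>g\<in>H. u = g \<otimes> v"
      then obtain g where g: "g \<in> H" "u = g \<otimes> v" by blast
      have gc: "g \<in> carrier G" using g H_closed by simp
      have "g \<otimes> inv h \<otimes> (h \<otimes> v) = g \<otimes> (inv h \<otimes> (h \<otimes> v))" using gc hc v by (simp add: m_assoc)
      also have "inv h \<otimes> (h \<otimes> v) = v" using hc v by (simp add: m_assoc[symmetric])
      finally show "\<exists>g\<in>H. u = g \<otimes> (h \<otimes> v)"
        using g h H_closed by (intro bexI[of _ "g \<otimes> inv h"]) auto
    qed
    then have "rep (h \<otimes> v) = rep v" unfolding rep_def by simp
    then show ?thesis
      unfolding f_def using hc v rep_closed[OF v] p_closed[OF rep_closed[OF v]] by (simp add: m_assoc)
  qed
  moreover have "descends k v (f v)" if v: "v \<in> carrier G" and k: "k \<le> height v" for v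
  proof -
    obtain h where h: "h \<in> H" "v = h \<otimes> rep v" "f v = h \<otimes> p (rep v)" using f_alt[OF v] by blast
    have "height (rep v) = height v" using height_translate[OF h(1) rep_closed[OF v]] h(2) by simp
    then have "descends k (rep v) (p (rep v))" using p[OF rep_closed[OF v]] k by simp
    from descends_translate[OF h(1) rep_closed[OF v] this] show ?thesis using h(2,3) by simp
  qed
  ultimately show ?thesis by blast
qed

text \<open>The four-point condition for \<open>u\<close>, \<open>w\<close>, \<open>v\<close> and the nearest centre \<open>z\<close> of \<open>v\<close> compares two sums. In
  one of them the gain of \<open>k\<close> in height beats the error \<open>2\<delta>\<close>; in the other, \<open>w\<close> is not much farther
  from \<open>z\<close> than \<open>v\<close> is, because the centre has small diameter, and \<open>k\<close> is small compared with \<open>d\<close>.\<close>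

lemma descent_close:
  assumes v: "v \<in> carrier G" and w: "w \<in> carrier G"
    and k: "2 * \<delta> \<le> real k" "real k + 6 * \<delta> + 1 \<le> real d"
    and n: "height v = n" "height w \<le> n" "k \<le> n"
    and close: "dst v w \<le> d" and u: "descends k v u"
  shows "dst u w \<le> d"
proof -
  obtain z where z: "z \<in> centre" "dst z v = n" "dst z u = n - k"
    and uc: "u \<in> carrier G" "dst u v = k"
    using u n(1) unfolding descends_def by blast
  have zc: "z \<in> carrier G" using z centre_carrier by simp
  have "real (dst u w) + real (dst z v) \<le>
      max (real (dst u z) + real (dst w v)) (real (dst u v) + real (dst w z)) + 2 * \<delta>"
    using four_point[OF uc(1) w zc v] .
  moreover have "real (dst w z) \<le> real n + 4 * \<delta> + 1"
    using dst_centre_le[OF w z(1)] n(2) by linarith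
  moreover have "dst u z = n - k" "dst w v \<le> d"
    using dst_commute z uc zc v w close by metis+
  moreover have "real (n - k) = real n - real k" using n(3) by simp
  ultimately have "real (dst u w) \<le> real d"
    using z(2) uc(2) k by linarith
  then show ?thesis by simp
qed

text \<open>The map \<open>\<rho> n\<close> iterates the descent until the height is at most \<open>n\<close>. The maps \<open>\<rho> n\<close> and \<open>\<rho> (Suc
  n)\<close> differ by a single descent of the vertices at height exactly \<open>Suc n\<close>, so their contiguity
  reduces to \<open>descent_close\<close>.\<close>

lemma equivariant_retractions:
  assumes k: "2 * \<delta> \<le> real k" "1 \<le> k" "real k + 6 * \<delta> + 1 \<le> real d"
  shows "\<exists>\<rho>. (\<forall>n. \<forall>v\<in>carrier G. n \<ge> k \<longrightarrow> \<rho> n v \<in> carrier G \<and> height (\<rho> n v) \<le> n \<and>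
            (height v \<le> n \<longrightarrow> \<rho> n v = v) \<and> (\<forall>h\<in>H. \<rho> n (h \<otimes> v) = h \<otimes> \<rho> n v)) \<and>
          (\<forall>n. \<forall>\<sigma>\<in>rips d. n \<ge> k \<longrightarrow> \<rho> n ` \<sigma> \<union> \<rho> (Suc n) ` \<sigma> \<in> rips d)"
proof -
  obtain f where f_closed: "\<And>v. v \<in> carrier G \<Longrightarrow> f v \<in> carrier G"
    and f_equiv: "\<And>h v. h \<in> H \<Longrightarrow> v \<in> carrier G \<Longrightarrow> f (h \<otimes> v) = h \<otimes> f v"
    and f_desc: "\<And>v. v \<in> carrier G \<Longrightarrow> k \<le> height v \<Longrightarrow> descends k v (f v)"
    using equivariant_descent[of k] by metis
  have height_f: "height (f v) = height v - k" if "v \<in> carrier G" "k \<le> height v" for v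
    using height_descends[OF that(1) f_desc[OF that] that(2)] .
  \<comment> \<open>The number of descents is \<open>(height v - n) / k\<close> rounded up; truncated subtraction gives \<open>0\<close>
    when \<open>height v \<le> n\<close>.\<close>
  define \<rho> where "\<rho> n v = (f ^^ ((height v - n + (k - 1)) div k)) v" for n v
  have \<rho>_id: "\<rho> n v = v" if "height v \<le> n" for n v
    using that k(2) unfolding \<rho>_def by simp
  have \<rho>_rec: "\<rho> n v = \<rho> n (f v)" if "v \<in> carrier G" "n < height v" "k \<le> n" for n v
  proof -
    define a where "a = height v - n - 1"
    have "(height v - n + (k - 1)) div k = Suc (a div k)"
    proof -
      have eq: "height v - n + (k - 1) = a + k" using that(2) k(2) unfolding a_def by simp
      show ?thesis unfolding eq using k(2) by simp
    qed
    moreover have "(height (f v) - n + (k - 1)) div k = a div k"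
    proof (cases "k \<le> a")
      case True
      then have "height (f v) - n + (k - 1) = a"
        using height_f[OF that(1)] that k(2) unfolding a_def by simp
      then show ?thesis by (rule arg_cong)
    next
      case False
      then have "height (f v) - n = 0"
        using height_f[OF that(1)] that k(2) unfolding a_def by simp
      then show ?thesis using False k(2) by (simp only: add_0) simp
    qed
    ultimately show ?thesis unfolding \<rho>_def by (simp only: funpow_Suc_right o_apply)
  qed
  have \<rho>_props: "\<rho> n v \<in> carrier G \<and> height (\<rho> n v) \<le> n \<and> (\<forall>h\<in>H. \<rho> n (h \<otimes> v) = h \<otimes> \<rho> n v) \<and>
      \<rho> n v = (if height (\<rho> (Suc n) v) = Suc n then f (\<rho> (Suc n) v) else \<rho> (Suc n) v)"
    if "v \<in> carrier G" "k \<le> n" for n v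
    using that
  proof (induction "height v" arbitrary: v rule: less_induct)
    case less
    have trans: "height (h \<otimes> v) = height v" "h \<otimes> v \<in> carrier G" if "h \<in> H" for h
      using height_translate[OF that less.prems(1)] less.prems(1) that H_closed by auto
    show ?case
    proof (cases "height v \<le> n")
      case True
      then show ?thesis
        using less.prems by (simp add: \<rho>_id trans)
    next
      case False
      then have big: "n < height v" "k \<le> height v" using less.prems by auto
      have h: "height (f v) = height v - k" using height_f[OF less.prems(1) big(2)] .
      then have IH: "\<rho> n (f v) \<in> carrier G" "height (\<rho> n (f v)) \<le> n"
        "\<And>h. h \<in> H \<Longrightarrow> \<rho> n (h \<otimes> f v) = h \<otimes> \<rho> n (f v)"
        "\<rho> n (f v) = (if height (\<rho> (Suc n) (f v)) = Suc n then f (\<rho> (Suc n) (f v)) else \<rho> (Suc n) (f v))"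
        using less.hyps[of "f v"] f_closed less.prems big k(2) by auto
      have rec: "\<rho> n v = \<rho> n (f v)" using \<rho>_rec[OF less.prems(1) big(1) less.prems(2)] .
      have "\<rho> n (h \<otimes> v) = h \<otimes> \<rho> n v" if "h \<in> H" for h
        using \<rho>_rec[of "h \<otimes> v" n] trans[OF that] big less.prems IH(3)[OF that] rec
        by (simp add: f_equiv that)
      moreover have "\<rho> n v = (if height (\<rho> (Suc n) v) = Suc n then f (\<rho> (Suc n) v) else \<rho> (Suc n) v)"
      proof (cases "height v = Suc n")
        case True
        then have "\<rho> (Suc n) v = v" "\<rho> n (f v) = f v" using h k(2) by (simp_all add: \<rho>_id)
        then show ?thesis using True rec by simp
      next
        case False
        then have "\<rho> (Suc n) v = \<rho> (Suc n) (f v)"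
          using \<rho>_rec[OF less.prems(1), of "Suc n"] big less.prems(2) by simp
        then show ?thesis using IH(4) rec by simp
      qed
      ultimately show ?thesis using IH(1,2) rec by simp
    qed
  qed
  have push: "\<tau> \<union> (\<lambda>v. if height v = n then f v else v) ` \<tau> \<in> rips d"
    if \<tau>: "\<tau> \<in> rips d" and n: "\<And>v. v \<in> \<tau> \<Longrightarrow> height v \<le> n" "k \<le> n" for \<tau> n
  proof (rule ripsI)
    let ?F = "\<lambda>v. if height v = n then f v else v"
    have \<tau>c: "v \<in> carrier G" if "v \<in> \<tau>" for v using that ripsD(3)[OF \<tau>] by blast
    show "\<tau> \<union> ?F ` \<tau> \<subseteq> carrier G" using \<tau>c f_closed by auto
    have far: "dst (f v) w \<le> d"
      if "v \<in> \<tau>" "height v = n" "w \<in> carrier G" "height w \<le> n" "dst v w \<le> d" for v w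
      using descent_close[OF \<tau>c[OF that(1)] that(3) k(1,3) that(2,4) n(2) that(5)]
        f_desc[OF \<tau>c[OF that(1)]] that(2) n(2) by simp
    have c1: "dst (?F v) w \<le> d" if "v \<in> \<tau>" "w \<in> \<tau>" for v w
      using far[OF that(1)] ripsD(4)[OF \<tau> that] n(1) \<tau>c that by simp
    \<comment> \<open>If both points descend, the first may be moved against the already moved second one,
      which still has height at most \<open>n\<close>.\<close>
    have c2: "dst (?F v) (?F w) \<le> d" if "v \<in> \<tau>" "w \<in> \<tau>" for v w
    proof (cases "height v = n")
      case True
      have Fw: "?F w \<in> carrier G" using that \<tau>c f_closed by simp
      have "dst v (?F w) \<le> d" using c1[OF that(2,1)] dst_commute[OF \<tau>c[OF that(1)] Fw] by simp
      moreover have "height (?F w) \<le> n" using n height_f[OF \<tau>c[OF that(2)]] that by auto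
      ultimately show ?thesis using far[OF that(1) True Fw] True by simp
    next
      case False
      then show ?thesis
        using c1[OF that(2,1)] dst_commute[of v "?F w"] that \<tau>c f_closed by auto
    qed
    fix x y assume "x \<in> \<tau> \<union> ?F ` \<tau>" "y \<in> \<tau> \<union> ?F ` \<tau>"
    then consider "x \<in> \<tau>" "y \<in> \<tau>" | v where "v \<in> \<tau>" "x = ?F v" "y \<in> \<tau>"
      | w where "w \<in> \<tau>" "y = ?F w" "x \<in> \<tau>"
      | v w where "v \<in> \<tau>" "x = ?F v" "w \<in> \<tau>" "y = ?F w"
      by blast
    then show "dst x y \<le> d"
    proof cases
      case 1
      then show ?thesis using ripsD(4)[OF \<tau>] by simp
    next
      case 2
      then show ?thesis using c1 by simp
    next
      case 3
      have "?F w \<in> carrier G" using 3 \<tau>c f_closed by simp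
      then show ?thesis using c1[OF 3(1,3)] 3(2) dst_commute[OF \<tau>c[OF 3(3)]] by simp
    next
      case 4
      then show ?thesis using c2 by simp
    qed
  qed (use ripsD(1,2)[OF that(1)] in auto)
  have both: "\<rho> n ` \<sigma> \<union> \<rho> (Suc n) ` \<sigma> \<in> rips d"
    if \<sigma>: "\<sigma> \<in> rips d" and n: "k \<le> n" and up: "\<rho> (Suc n) ` \<sigma> \<in> rips d" for \<sigma> n
  proof -
    let ?F = "\<lambda>v. if height v = Suc n then f v else v"
    have \<sigma>c: "v \<in> carrier G" if "v \<in> \<sigma>" for v using that ripsD(3)[OF \<sigma>] by blast
    have "\<rho> n ` \<sigma> = ?F ` \<rho> (Suc n) ` \<sigma>"
      unfolding image_image
    proof (rule image_cong[OF refl])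
      fix v assume "v \<in> \<sigma>"
      then show "\<rho> n v = ?F (\<rho> (Suc n) v)" using \<rho>_props[OF \<sigma>c n] by blast
    qed
    moreover have "height v \<le> Suc n" if v: "v \<in> \<rho> (Suc n) ` \<sigma>" for v
    proof -
      obtain u where u: "u \<in> \<sigma>" "v = \<rho> (Suc n) u" using v by blast
      then show ?thesis using \<rho>_props[OF \<sigma>c[OF u(1)] le_SucI[OF n]] by (elim conjE) simp
    qed
    ultimately show ?thesis using push[OF up, of "Suc n"] n by (simp add: Un_commute)
  qed
  have stay: "\<rho> n ` \<sigma> \<in> rips d" if \<sigma>: "\<sigma> \<in> rips d" and n: "k \<le> n" for \<sigma> n
  proof -
    define N where "N = max n (Max (height ` \<sigma>))"
    have "height v \<le> N" if "v \<in> \<sigma>" for v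
      using that ripsD(1)[OF \<sigma>] unfolding N_def by (simp add: le_max_iff_disj)
    then have base_image: "\<rho> N ` \<sigma> = \<sigma>" using \<rho>_id by force
    have "n \<le> N" unfolding N_def by simp
    then show ?thesis using n
    \<comment> \<open>Downward induction from a height above which nothing in \<open>\<sigma>\<close> moves.\<close>
    proof (induction rule: inc_induct)
      case base
      then show ?case using \<sigma> base_image by simp
    next
      case (step m)
      then have "\<rho> m ` \<sigma> \<union> \<rho> (Suc m) ` \<sigma> \<in> rips d" using both[OF \<sigma>, of m] by simp
      moreover have "\<rho> m ` \<sigma> \<noteq> {}" using ripsD(2)[OF \<sigma>] by simp
      ultimately show ?case by (rule rips_subset[OF _ Un_upper1])
    qed
  qed
  show ?thesis
  proof (intro exI[of _ \<rho>] conjI allI ballI impI)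
    fix n v assume v: "v \<in> carrier G" "k \<le> n"
    show "\<rho> n v \<in> carrier G" using \<rho>_props[OF v] by (rule conjunct1)
    show "height (\<rho> n v) \<le> n" using \<rho>_props[OF v] by (elim conjE)
    show "\<rho> n (h \<otimes> v) = h \<otimes> \<rho> n v" if "h \<in> H" for h
      using \<rho>_props[OF v] that by (elim conjE) (rule bspec)
    show "\<rho> n v = v" if "height v \<le> n" using \<rho>_id[OF that] .
  next
    fix n \<sigma> assume "\<sigma> \<in> rips d" "k \<le> n"
    then show "\<rho> n ` \<sigma> \<union> \<rho> (Suc n) ` \<sigma> \<in> rips d"
      using both[of \<sigma> n] stay[of \<sigma> "Suc n"] by simp
  qed
qed

definition invariant_simplices :: "nat \<Rightarrow> 'a set set" where
  "invariant_simplices d = {\<sigma> \<in> rips d. \<forall>h\<in>H. (\<otimes>) h ` \<sigma> = \<sigma>}"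

lemma equivariant_image_invariant:
  assumes "\<sigma> \<in> invariant_simplices d" "\<And>h v. h \<in> H \<Longrightarrow> v \<in> \<sigma> \<Longrightarrow> f (h \<otimes> v) = h \<otimes> f v" "h \<in> H"
  shows "(\<otimes>) h ` f ` \<sigma> = f ` \<sigma>"
proof -
  have "(\<otimes>) h ` f ` \<sigma> = f ` (\<otimes>) h ` \<sigma>"
    unfolding image_image using assms(2,3) by (intro image_cong) auto
  then show ?thesis using assms(1,3) unfolding invariant_simplices_def by simp
qed

lemma centre_image:
  assumes "h \<in> H"
  shows "(\<otimes>) h ` centre = centre"
proof
  show "(\<otimes>) h ` centre \<subseteq> centre" using centre_invariant assms by blast
  show "centre \<subseteq> (\<otimes>) h ` centre"
  proof
    fix z assume z: "z \<in> centre"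
    then have "z = h \<otimes> (inv h \<otimes> z)" using assms H_closed centre_carrier by (simp add: m_assoc[symmetric])
    then show "z \<in> (\<otimes>) h ` centre" using centre_invariant[OF H_closed(3)[OF assms] z] by blast
  qed
qed

lemma centre_invariant_simplex:
  assumes "4 * \<delta> + 1 \<le> real d"
  shows "centre \<in> invariant_simplices d"
proof -
  have "centre \<in> rips d"
  proof (rule ripsI)
    fix x y assume "x \<in> centre" "y \<in> centre"
    then have "real (dst x y) \<le> real d" using centre_diameter[of x y] assms by linarith
    then show "dst x y \<le> d" by simp
  qed (use finite_centre centre_nonempty centre_carrier in auto)
  then show ?thesis unfolding invariant_simplices_def using centre_image by simp
qed

text \<open>The retractions bring every simplex into the \<open>k\<close>-neighbourhood of the centre. Two points
  there are at distance at most \<open>2k + 4\<delta> + 1 \<le> d\<close>, so the simplices there can be joined to the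
  centre and then replaced by it. Equivariance keeps all sets in question invariant.\<close>

theorem monotone_contraction_invariant_simplices:
  assumes d: "32 * \<delta> + 20 \<le> real d"
  shows "\<exists>C. monotone_contraction (invariant_simplices d) C"
proof -
  let ?Q = "invariant_simplices d"
  \<comment> \<open>The length of a descent must be at least \<open>2\<delta>\<close> for \<open>descent_close\<close>; the summand \<open>1\<close> ensures
    progress when \<open>\<delta> = 0\<close>.\<close>
  define k where "k = nat \<lceil>2 * \<delta>\<rceil> + 1"
  have "0 \<le> \<lceil>2 * \<delta>\<rceil>" using delta_nonneg by simp
  then have "real k = of_int \<lceil>2 * \<delta>\<rceil> + 1" unfolding k_def by simp
  then have k_bounds: "2 * \<delta> \<le> real k" "real k \<le> 2 * \<delta> + 2" by linarith+
  moreover have k1: "1 \<le> k" unfolding k_def by simp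
  moreover have "real k + 6 * \<delta> + 1 \<le> real d" using d k_bounds delta_nonneg by linarith
  ultimately obtain \<rho> where
    \<rho>: "\<forall>n. \<forall>v\<in>carrier G. n \<ge> k \<longrightarrow> \<rho> n v \<in> carrier G \<and> height (\<rho> n v) \<le> n \<and>
            (height v \<le> n \<longrightarrow> \<rho> n v = v) \<and> (\<forall>h\<in>H. \<rho> n (h \<otimes> v) = h \<otimes> \<rho> n v)"
    and contig: "\<forall>n. \<forall>\<sigma>\<in>rips d. n \<ge> k \<longrightarrow> \<rho> n ` \<sigma> \<union> \<rho> (Suc n) ` \<sigma> \<in> rips d"
    using equivariant_retractions[of k d] by blast
  have QD: "\<sigma> \<in> rips d" "\<sigma> \<noteq> {}" "finite \<sigma>" "v \<in> \<sigma> \<Longrightarrow> v \<in> carrier G" if "\<sigma> \<in> ?Q" for \<sigma> v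
    using that ripsD(1,2,3)[of \<sigma> d] unfolding invariant_simplices_def by auto
  have img: "(\<otimes>) h ` \<rho> n ` \<sigma> = \<rho> n ` \<sigma>" if "\<sigma> \<in> ?Q" "k \<le> n" "h \<in> H" for \<sigma> n h
    using \<rho> that QD(4)[OF that(1)] by (intro equivariant_image_invariant[OF that(1) _ that(3)]) simp
  have Q2: "\<rho> n ` \<sigma> \<union> \<rho> (Suc n) ` \<sigma> \<in> ?Q" if \<sigma>: "\<sigma> \<in> ?Q" and n: "k \<le> n" for \<sigma> n
    using contig QD(1)[OF \<sigma>] n img[OF \<sigma>, of n] img[OF \<sigma>, of "Suc n"]
    unfolding invariant_simplices_def by (simp add: image_Un)
  have Q1: "\<rho> n ` \<sigma> \<in> ?Q" if \<sigma>: "\<sigma> \<in> ?Q" and n: "k \<le> n" for \<sigma> n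
  proof -
    have "\<rho> n ` \<sigma> \<union> \<rho> (Suc n) ` \<sigma> \<in> rips d"
      using Q2[OF that] unfolding invariant_simplices_def by simp
    moreover have "\<rho> n ` \<sigma> \<noteq> {}" using QD(2)[OF \<sigma>] by simp
    ultimately have "\<rho> n ` \<sigma> \<in> rips d" by (rule rips_subset[OF _ Un_upper1])
    then show ?thesis unfolding invariant_simplices_def using img[OF \<sigma> n] by simp
  qed
  have centreQ: "centre \<in> ?Q"
    using d delta_nonneg by (intro centre_invariant_simplex) linarith
  have cone: "\<rho> k ` \<sigma> \<union> centre \<in> ?Q" if \<sigma>: "\<sigma> \<in> ?Q" for \<sigma>
  proof -
    have low: "x \<in> carrier G \<and> height x \<le> k" if x: "x \<in> \<rho> k ` \<sigma> \<union> centre" for x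
    proof (cases "x \<in> centre")
      case True
      then have "height x = 0" using height_le[OF True, of x] dst_self centre_carrier by simp
      then show ?thesis using centre_carrier[OF True] by simp
    next
      case False
      then obtain v where "v \<in> \<sigma>" "x = \<rho> k v" using x by blast
      then show ?thesis using \<rho> QD(4)[OF \<sigma>] by simp
    qed
    have "\<rho> k ` \<sigma> \<union> centre \<in> rips d"
    proof (rule ripsI)
      fix x y assume "x \<in> \<rho> k ` \<sigma> \<union> centre" "y \<in> \<rho> k ` \<sigma> \<union> centre"
      then have xy: "x \<in> carrier G" "height x \<le> k" "y \<in> carrier G" "height y \<le> k"
        using low by auto
      obtain z where z: "z \<in> centre" "dst y z = height y" using height_attained by blast
      have "dst x y \<le> dst x z + dst z y"
        using xy z centre_carrier by (intro dst_triangle) auto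
      also have "dst z y = height y" using z xy dst_commute centre_carrier by metis
      finally have "real (dst x y) \<le> 2 * real k + 4 * \<delta> + 1"
        using dst_centre_le[OF xy(1) z(1)] xy by linarith
      then have "real (dst x y) \<le> real d" using d k_bounds delta_nonneg by linarith
      then show "dst x y \<le> d" by simp
    qed (use low QD[OF \<sigma>] finite_centre centre_nonempty in auto)
    then show ?thesis
      using img[OF \<sigma> order_refl] centre_image unfolding invariant_simplices_def
      by (simp add: image_Un)
  qed
  \<comment> \<open>Time \<open>0\<close> is the constant map, and time \<open>1\<close> joins it to the retraction onto the
    \<open>k\<close>-neighbourhood of the centre. From time \<open>2\<close> on, retractions at even times alternate with
    the joins of two consecutive ones.\<close>
  define C where "C n \<sigma> = (if n = 0 then centre else if n = 1 then \<rho> k ` \<sigma> \<union> centre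
      else if even n then \<rho> (k + (n - 2) div 2) ` \<sigma>
      else \<rho> (k + (n - 2) div 2) ` \<sigma> \<union> \<rho> (Suc (k + (n - 2) div 2)) ` \<sigma>)" for n \<sigma>
  have "monotone_contraction ?Q C"
    unfolding monotone_contraction_def
  proof (intro conjI allI ballI impI)
    show "C n \<sigma> \<in> ?Q" if "\<sigma> \<in> ?Q" for n \<sigma>
      unfolding C_def using centreQ cone[OF that] Q1[OF that] Q2[OF that] by simp
    show "C n \<sigma> \<subseteq> C n \<tau>" if "\<sigma> \<subseteq> \<tau>" for n \<sigma> \<tau>
      unfolding C_def using that by auto
    show "(\<forall>\<sigma>\<in>?Q. C n \<sigma> \<subseteq> C (Suc n) \<sigma>) \<or> (\<forall>\<sigma>\<in>?Q. C (Suc n) \<sigma> \<subseteq> C n \<sigma>)" for n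
    proof -
      consider "n = 0" | "n = 1" | i where "n = 2 * i + 2" | i where "n = 2 * i + 3"
      proof -
        have "n = 0 \<or> n = 1 \<or> n = 2 * ((n - 2) div 2) + 2 \<or> n = 2 * ((n - 2) div 2) + 3"
          by presburger
        then show thesis using that by metis
      qed
      then show ?thesis
      proof cases
        case 1
        then show ?thesis unfolding C_def by auto
      next
        case 2
        then show ?thesis unfolding C_def by auto
      next
        case 3
        then have "C n \<sigma> = \<rho> (k + i) ` \<sigma>" "C (Suc n) \<sigma> = \<rho> (k + i) ` \<sigma> \<union> \<rho> (Suc (k + i)) ` \<sigma>" for \<sigma>
          unfolding C_def by auto
        then show ?thesis by simp
      next
        case 4
        then have "C n \<sigma> = \<rho> (k + i) ` \<sigma> \<union> \<rho> (Suc (k + i)) ` \<sigma>" "C (Suc n) \<sigma> = \<rho> (Suc (k + i)) ` \<sigma>" for \<sigma>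
          unfolding C_def by auto
        then show ?thesis by simp
      qed
    qed
    show "\<exists>N. \<forall>n\<ge>N. C n \<sigma> = \<sigma>" if \<sigma>: "\<sigma> \<in> ?Q" for \<sigma>
    proof -
      define B where "B = Max (height ` \<sigma>)"
      have "height v \<le> B" if "v \<in> \<sigma>" for v
        using that QD(3)[OF \<sigma>] unfolding B_def by simp
      then have "\<rho> m v = v" if "v \<in> \<sigma>" "k + B \<le> m" for m v
        using \<rho> QD(4)[OF \<sigma>] that by (meson add_leE order_trans)
      then have fixed: "\<rho> m ` \<sigma> = \<sigma>" if "k + B \<le> m" for m
        using that by force
      have "C n \<sigma> = \<sigma>" if "2 * B + 2 \<le> n" for n
      proof -
        have "B \<le> (n - 2) div 2" using that by linarith
        then show ?thesis using that fixed unfolding C_def by simp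
      qed
      then show ?thesis by blast
    qed
    show "\<exists>a. \<forall>\<sigma>\<in>?Q. C 0 \<sigma> = a" unfolding C_def by simp
  qed
  then show ?thesis by (intro exI)
qed

end

end


section \<open>The cell structure of a simplicial complex\<close>

text \<open>The linear isomorphism from \<open>n\<close>-space, given by the coordinates below \<open>n\<close>, to the hyperplane
  of vectors with \<open>n + 1\<close> coordinates and sum zero, which is the tangent space of the standard
  simplex at its barycentre.\<close>

definition balanced :: "nat \<Rightarrow> (nat \<Rightarrow> real) \<Rightarrow> nat \<Rightarrow> real" where
  "balanced n y i = (if i < n then y i else - (\<Sum>j<n. y j))"

text \<open>Up to the factor \<open>n + 1\<close>, the Minkowski functional of the standard simplex centred at its
  barycentre: going from the barycentre in the direction of \<open>balanced n y\<close>, one leaves the simplex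
  where the smallest coordinate vanishes.\<close>

definition gauge_height :: "nat \<Rightarrow> (nat \<Rightarrow> real) \<Rightarrow> real" where
  "gauge_height n y = Max ((\<lambda>i. - balanced n y i) ` {..n})"

definition radius :: "nat \<Rightarrow> (nat \<Rightarrow> real) \<Rightarrow> real" where
  "radius n y = sqrt (\<Sum>i<n. (y i)\<^sup>2)"

definition radial_factor :: "nat \<Rightarrow> (nat \<Rightarrow> real) \<Rightarrow> real" where
  "radial_factor n y = radius n y / ((real n + 1) * gauge_height n y)"

text \<open>The radial homeomorphism from the unit disc to the standard simplex that takes the sphere
  of radius \<open>r\<close> to the boundary of the simplex shrunk by the factor \<open>r\<close> towards the barycentre. At
  the origin the radial factor is \<open>0 / 0 = 0\<close>.\<close>

definition simplex_coordinate :: "nat \<Rightarrow> (nat \<Rightarrow> real) \<Rightarrow> nat \<Rightarrow> real" where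
  "simplex_coordinate n y i = 1 / (real n + 1) + radial_factor n y * balanced n y i"

lemma sum_balanced: "(\<Sum>i\<le>n. balanced n y i) = 0"
proof -
  have "(\<Sum>i\<le>n. balanced n y i) = (\<Sum>i<n. balanced n y i) + balanced n y n"
    by (simp flip: lessThan_Suc_atMost)
  then show ?thesis by (simp add: balanced_def)
qed

lemma gauge_height_ge: "i \<le> n \<Longrightarrow> - balanced n y i \<le> gauge_height n y"
  unfolding gauge_height_def by (intro Max_ge) auto

lemma gauge_height_attained: "\<exists>i\<le>n. gauge_height n y = - balanced n y i"
proof -
  have "Max ((\<lambda>i. - balanced n y i) ` {..n}) \<in> (\<lambda>i. - balanced n y i) ` {..n}"
    by (intro Max_in) auto
  then show ?thesis unfolding gauge_height_def by (elim imageE) (intro exI conjI, simp_all)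
qed

lemma gauge_height_nonneg: "0 \<le> gauge_height n y"
proof (rule ccontr)
  assume neg: "\<not> 0 \<le> gauge_height n y"
  have "0 < (\<Sum>i\<le>n. balanced n y i)"
  proof (rule sum_pos)
    fix i assume "i \<in> {..n}"
    then show "0 < balanced n y i" using gauge_height_ge[of i n y] neg by simp
  qed auto
  then show False by (simp add: sum_balanced)
qed

lemma balanced_abs_le:
  assumes "i \<le> n"
  shows "\<bar>balanced n y i\<bar> \<le> (real n + 1) * gauge_height n y"
proof -
  have "balanced n y i = (\<Sum>j\<in>{..n} - {i}. - balanced n y j)"
    using sum_balanced[of n y] assms by (simp add: sum.remove[of "{..n}" i] sum_negf)
  also have "\<dots> \<le> (\<Sum>j\<in>{..n} - {i}. gauge_height n y)"
    by (intro sum_mono gauge_height_ge) auto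
  also have "\<dots> = real n * gauge_height n y" using assms by simp
  finally have "balanced n y i \<le> real n * gauge_height n y" .
  moreover have "0 \<le> real n * gauge_height n y" using gauge_height_nonneg by simp
  ultimately show ?thesis
    using gauge_height_ge[OF assms, of y] gauge_height_nonneg[of n y]
    unfolding distrib_right mult_1_left abs_le_iff by linarith
qed

lemma radius_nonneg: "0 \<le> radius n y"
  unfolding radius_def by (simp add: sum_nonneg)

lemma radius_power2: "(radius n y)\<^sup>2 = (\<Sum>i<n. (y i)\<^sup>2)"
  unfolding radius_def by (simp add: sum_nonneg)

lemma radius_eq_0_iff: "radius n y = 0 \<longleftrightarrow> (\<forall>i<n. y i = 0)"
  unfolding radius_def by (auto simp: sum_nonneg_eq_0_iff)

lemma gauge_height_0_imp_radius_0:
  assumes "gauge_height n y = 0"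
  shows "radius n y = 0"
  unfolding radius_eq_0_iff
proof (intro allI impI)
  fix i assume "i < n"
  then show "y i = 0" using balanced_abs_le[of i n y] assms by (simp add: balanced_def)
qed

lemma radial_factor_gauge_height:
  "radial_factor n y * gauge_height n y = radius n y / (real n + 1)"
  using gauge_height_0_imp_radius_0[of n y] unfolding radial_factor_def by auto

lemma radial_factor_nonneg: "0 \<le> radial_factor n y"
  unfolding radial_factor_def using radius_nonneg gauge_height_nonneg by simp

lemma radial_displacement_le:
  assumes "i \<le> n"
  shows "\<bar>radial_factor n y * balanced n y i\<bar> \<le> radius n y"
proof -
  have "\<bar>radial_factor n y * balanced n y i\<bar> \<le> radial_factor n y * ((real n + 1) * gauge_height n y)"
    unfolding abs_mult using balanced_abs_le[OF assms] radial_factor_nonneg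
    by (simp add: mult_left_mono)
  also have "\<dots> = (real n + 1) * (radial_factor n y * gauge_height n y)" by (simp only: mult_ac)
  also have "\<dots> = radius n y"
  proof -
    have "real n + 1 \<noteq> 0" by linarith
    then show ?thesis unfolding radial_factor_gauge_height by simp
  qed
  finally show ?thesis .
qed

lemma sum_simplex_coordinate: "(\<Sum>i\<le>n. simplex_coordinate n y i) = 1"
proof -
  have "(\<Sum>i\<le>n. simplex_coordinate n y i) =
      (\<Sum>i\<le>n. 1 / (real n + 1)) + radial_factor n y * (\<Sum>i\<le>n. balanced n y i)"
    unfolding simplex_coordinate_def by (simp only: sum.distrib sum_distrib_left)
  then show ?thesis by (simp add: sum_balanced add.commute)
qed

lemma simplex_coordinate_ge:
  assumes "i \<le> n"
  shows "(1 - radius n y) / (real n + 1) \<le> simplex_coordinate n y i"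
proof -
  have "radial_factor n y * (- balanced n y i) \<le> radial_factor n y * gauge_height n y"
    using gauge_height_ge[OF assms] radial_factor_nonneg by (intro mult_left_mono)
  then show ?thesis
    unfolding simplex_coordinate_def radial_factor_gauge_height by (simp add: diff_divide_distrib)
qed

lemma simplex_coordinate_attained:
  "\<exists>i\<le>n. simplex_coordinate n y i = (1 - radius n y) / (real n + 1)"
proof -
  obtain i where i: "i \<le> n" "gauge_height n y = - balanced n y i" using gauge_height_attained by blast
  have "radial_factor n y * balanced n y i = - (radius n y / (real n + 1))"
    using radial_factor_gauge_height[of n y] i(2) by simp
  then show ?thesis using i(1) unfolding simplex_coordinate_def
    by (intro exI[of _ i]) (simp add: diff_divide_distrib)
qed

text \<open>The smallest coordinate of the image determines the radius. The image also determines \<open>y\<close>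
  up to a positive factor, and the radius determines this factor.\<close>

lemma simplex_coordinate_inject:
  assumes eq: "\<And>i. i \<le> n \<Longrightarrow> simplex_coordinate n y i = simplex_coordinate n y' i"
    and i: "i < n"
  shows "y i = y' i"
proof -
  have le: "radius n b \<le> radius n a"
    if "\<And>i. i \<le> n \<Longrightarrow> simplex_coordinate n a i = simplex_coordinate n b i" for a b
  proof -
    obtain j where "j \<le> n" "simplex_coordinate n b j = (1 - radius n b) / (real n + 1)"
      using simplex_coordinate_attained by blast
    then have "(1 - radius n a) / (real n + 1) \<le> (1 - radius n b) / (real n + 1)"
      using simplex_coordinate_ge[of j n a] that by simp
    then show ?thesis by (simp add: divide_le_cancel)
  qed
  have r: "radius n y = radius n y'"
    using le[of y y'] le[of y' y] eq by (simp add: le_antisym)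
  show ?thesis
  proof (cases "radius n y = 0")
    case True
    then show ?thesis using r i radius_eq_0_iff[of n y] radius_eq_0_iff[of n y'] by simp
  next
    case False
    let ?s = "radial_factor n y" and ?s' = "radial_factor n y'"
    have pos: "0 < radial_factor n a" if "radius n a \<noteq> 0" for a
      using that gauge_height_0_imp_radius_0[of n a] radial_factor_nonneg[of n a]
      unfolding radial_factor_def by (auto simp: less_le)
    have s: "0 < ?s" "0 < ?s'" using pos False r by auto
    have scaled: "?s * y j = ?s' * y' j" if "j < n" for j
      using eq[of j] that unfolding simplex_coordinate_def balanced_def by simp
    have "?s\<^sup>2 * (radius n y)\<^sup>2 = (\<Sum>j<n. (?s * y j)\<^sup>2)"
      unfolding radius_power2 sum_distrib_left by (simp add: power_mult_distrib)
    also have "\<dots> = (\<Sum>j<n. (?s' * y' j)\<^sup>2)" using scaled by simp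
    also have "\<dots> = ?s'\<^sup>2 * (radius n y')\<^sup>2"
      unfolding radius_power2 sum_distrib_left by (simp add: power_mult_distrib)
    finally have "?s\<^sup>2 = ?s'\<^sup>2" using False r by simp
    then have "?s = ?s'" using s by (simp add: power2_eq_iff_nonneg)
    then show ?thesis using scaled[OF i] s by simp
  qed
qed

lemma simplex_coordinate_surj:
  assumes pos: "\<And>i. i \<le> n \<Longrightarrow> 0 < t i" and sum: "(\<Sum>i\<le>n. t i) = (1::real)"
  shows "\<exists>y. (\<forall>i\<ge>n. y i = 0) \<and> radius n y < 1 \<and> (\<forall>i\<le>n. simplex_coordinate n y i = t i)"
proof -
  define x where "x i = (if i < n then t i - 1 / (real n + 1) else 0)" for i
  have bal: "balanced n x i = t i - 1 / (real n + 1)" if "i \<le> n" for i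
  proof (cases "i < n")
    case False
    then have "i = n" using that by simp
    have "(\<Sum>j<n. t j) + t n = 1"
      using sum by (simp flip: lessThan_Suc_atMost)
    then have "- (\<Sum>j<n. x j) = t n - 1 + real n / (real n + 1)"
      unfolding x_def by (simp add: sum_subtractf)
    also have "\<dots> = t n - 1 / (real n + 1)" by (simp add: field_simps)
    finally show ?thesis using \<open>i = n\<close> unfolding balanced_def by simp
  qed (simp add: balanced_def x_def)
  show ?thesis
  proof (cases "radius n x = 0")
    case True
    then have "simplex_coordinate n x i = t i" if "i \<le> n" for i
    proof -
      have "\<forall>j<n. x j = 0" using True by (simp add: radius_eq_0_iff)
      then have "balanced n x i = 0" unfolding balanced_def by simp
      then show ?thesis using bal[OF that] unfolding simplex_coordinate_def by simp
    qed
    then show ?thesis using True by (intro exI[of _ x]) (simp add: x_def)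
  next
    case False
    then have g: "gauge_height n x > 0" "radius n x > 0"
      using gauge_height_0_imp_radius_0 gauge_height_nonneg[of n x] radius_nonneg[of n x]
      by (auto simp: less_le)
    define \<mu> where "\<mu> = (real n + 1) * gauge_height n x / radius n x"
    have \<mu>: "\<mu> > 0" unfolding \<mu>_def using g by simp
    define y where "y i = \<mu> * x i" for i
    have bal_y: "balanced n y i = \<mu> * balanced n x i" for i
      unfolding balanced_def y_def by (simp add: sum_distrib_left)
    have "radius n y = \<mu> * radius n x"
      unfolding radius_def y_def using \<mu>
      by (simp add: power_mult_distrib real_sqrt_mult flip: sum_distrib_left)
    then have rad_y: "radius n y = (real n + 1) * gauge_height n x"
      unfolding \<mu>_def using g by simp
    have "gauge_height n y = \<mu> * gauge_height n x"
    proof (rule antisym)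
      obtain i where i: "i \<le> n" "gauge_height n y = - balanced n y i"
        using gauge_height_attained by blast
      have "\<mu> * (- balanced n x i) \<le> \<mu> * gauge_height n x"
        using gauge_height_ge[OF i(1)] \<mu> by (intro mult_left_mono) auto
      then show "gauge_height n y \<le> \<mu> * gauge_height n x"
        unfolding i(2) bal_y by simp
      obtain i where "i \<le> n" "gauge_height n x = - balanced n x i" using gauge_height_attained by blast
      then show "\<mu> * gauge_height n x \<le> gauge_height n y"
        using gauge_height_ge[of i n y] by (simp add: bal_y)
    qed
    then have "radial_factor n y = 1 / \<mu>"
      unfolding radial_factor_def rad_y using g \<mu> by simp
    then have coord: "simplex_coordinate n y i = t i" if "i \<le> n" for i
      unfolding simplex_coordinate_def bal_y bal[OF that] using \<mu> by simp
    obtain i where i: "i \<le> n" "simplex_coordinate n y i = (1 - radius n y) / (real n + 1)"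
      using simplex_coordinate_attained by blast
    then have "0 < (1 - radius n y) / (real n + 1)" using pos[OF i(1)] coord[OF i(1)] by simp
    then have "radius n y < 1" by (simp add: zero_less_divide_iff)
    then show ?thesis using coord by (intro exI[of _ y]) (simp add: y_def x_def)
  qed
qed

lemma continuous_on_Max_image:
  fixes f :: "'i \<Rightarrow> 'x::topological_space \<Rightarrow> real"
  assumes "finite I" "I \<noteq> {}" "\<And>i. i \<in> I \<Longrightarrow> continuous_on X (f i)"
  shows "continuous_on X (\<lambda>x. Max ((\<lambda>i. f i x) ` I))"
  using assms
proof (induction rule: finite_ne_induct)
  case (singleton i)
  then show ?case by simp
next
  case (insert i I)
  then have "continuous_on X (\<lambda>x. max (f i x) (Max ((\<lambda>i. f i x) ` I)))"
    by (intro continuous_on_max) auto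
  then show ?case using insert by simp
qed

text \<open>This handles the origin, where the radial factor may jump but the displacement is bounded
  by the radius.\<close>

lemma continuous_on_dominated:
  fixes f q :: "'x::topological_space \<Rightarrow> real"
  assumes q: "continuous_on UNIV q" and le: "\<And>x. x \<in> X \<Longrightarrow> \<bar>f x\<bar> \<le> q x"
    and f: "continuous_on (X \<inter> {x. q x \<noteq> 0}) f"
  shows "continuous_on X f"
  unfolding continuous_on_topological
proof (intro ballI allI impI)
  fix x B assume x: "x \<in> X" and B: "open B" "f x \<in> B"
  show "\<exists>A. open A \<and> x \<in> A \<and> (\<forall>y\<in>X. y \<in> A \<longrightarrow> f y \<in> B)"
  proof (cases "q x = 0")
    case True
    then have "f x = 0" using le[OF x] by simp
    then obtain e where e: "e > 0" "ball 0 e \<subseteq> B" using B open_contains_ball by metis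
    have "f y \<in> B" if "y \<in> X" "q y < e" for y
      using le[OF that(1)] that(2) e(2) by (auto simp: subset_iff dist_real_def)
    moreover have "open {y. q y < e}" using q by (intro open_Collect_less) auto
    ultimately show ?thesis using True e(1) by (intro exI[of _ "{y. q y < e}"]) simp
  next
    case False
    then obtain A where A: "open A" "x \<in> A" "\<forall>y\<in>X \<inter> {x. q x \<noteq> 0}. y \<in> A \<longrightarrow> f y \<in> B"
      using f x B unfolding continuous_on_topological by blast
    have "open {y. q y \<noteq> 0}" using q by (intro open_Collect_neq) auto
    then have "open (A \<inter> {y. q y \<noteq> 0})" using A(1) by (rule open_Int[rotated])
    then show ?thesis using A(2,3) False by (intro exI[of _ "A \<inter> {y. q y \<noteq> 0}"]) auto
  qed
qed

lemma continuous_on_simplex_coordinate: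
  assumes "i \<le> n"
  shows "continuous_on UNIV (\<lambda>y. simplex_coordinate n y i)"
proof -
  have coord: "continuous_on X (\<lambda>y :: nat \<Rightarrow> real. y j)" for j X
    by (rule continuous_on_subset[OF continuous_on_product_coordinates]) simp
  have bal: "continuous_on X (\<lambda>y. balanced n y j)" for j X
    unfolding balanced_def by (cases "j < n") (auto intro!: continuous_intros coord)
  have rad: "continuous_on X (\<lambda>y. radius n y)" for X
    unfolding radius_def by (intro continuous_intros coord)
  have gauge: "continuous_on X (\<lambda>y. gauge_height n y)" for X
    unfolding gauge_height_def by (intro continuous_on_Max_image continuous_intros bal) auto
  have "continuous_on UNIV (\<lambda>y. radial_factor n y * balanced n y i)"
  proof (rule continuous_on_dominated[OF rad])
    show "\<bar>radial_factor n y * balanced n y i\<bar> \<le> radius n y" for y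
      using radial_displacement_le[OF assms] .
    have "real n + 1 \<noteq> 0" by linarith
    then show "continuous_on (UNIV \<inter> {y. radius n y \<noteq> 0}) (\<lambda>y. radial_factor n y * balanced n y i)"
      unfolding radial_factor_def using gauge_height_0_imp_radius_0
      by (intro continuous_intros rad gauge bal) auto
  qed
  then show ?thesis
    unfolding simplex_coordinate_def by (intro continuous_on_add continuous_on_const)
qed

definition disc :: "nat \<Rightarrow> (nat \<Rightarrow> real) set" where
  "disc n = {y. (\<forall>i\<ge>n. y i = 0) \<and> (\<Sum>i<n. (y i)\<^sup>2) \<le> 1}"

lemma unit_disc_eq: "unit_disc n = top_of_set (disc n)"
proof -
  have "{y. \<forall>i\<ge>n. y i = 0} \<inter> {y. (\<Sum>i<n. (y i)\<^sup>2) \<le> 1} = disc n"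
    unfolding disc_def by blast
  then show ?thesis
    unfolding unit_disc_def Euclidean_space_def
    by (simp add: subtopology_subtopology euclidean_product_topology)
qed

lemma radius_le_1_iff: "radius n y \<le> 1 \<longleftrightarrow> (\<Sum>i<n. (y i)\<^sup>2) \<le> 1"
  and radius_less_1_iff: "radius n y < 1 \<longleftrightarrow> (\<Sum>i<n. (y i)\<^sup>2) < 1"
  and radius_eq_1_iff: "radius n y = 1 \<longleftrightarrow> (\<Sum>i<n. (y i)\<^sup>2) = 1"
  unfolding radius_def by simp_all

lemma compact_disc: "compact (disc n)"
proof -
  have "compactin (product_topology (\<lambda>i::nat. euclidean) UNIV) (PiE UNIV (\<lambda>i. {-1..1::real}))"
    unfolding compactin_PiE by auto
  then have cpt: "compact (PiE UNIV (\<lambda>i::nat. {-1..1::real}))"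
    by (simp add: euclidean_product_topology)
  have "disc n = (\<Inter>i\<in>{n..}. {y. y i = 0}) \<inter> {y. (\<Sum>i<n. (y i)\<^sup>2) \<le> 1}"
    unfolding disc_def by auto
  also have "closed \<dots>"
    by (intro closed_Int closed_INT ballI closed_Collect_le closed_Collect_eq continuous_intros
        continuous_on_product_coordinates)
  finally have cl: "closed (disc n)" .
  have "y i \<in> {-1..1}" if y: "y \<in> disc n" for y i
  proof (cases "i < n")
    case True
    have "(y i)\<^sup>2 \<le> (\<Sum>i<n. (y i)\<^sup>2)" using True by (intro member_le_sum) auto
    also have "\<dots> \<le> 1" using y unfolding disc_def by blast
    finally show ?thesis by (simp add: abs_square_le_1 abs_le_iff)
  next
    case False
    then show ?thesis using y unfolding disc_def by simp
  qed
  then have "PiE UNIV (\<lambda>i. {-1..1}) \<inter> disc n = disc n" by auto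
  then show ?thesis using compact_Int_closed[OF cpt cl] by simp
qed

lemma Hausdorff_euclidean_fun: "Hausdorff_space (euclidean :: ('v \<Rightarrow> real) topology)"
proof -
  have "Hausdorff_space (product_topology (\<lambda>v::'v. euclideanreal) UNIV)"
    unfolding Hausdorff_space_product_topology by simp
  then show ?thesis by (simp add: euclidean_product_topology)
qed

lemma Hausdorff_realization:
  "locally_finite_complex K \<Longrightarrow> Hausdorff_space (realization K)"
  by (simp add: realization_locally_finite Hausdorff_space_subtopology Hausdorff_euclidean_fun)

text \<open>After an enumeration of the vertices, the radial homeomorphism is a continuous injection
  of the compact disc into a Hausdorff space, hence an embedding. It takes the interior to the
  open simplex because the smallest coordinate is positive exactly for radius less than \<open>1\<close>.\<close>

lemma characteristic_map_simplex:
  assumes K: "locally_finite_complex K"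
    and faces: "\<And>\<sigma> \<tau>. \<sigma> \<in> K \<Longrightarrow> \<tau> \<subseteq> \<sigma> \<Longrightarrow> \<tau> \<noteq> {} \<Longrightarrow> \<tau> \<in> K"
    and \<sigma>: "\<sigma> \<in> K" "card \<sigma> = Suc n"
  shows "\<exists>\<Phi>. characteristic_map (realization K) (simplicial_cells K) n (open_simplex \<sigma>) \<Phi>"
proof -
  have fin: "finite \<sigma>" using locally_finite_complexD(1)[OF K \<sigma>(1)] .
  have "\<exists>h. bij_betw h {0..<card \<sigma>} \<sigma>" by (rule ex_bij_betw_nat_finite[OF fin])
  then obtain e where "bij_betw e {0..<card \<sigma>} \<sigma>" ..
  moreover have "{0..<card \<sigma>} = {..n}" using \<sigma>(2) by auto
  ultimately have e: "bij_betw e {..n} \<sigma>" by simp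
  define idx where "idx = the_inv_into {..n} e"
  have idx: "idx (e i) = i" if "i \<le> n" for i
    using that e unfolding idx_def bij_betw_def by (simp add: the_inv_into_f_f)
  have e_idx: "e (idx v) = v" "idx v \<le> n" if "v \<in> \<sigma>" for v
    using that e the_inv_into_into[of e "{..n}" v "{..n}"] f_the_inv_into_f[of e "{..n}" v]
    unfolding idx_def bij_betw_def by auto
  have e_mem: "e i \<in> \<sigma>" if "i \<le> n" for i using that e unfolding bij_betw_def by auto
  define \<Phi> where "\<Phi> y v = (if v \<in> \<sigma> then simplex_coordinate n y (idx v) else 0)" for y v
  have \<Phi>_e: "\<Phi> y (e i) = simplex_coordinate n y i" if "i \<le> n" for y i
    unfolding \<Phi>_def using that e_mem idx by simp
  have sum_\<Phi>: "sum (\<Phi> y) \<sigma> = 1" for y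
  proof -
    have "sum (\<Phi> y) \<sigma> = (\<Sum>i\<le>n. \<Phi> y (e i))" using sum.reindex_bij_betw[OF e] by metis
    then show ?thesis using \<Phi>_e sum_simplex_coordinate[of n y] by simp
  qed
  have \<Phi>_ge: "(1 - radius n y) / (real n + 1) \<le> \<Phi> y v" if "v \<in> \<sigma>" for y v
    unfolding \<Phi>_def using that simplex_coordinate_ge[OF e_idx(2)[OF that], of y] by simp
  have closed: "\<Phi> y \<in> closed_simplex \<sigma>" if "radius n y \<le> 1" for y
  proof -
    have "0 \<le> (1 - radius n y) / (real n + 1)" using that by simp
    then have "0 \<le> \<Phi> y v" for v
      using \<Phi>_ge[of v y] unfolding \<Phi>_def by (cases "v \<in> \<sigma>") auto
    then show ?thesis using sum_\<Phi> unfolding closed_simplex_alt \<Phi>_def by auto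
  qed
  have open_iff: "\<Phi> y \<in> open_simplex \<sigma> \<longleftrightarrow> radius n y < 1" if "radius n y \<le> 1" for y
  proof
    assume less: "radius n y < 1"
    then have "0 < (1 - radius n y) / (real n + 1)" by simp
    then have "0 < \<Phi> y v" if "v \<in> \<sigma>" for v using \<Phi>_ge[OF that, of y] by linarith
    then have "\<sigma> \<subseteq> support (\<Phi> y)" unfolding support_def by fastforce
    then show "\<Phi> y \<in> open_simplex \<sigma>"
      using closed[OF that] unfolding closed_simplex_def open_simplex_def by auto
  next
    assume "\<Phi> y \<in> open_simplex \<sigma>"
    moreover obtain i where i: "i \<le> n" "simplex_coordinate n y i = (1 - radius n y) / (real n + 1)"
      using simplex_coordinate_attained by blast
    ultimately have "\<Phi> y (e i) \<noteq> 0"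
      using e_mem[OF i(1)] unfolding open_simplex_def support_def by blast
    then show "radius n y < 1" using \<Phi>_e[OF i(1), of y] i(2) that by (auto simp: less_le)
  qed
  have "continuous_on (disc n) \<Phi>"
  proof (rule continuous_on_coordinatewise_then_product)
    fix v
    show "continuous_on (disc n) (\<lambda>y. \<Phi> y v)"
      unfolding \<Phi>_def using continuous_on_simplex_coordinate[OF e_idx(2), of v]
      by (cases "v \<in> \<sigma>") (auto intro: continuous_on_subset)
  qed
  moreover have "\<Phi> ` disc n \<subseteq> underlying_set K"
    using closed \<sigma>(1) unfolding disc_def by (auto simp: radius_le_1_iff)
  ultimately have cont: "continuous_map (unit_disc n) (realization K) \<Phi>"
    by (simp add: unit_disc_eq realization_locally_finite[OF K] image_subset_iff_funcset)
  have "inj_on \<Phi> (disc n)"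
  proof (rule inj_onI)
    fix y y' assume y: "y \<in> disc n" "y' \<in> disc n" and eq: "\<Phi> y = \<Phi> y'"
    have "simplex_coordinate n y i = simplex_coordinate n y' i" if "i \<le> n" for i
      using \<Phi>_e[OF that] eq by metis
    then have "y i = y' i" if "i < n" for i using simplex_coordinate_inject that by metis
    then have "y i = y' i" for i
      using y unfolding disc_def by (cases "i < n") auto
    then show "y = y'" by (rule ext)
  qed
  then have "embedding_map (unit_disc n) (realization K) \<Phi>"
    using cont Hausdorff_realization[OF K] compact_disc[of n]
    by (intro continuous_imp_embedding_map)
      (simp_all add: unit_disc_eq compact_space_subtopology)
  then have "homeomorphic_map (unit_disc n) (subtopology (realization K) (\<Phi> ` disc n)) \<Phi>"
    unfolding embedding_map_def unit_disc_eq by simp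
  moreover have image: "\<Phi> ` disc_interior n = open_simplex \<sigma>"
  proof
    show "\<Phi> ` disc_interior n \<subseteq> open_simplex \<sigma>"
      using open_iff by (auto simp: disc_interior_def unit_disc_eq disc_def simp flip: radius_le_1_iff radius_less_1_iff)
    show "open_simplex \<sigma> \<subseteq> \<Phi> ` disc_interior n"
    proof
      fix t assume t: "t \<in> open_simplex \<sigma>"
      have pos: "0 < t (e i)" if "i \<le> n" for i
        using t e_mem[OF that] unfolding open_simplex_def support_def by (auto simp: less_le)
      have "(\<Sum>i\<le>n. t (e i)) = sum t \<sigma>" using sum.reindex_bij_betw[OF e] by metis
      then have "(\<Sum>i\<le>n. t (e i)) = 1" using t unfolding open_simplex_def by simp
      then obtain y where y: "\<forall>i\<ge>n. y i = 0" "radius n y < 1" "\<forall>i\<le>n. simplex_coordinate n y i = t (e i)"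
        using simplex_coordinate_surj[of n "\<lambda>i. t (e i)"] pos by blast
      have "\<Phi> y v = t v" for v
      proof (cases "v \<in> \<sigma>")
        case True
        then show ?thesis unfolding \<Phi>_def using y(3) e_idx[OF True] by simp
      next
        case False
        then show ?thesis using t unfolding \<Phi>_def open_simplex_def support_def by auto
      qed
      then have "\<Phi> y = t" by (rule ext)
      moreover have "y \<in> disc_interior n"
        using y(1,2) unfolding disc_interior_def unit_disc_eq
        by (auto simp: disc_def radius_less_1_iff)
      ultimately show "t \<in> \<Phi> ` disc_interior n" by blast
    qed
  qed
  moreover have interior: "disc n \<inter> disc_interior n = disc_interior n"
    unfolding disc_interior_def unit_disc_eq by auto
  moreover have inside: "\<Phi> ` disc n \<inter> open_simplex \<sigma> = open_simplex \<sigma>"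
    using image interior by blast
  moreover have "open_simplex \<sigma> \<subseteq> topspace (realization K)"
    using open_simplex_subset_closed \<sigma>(1) by (auto simp: topspace_realization)
  ultimately have "homeomorphic_map (subtopology (unit_disc n) (disc_interior n))
      (subtopology (subtopology (realization K) (\<Phi> ` disc n)) (open_simplex \<sigma>)) \<Phi>"
    by (intro homeomorphic_map_subtopologies) (simp_all add: unit_disc_eq, blast)
  then have homeo: "homeomorphic_map (subtopology (unit_disc n) (disc_interior n))
      (subtopology (realization K) (open_simplex \<sigma>)) \<Phi>"
    unfolding subtopology_subtopology inside .
  define F where "F = open_simplex ` {\<tau>. \<tau> \<subset> \<sigma> \<and> \<tau> \<noteq> {}}"
  have "finite {\<tau>. \<tau> \<subset> \<sigma> \<and> \<tau> \<noteq> {}}"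
    using fin by (rule finite_subset[OF _ finite_Pow_iff[THEN iffD2], rotated]) auto
  then have "finite F"
    unfolding F_def by (rule finite_imageI)
  moreover have "F \<subseteq> (\<Union>m<n. simplicial_cells K m)"
  proof
    fix c assume "c \<in> F"
    then obtain \<tau> where \<tau>: "\<tau> \<subset> \<sigma>" "\<tau> \<noteq> {}" "c = open_simplex \<tau>" unfolding F_def by blast
    have "card \<tau> < Suc n" using psubset_card_mono[OF fin \<tau>(1)] \<sigma>(2) by simp
    moreover have "finite \<tau>" using finite_subset[OF psubset_imp_subset[OF \<tau>(1)] fin] .
    then have "card \<tau> > 0" using \<tau>(2) by (simp add: card_gt_0_iff)
    ultimately obtain m where "card \<tau> = Suc m" "m < n" by (cases "card \<tau>") auto
    moreover have "\<tau> \<in> K" using faces[OF \<sigma>(1)] \<tau> by blast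
    ultimately show "c \<in> (\<Union>m<n. simplicial_cells K m)"
      unfolding simplicial_cells_def \<tau>(3) by blast
  qed
  moreover have "\<Phi> ` disc_boundary n \<subseteq> \<Union>F"
  proof (rule image_subsetI)
    fix y assume "y \<in> disc_boundary n"
    then have y: "radius n y = 1" unfolding disc_boundary_def by (simp add: radius_eq_1_iff)
    then have mem: "\<Phi> y \<in> closed_simplex \<sigma>" "\<Phi> y \<notin> open_simplex \<sigma>" using closed open_iff by auto
    have open_supp: "\<Phi> y \<in> open_simplex (support (\<Phi> y))"
      using mem_closed_simplex_support(2)[OF fin mem(1)] .
    moreover have "support (\<Phi> y) \<noteq> \<sigma>" using open_supp mem(2) by auto
    ultimately show "\<Phi> y \<in> \<Union>F"
      unfolding F_def using closed_simplexD(4)[OF mem(1)] support_nonempty[OF mem(1)] by blast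
  qed
  ultimately show ?thesis
    using cont homeo unfolding characteristic_map_def by blast
qed

lemma open_simplex_nonempty:
  assumes "finite \<sigma>" "\<sigma> \<noteq> {}"
  shows "open_simplex \<sigma> \<noteq> {}"
proof -
  have "(\<lambda>v. if v \<in> \<sigma> then 1 / real (card \<sigma>) else 0) \<in> open_simplex \<sigma>"
    using assms unfolding open_simplex_def support_def by auto
  then show ?thesis by blast
qed

text \<open>Any point \<open>t\<close> of the closed simplex is the limit of points on the segment from an interior
  point to \<open>t\<close>.\<close>

lemma closed_simplex_subset_closure:
  assumes K: "locally_finite_complex K" and \<sigma>: "\<sigma> \<in> K"
  shows "closed_simplex \<sigma> \<subseteq> realization K closure_of open_simplex \<sigma>"
proof
  fix t assume t: "t \<in> closed_simplex \<sigma>"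
  have fin: "finite \<sigma>" "\<sigma> \<noteq> {}" using locally_finite_complexD(1,2)[OF K \<sigma>] by auto
  obtain b where b_open: "b \<in> open_simplex \<sigma>" using open_simplex_nonempty[OF fin] by blast
  define p where "p k v = (1 - 1 / real (Suc k)) * t v + (1 / real (Suc k)) * b v" for k v
  have b: "b \<in> closed_simplex \<sigma>" using b_open open_simplex_subset_closed by blast
  have p_open: "p k \<in> open_simplex \<sigma>" for k
  proof -
    have closed: "p k \<in> closed_simplex \<sigma>"
      unfolding p_def using t b by (rule segment_in_closed_simplex) auto
    have "p k v > 0" if "v \<in> \<sigma>" for v
    proof -
      have "b v > 0" using that b_open unfolding open_simplex_def support_def by (auto simp: less_le)
      then have "(1 / real (Suc k)) * b v > 0" by simp
      moreover have "(1 - 1 / real (Suc k)) * t v \<ge> 0"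
        using closed_simplexD(1)[OF t] by (intro mult_nonneg_nonneg) auto
      ultimately show ?thesis unfolding p_def by linarith
    qed
    then have "\<sigma> \<subseteq> support (p k)" unfolding support_def by fastforce
    then show ?thesis using closed unfolding closed_simplex_def open_simplex_def by auto
  qed
  have "(\<lambda>k. p k v) \<longlonglongrightarrow> (1 - 0) * t v + 0 * b v" for v
    unfolding p_def by (intro tendsto_intros LIMSEQ_Suc[OF lim_1_over_n])
  then have coordinatewise: "(\<lambda>k. p k v) \<longlonglongrightarrow> t v" for v by simp
  have "limitin euclidean p t sequentially"
  proof -
    have "limitin (product_topology (\<lambda>v. euclideanreal) UNIV) p t sequentially"
      unfolding limitin_componentwise using coordinatewise by auto
    then show ?thesis by (simp add: euclidean_product_topology)
  qed
  then have lim: "p \<longlonglongrightarrow> t" by simp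
  show "t \<in> realization K closure_of open_simplex \<sigma>"
    unfolding in_closure_of
  proof (intro conjI allI impI)
    show "t \<in> topspace (realization K)" using t \<sigma> by (auto simp: topspace_realization)
    fix T assume T: "t \<in> T \<and> openin (realization K) T"
    then obtain U where U: "open U" "T = underlying_set K \<inter> U"
      unfolding realization_locally_finite[OF K] openin_open by blast
    have "eventually (\<lambda>k. p k \<in> U) sequentially"
      using topological_tendstoD[OF lim U(1)] T U(2) by blast
    then obtain k where "p k \<in> U" using eventually_happens by force
    then show "\<exists>y. y \<in> open_simplex \<sigma> \<and> y \<in> T"
      using p_open[of k] open_simplex_subset_closed \<sigma> U(2) by blast
  qed
qed

text \<open>Each point lies in the open simplex on its support, and only there. The closure of an
  open simplex contains the closed simplex, so the coherence condition on cells follows from the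
  weak topology.\<close>

theorem CW_complex_realization:
  assumes K: "locally_finite_complex K"
    and faces: "\<And>\<sigma> \<tau>. \<sigma> \<in> K \<Longrightarrow> \<tau> \<subseteq> \<sigma> \<Longrightarrow> \<tau> \<noteq> {} \<Longrightarrow> \<tau> \<in> K"
  shows "CW_complex (realization K) (simplicial_cells K)"
  unfolding CW_complex_def
proof (intro conjI allI ballI impI)
  show "Hausdorff_space (realization K)" using Hausdorff_realization[OF K] .
  have support_mem: "support t \<in> K" if "\<sigma> \<in> K" "t \<in> closed_simplex \<sigma>" for t \<sigma>
    using faces[OF that(1) closed_simplexD(4)[OF that(2)] support_nonempty[OF that(2)]] .
  show "(\<Union>n. \<Union>(simplicial_cells K n)) = topspace (realization K)"
  proof
    show "(\<Union>n. \<Union>(simplicial_cells K n)) \<subseteq> topspace (realization K)"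
      unfolding simplicial_cells_def topspace_realization using open_simplex_subset_closed by blast
    show "topspace (realization K) \<subseteq> (\<Union>n. \<Union>(simplicial_cells K n))"
    proof
      fix t assume "t \<in> topspace (realization K)"
      then obtain \<sigma> where \<sigma>: "\<sigma> \<in> K" "t \<in> closed_simplex \<sigma>" unfolding topspace_realization by blast
      have supp: "support t \<in> K" using support_mem[OF \<sigma>] .
      then obtain n where "card (support t) = Suc n"
        using locally_finite_complexD(1,2)[OF K supp] by (metis card_eq_0_iff not0_implies_Suc)
      then show "t \<in> (\<Union>n. \<Union>(simplicial_cells K n))"
        using mem_closed_simplex_support(2)[OF locally_finite_complexD(1)[OF K \<sigma>(1)] \<sigma>(2)] supp
        unfolding simplicial_cells_def by blast
    qed
  qed
  fix m n c c'
  assume c: "c \<in> simplicial_cells K m" "c' \<in> simplicial_cells K n" "(m, c) \<noteq> (n, c')"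
  then obtain \<sigma> \<tau> where *: "c = open_simplex \<sigma>" "card \<sigma> = Suc m" "c' = open_simplex \<tau>" "card \<tau> = Suc n"
    unfolding simplicial_cells_def by blast
  show "c \<inter> c' = {}"
  proof (rule ccontr)
    assume "c \<inter> c' \<noteq> {}"
    then have "\<sigma> = \<tau>" unfolding * open_simplex_def by blast
    then show False using * c(3) by simp
  qed
next
  fix n c assume "c \<in> simplicial_cells K n"
  then obtain \<sigma> where "c = open_simplex \<sigma>" "\<sigma> \<in> K" "card \<sigma> = Suc n"
    unfolding simplicial_cells_def by blast
  then show "\<exists>\<Phi>. characteristic_map (realization K) (simplicial_cells K) n c \<Phi>"
    using characteristic_map_simplex[OF K faces] by simp
next
  fix A assume A: "A \<subseteq> topspace (realization K)"
    and cells: "\<forall>n. \<forall>c\<in>simplicial_cells K n. closedin (realization K) (A \<inter> realization K closure_of c)"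
  have "openin (realization K) (topspace (realization K) - A)"
    unfolding openin_realization
  proof (intro conjI ballI)
    show "topspace (realization K) - A \<subseteq> underlying_set K" by (auto simp: topspace_realization)
    fix \<sigma> assume \<sigma>: "\<sigma> \<in> K"
    let ?cl = "realization K closure_of open_simplex \<sigma>"
    obtain n where "card \<sigma> = Suc n"
      using locally_finite_complexD(1,2)[OF K \<sigma>] by (metis card_eq_0_iff not0_implies_Suc)
    then have "open_simplex \<sigma> \<in> simplicial_cells K n" unfolding simplicial_cells_def using \<sigma> by blast
    then have "closedin (realization K) (A \<inter> ?cl)" using cells by blast
    then have "openin (realization K) (topspace (realization K) - (A \<inter> ?cl))"
      by (rule openin_diff[OF openin_topspace])
    then have "openin (top_of_set (closed_simplex \<sigma>))
        ((topspace (realization K) - (A \<inter> ?cl)) \<inter> closed_simplex \<sigma>)"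
      unfolding openin_realization using \<sigma> by blast
    moreover have "(topspace (realization K) - (A \<inter> ?cl)) \<inter> closed_simplex \<sigma> =
        (topspace (realization K) - A) \<inter> closed_simplex \<sigma>"
      using closed_simplex_subset_closure[OF K \<sigma>] by blast
    ultimately show "openin (top_of_set (closed_simplex \<sigma>))
        ((topspace (realization K) - A) \<inter> closed_simplex \<sigma>)" by simp
  qed
  then show "closedin (realization K) A" using A unfolding closedin_def by blast
qed


section \<open>Affine extensions of vertex maps\<close>

lemma affine_extension_eq_sum:
  assumes "finite \<sigma>" "t \<in> closed_simplex \<sigma>"
  shows "affine_extension f t w = (\<Sum>v\<in>support t. t v * of_bool (w = f v))"
    and "affine_extension f t w = (\<Sum>v\<in>\<sigma>. t v * of_bool (w = f v))"
proof -
  have "finite (support t)" using closed_simplexD(4)[OF assms(2)] assms(1) by (rule finite_subset)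
  then show eq: "affine_extension f t w = (\<Sum>v\<in>support t. t v * of_bool (w = f v))"
    unfolding affine_extension_def by (intro sum.mono_neutral_cong_left) auto
  show "affine_extension f t w = (\<Sum>v\<in>\<sigma>. t v * of_bool (w = f v))"
    unfolding eq using assms(1) closed_simplexD(4)[OF assms(2)] by (rule sum_support)
qed

lemma affine_extension_closed_simplex:
  assumes "finite \<sigma>" "t \<in> closed_simplex \<sigma>"
  shows "affine_extension f t \<in> closed_simplex (f ` \<sigma>)"
proof -
  have "(\<lambda>w. \<Sum>v\<in>support t. t v * of_bool (w = f v)) \<in> closed_simplex (f ` \<sigma>)"
    using assms by (intro convex_combination_in_closed_simplex[OF assms] vertex_in_closed_simplex) auto
  moreover have "affine_extension f t = (\<lambda>w. \<Sum>v\<in>support t. t v * of_bool (w = f v))"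
    using affine_extension_eq_sum(1)[OF assms] by (rule ext)
  ultimately show ?thesis by simp
qed

text \<open>Coordinates are nonnegative, so nothing cancels when vertices are identified.\<close>

lemma support_affine_extension:
  assumes "finite \<sigma>" "t \<in> closed_simplex \<sigma>"
  shows "support (affine_extension f t) = f ` support t"
proof -
  have fin: "finite (support t)"
    using closed_simplexD(4)[OF assms(2)] assms(1) by (rule finite_subset)
  have "affine_extension f t w \<noteq> 0 \<longleftrightarrow> (\<exists>v\<in>support t. w = f v)" for w
  proof -
    have "affine_extension f t w = 0 \<longleftrightarrow> (\<forall>v\<in>support t. t v * of_bool (w = f v) = 0)"
      unfolding affine_extension_eq_sum(1)[OF assms]
      using closed_simplexD(1)[OF assms(2)] fin by (intro sum_nonneg_eq_0_iff) auto
    then show ?thesis by (auto simp: support_def)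
  qed
  then show ?thesis unfolding support_def[of "affine_extension f t"] by blast
qed

lemma affine_extension_open_simplex:
  assumes "finite \<sigma>" "t \<in> open_simplex \<sigma>"
  shows "affine_extension f t \<in> open_simplex (f ` \<sigma>)"
proof -
  have t: "t \<in> closed_simplex \<sigma>" using assms(2) open_simplex_subset_closed by blast
  have "support (affine_extension f t) = f ` \<sigma>"
    using support_affine_extension[OF assms(1) t] assms(2) unfolding open_simplex_def by simp
  then show ?thesis
    using affine_extension_closed_simplex[OF assms(1) t, of f]
    unfolding open_simplex_def closed_simplex_def by simp
qed

lemma affine_extension_compose:
  assumes "finite \<sigma>" "t \<in> closed_simplex \<sigma>"
  shows "affine_extension f (affine_extension g t) = affine_extension (f \<circ> g) t"
proof
  fix w
  have "affine_extension f (affine_extension g t) w =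
      (\<Sum>u\<in>g ` \<sigma>. (\<Sum>v\<in>\<sigma>. t v * of_bool (u = g v)) * of_bool (w = f u))"
    unfolding affine_extension_eq_sum(2)[OF finite_imageI[OF assms(1)]
        affine_extension_closed_simplex[OF assms]] affine_extension_eq_sum(2)[OF assms] ..
  also have "\<dots> = (\<Sum>v\<in>\<sigma>. \<Sum>u\<in>g ` \<sigma>. t v * of_bool (u = g v) * of_bool (w = f u))"
    unfolding sum_distrib_right by (rule sum.swap)
  also have "\<dots> = (\<Sum>v\<in>\<sigma>. t v * of_bool (w = f (g v)))"
  proof (rule sum.cong[OF refl])
    fix v assume v: "v \<in> \<sigma>"
    have "(\<Sum>u\<in>g ` \<sigma>. t v * of_bool (u = g v) * of_bool (w = f u)) =
        (\<Sum>u\<in>g ` \<sigma>. if u = g v then t v * of_bool (w = f (g v)) else 0)"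
      by (rule sum.cong) auto
    then show "(\<Sum>u\<in>g ` \<sigma>. t v * of_bool (u = g v) * of_bool (w = f u)) =
        t v * of_bool (w = f (g v))"
      using v assms(1) by simp
  qed
  finally show "affine_extension f (affine_extension g t) w = affine_extension (f \<circ> g) t w"
    unfolding affine_extension_eq_sum(2)[OF assms] by simp
qed

lemma affine_extension_id:
  assumes "finite \<sigma>" "t \<in> closed_simplex \<sigma>" "\<And>v. v \<in> \<sigma> \<Longrightarrow> f v = v"
  shows "affine_extension f t = t"
proof
  fix w
  have "affine_extension f t w = (\<Sum>v\<in>\<sigma>. if v = w then t w else 0)"
    unfolding affine_extension_eq_sum(2)[OF assms(1,2)] using assms(3) by (intro sum.cong) auto
  then show "affine_extension f t w = t w"
    using assms(1) closed_simplexD(2)[OF assms(2)] by simp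
qed

lemma affine_extension_cong:
  assumes "finite \<sigma>" "t \<in> closed_simplex \<sigma>" "\<And>v. v \<in> \<sigma> \<Longrightarrow> f v = g v"
  shows "affine_extension f t = affine_extension g t"
proof
  fix w
  show "affine_extension f t w = affine_extension g t w"
    unfolding affine_extension_eq_sum(2)[OF assms(1,2)] using assms(3) by (intro sum.cong) auto
qed

lemma continuous_on_affine_extension:
  assumes K: "locally_finite_complex K"
  shows "continuous_on (underlying_set K) (affine_extension f)"
proof (rule continuous_on_coordinatewise_then_product)
  fix w
  have "continuous_on (underlying_set K) (\<lambda>t. \<Sum>v\<in>support t. t v * of_bool (w = f v))"
    by (rule continuous_on_weighted_sum[OF K]) (auto intro: continuous_on_id)
  moreover have "affine_extension f t w = (\<Sum>v\<in>support t. t v * of_bool (w = f v))"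
    if t: "t \<in> underlying_set K" for t
  proof -
    obtain \<sigma> where \<sigma>: "\<sigma> \<in> K" "t \<in> closed_simplex \<sigma>" using t by blast
    show ?thesis by (rule affine_extension_eq_sum(1)[OF locally_finite_complexD(1)[OF K \<sigma>(1)] \<sigma>(2)])
  qed
  ultimately show "continuous_on (underlying_set K) (\<lambda>t. affine_extension f t w)"
    by (subst continuous_on_cong[OF refl])
qed


section \<open>Cocompact simplicial actions\<close>

text \<open>The laws of an action are required on vertices of the complex only, because left
  multiplication satisfies them only on the carrier of the group. The last two assumptions
  express properness and cocompactness by simplices, in a form that passes to the subdivision.\<close>

locale simplicial_action = group G for G (structure) +
  fixes K :: "'v set set" and \<alpha> :: "'a \<Rightarrow> 'v \<Rightarrow> 'v"
  assumes locally_finite: "locally_finite_complex K"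
    and faces: "\<sigma> \<in> K \<Longrightarrow> \<tau> \<subseteq> \<sigma> \<Longrightarrow> \<tau> \<noteq> {} \<Longrightarrow> \<tau> \<in> K"
    and translate: "g \<in> carrier G \<Longrightarrow> \<sigma> \<in> K \<Longrightarrow> \<alpha> g ` \<sigma> \<in> K"
    and act_one: "\<sigma> \<in> K \<Longrightarrow> v \<in> \<sigma> \<Longrightarrow> \<alpha> \<one> v = v"
    and act_mult: "g \<in> carrier G \<Longrightarrow> h \<in> carrier G \<Longrightarrow> \<sigma> \<in> K \<Longrightarrow> v \<in> \<sigma> \<Longrightarrow>
      \<alpha> (g \<otimes> h) v = \<alpha> g (\<alpha> h v)"
    and finite_isotropy: "\<sigma> \<in> K \<Longrightarrow> finite {g \<in> carrier G. \<alpha> g ` \<sigma> = \<sigma>}"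
    and cofinite: "\<exists>F. finite F \<and> F \<subseteq> K \<and> (\<forall>\<sigma>\<in>K. \<exists>g\<in>carrier G. \<exists>\<tau>\<in>F. \<sigma> = \<alpha> g ` \<tau>)"
begin

lemma simplex_finite: "\<sigma> \<in> K \<Longrightarrow> finite \<sigma>"
  and simplex_nonempty: "\<sigma> \<in> K \<Longrightarrow> \<sigma> \<noteq> {}"
  using locally_finite_complexD(1,2)[OF locally_finite] by auto

lemma image_mult:
  assumes "g \<in> carrier G" "h \<in> carrier G" "\<sigma> \<in> K"
  shows "\<alpha> (g \<otimes> h) ` \<sigma> = \<alpha> g ` \<alpha> h ` \<sigma>"
  unfolding image_image using act_mult[OF assms] by (intro image_cong) auto

lemma image_one: "\<sigma> \<in> K \<Longrightarrow> \<alpha> \<one> ` \<sigma> = \<sigma>"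
  using act_one by force

lemma image_inv:
  assumes "g \<in> carrier G" "\<sigma> \<in> K"
  shows "\<alpha> (inv g) ` \<alpha> g ` \<sigma> = \<sigma>" "\<alpha> g ` \<alpha> (inv g) ` \<sigma> = \<sigma>"
  using image_mult[of "inv g" g \<sigma>] image_mult[of g "inv g" \<sigma>] image_one assms by simp_all

lemma act_inj:
  assumes "g \<in> carrier G" "\<sigma> \<in> K"
  shows "inj_on (\<alpha> g) \<sigma>"
proof (rule inj_on_inverseI[where g = "\<alpha> (inv g)"])
  fix v assume "v \<in> \<sigma>"
  then show "\<alpha> (inv g) (\<alpha> g v) = v"
    using act_mult[of "inv g" g \<sigma> v] act_one[of \<sigma> v] assms by simp
qed

abbreviation \<phi> :: "'a \<Rightarrow> ('v \<Rightarrow> real) \<Rightarrow> 'v \<Rightarrow> real" where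
  "\<phi> \<equiv> realization_action K \<alpha>"

lemma \<phi>_eq: "t \<in> underlying_set K \<Longrightarrow> \<phi> g t = affine_extension (\<alpha> g) t"
  unfolding realization_action_def topspace_realization by simp

lemma \<phi>_closed_simplex:
  assumes "\<sigma> \<in> K" "t \<in> closed_simplex \<sigma>"
  shows "\<phi> g t \<in> closed_simplex (\<alpha> g ` \<sigma>)"
proof -
  have "t \<in> underlying_set K" using assms by blast
  then show ?thesis
    using affine_extension_closed_simplex[OF simplex_finite[OF assms(1)] assms(2)] by (simp add: \<phi>_eq)
qed

lemma \<phi>_closed:
  assumes "g \<in> carrier G" "t \<in> underlying_set K"
  shows "\<phi> g t \<in> underlying_set K"
proof -
  obtain \<sigma> where "\<sigma> \<in> K" "t \<in> closed_simplex \<sigma>" using assms(2) by blast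
  then show ?thesis
    using \<phi>_closed_simplex[of \<sigma> t g] translate[OF assms(1), of \<sigma>] by blast
qed

lemma \<phi>_mult:
  assumes "g \<in> carrier G" "h \<in> carrier G" "t \<in> underlying_set K"
  shows "\<phi> (g \<otimes> h) t = \<phi> g (\<phi> h t)"
proof -
  obtain \<sigma> where \<sigma>: "\<sigma> \<in> K" "t \<in> closed_simplex \<sigma>" using assms(3) by blast
  have "affine_extension (\<alpha> (g \<otimes> h)) t = affine_extension (\<alpha> g \<circ> \<alpha> h) t"
    using act_mult[OF assms(1,2) \<sigma>(1)]
    by (intro affine_extension_cong[OF simplex_finite[OF \<sigma>(1)] \<sigma>(2)]) simp
  also have "\<dots> = affine_extension (\<alpha> g) (affine_extension (\<alpha> h) t)"
    by (rule affine_extension_compose[OF simplex_finite[OF \<sigma>(1)] \<sigma>(2), symmetric])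
  finally show ?thesis
    using \<phi>_closed[OF assms(2,3)] assms(3) by (simp add: \<phi>_eq)
qed

lemma \<phi>_one: "t \<in> underlying_set K \<Longrightarrow> \<phi> \<one> t = t"
proof -
  assume t: "t \<in> underlying_set K"
  then obtain \<sigma> where \<sigma>: "\<sigma> \<in> K" "t \<in> closed_simplex \<sigma>" by blast
  show "\<phi> \<one> t = t"
    unfolding \<phi>_eq[OF t] using act_one[OF \<sigma>(1)]
    by (rule affine_extension_id[OF simplex_finite[OF \<sigma>(1)] \<sigma>(2)])
qed

lemma \<phi>_inv:
  assumes "g \<in> carrier G" "t \<in> underlying_set K"
  shows "\<phi> (inv g) (\<phi> g t) = t" "\<phi> g (\<phi> (inv g) t) = t"
  using \<phi>_mult[of "inv g" g t] \<phi>_mult[of g "inv g" t] \<phi>_one assms by simp_all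

lemma group_action_\<phi>: "group_action G (topspace (realization K)) \<phi>"
proof -
  let ?E = "underlying_set K"
  have bij: "\<phi> g \<in> Bij ?E" if g: "g \<in> carrier G" for g
  proof -
    have "bij_betw (\<phi> g) ?E ?E"
      by (rule bij_betw_byWitness[where f' = "\<phi> (inv g)"])
        (use g \<phi>_inv \<phi>_closed in \<open>simp_all add: image_subset_iff\<close>)
    moreover have "\<phi> g \<in> extensional ?E"
      unfolding realization_action_def topspace_realization by (rule restrict_extensional)
    ultimately show ?thesis unfolding Bij_def by simp
  qed
  have "\<phi> (g \<otimes> h) = compose ?E (\<phi> g) (\<phi> h)" if "g \<in> carrier G" "h \<in> carrier G" for g h
  proof
    fix t
    show "\<phi> (g \<otimes> h) t = compose ?E (\<phi> g) (\<phi> h) t"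
    proof (cases "t \<in> ?E")
      case True
      then show ?thesis using \<phi>_mult[OF that] by (simp add: compose_def)
    next
      case False
      then show ?thesis by (simp add: compose_def realization_action_def topspace_realization)
    qed
  qed
  then have "\<phi> \<in> hom G (BijGroup ?E)"
    using bij unfolding hom_def BijGroup_def by auto
  then show ?thesis
    unfolding group_action_def group_hom_def group_hom_axioms_def topspace_realization
    using is_group group_BijGroup by blast
qed

lemma continuous_\<phi>:
  assumes "g \<in> carrier G"
  shows "continuous_map (realization K) (realization K) (\<phi> g)"
proof -
  have "continuous_on (underlying_set K) (\<phi> g)"
    using continuous_on_affine_extension[OF locally_finite]
    by (subst continuous_on_cong[OF refl \<phi>_eq])
  moreover have "\<phi> g ` underlying_set K \<subseteq> underlying_set K"
    using \<phi>_closed[OF assms] by (rule image_subsetI)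
  ultimately show ?thesis
    by (simp add: realization_locally_finite[OF locally_finite] image_subset_iff_funcset)
qed

lemma homeomorphic_\<phi>:
  assumes "g \<in> carrier G"
  shows "homeomorphic_map (realization K) (realization K) (\<phi> g)"
  unfolding homeomorphic_map_maps homeomorphic_maps_def
  using continuous_\<phi>[OF assms] continuous_\<phi>[of "inv g"] \<phi>_inv[OF assms] assms
  by (intro exI[of _ "\<phi> (inv g)"]) (simp add: topspace_realization)

lemma \<phi>_open_simplex:
  assumes g: "g \<in> carrier G" and \<sigma>: "\<sigma> \<in> K"
  shows "\<phi> g ` open_simplex \<sigma> = open_simplex (\<alpha> g ` \<sigma>)"
proof -
  have into: "\<phi> h t \<in> open_simplex (\<alpha> h ` \<tau>)" if "\<tau> \<in> K" "t \<in> open_simplex \<tau>" for h t \<tau>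
  proof -
    have "t \<in> underlying_set K" using that open_simplex_subset_closed by blast
    then show ?thesis
      using affine_extension_open_simplex[OF simplex_finite[OF that(1)] that(2)] by (simp add: \<phi>_eq)
  qed
  show ?thesis
  proof
    show "\<phi> g ` open_simplex \<sigma> \<subseteq> open_simplex (\<alpha> g ` \<sigma>)"
      using into[OF \<sigma>] by (rule image_subsetI)
    show "open_simplex (\<alpha> g ` \<sigma>) \<subseteq> \<phi> g ` open_simplex \<sigma>"
    proof
      fix t assume t: "t \<in> open_simplex (\<alpha> g ` \<sigma>)"
      then have "t \<in> underlying_set K"
        using translate[OF g \<sigma>] open_simplex_subset_closed by blast
      then have "t = \<phi> g (\<phi> (inv g) t)" using \<phi>_inv(2)[OF g] by simp
      moreover have "\<phi> (inv g) t \<in> open_simplex \<sigma>"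
        using into[OF translate[OF g \<sigma>] t, of "inv g"] image_inv(1)[OF g \<sigma>] by simp
      ultimately show "t \<in> \<phi> g ` open_simplex \<sigma>" by blast
    qed
  qed
qed

lemma open_simplex_inject:
  assumes "\<sigma> \<in> K" "open_simplex \<sigma> = open_simplex \<tau>"
  shows "\<sigma> = \<tau>"
proof -
  obtain t where t: "t \<in> open_simplex \<sigma>"
    using open_simplex_nonempty[OF simplex_finite[OF assms(1)] simplex_nonempty[OF assms(1)]] by blast
  then have "t \<in> open_simplex \<tau>" unfolding assms(2) .
  with t show ?thesis unfolding open_simplex_def by blast
qed

text \<open>An element fixing a point maps the support of that point to itself.\<close>

lemma proper_\<phi>: "proper_action G (realization K) \<phi>"
  unfolding proper_action_def
proof
  fix t assume "t \<in> topspace (realization K)"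
  then obtain \<sigma> where \<sigma>: "\<sigma> \<in> K" "t \<in> closed_simplex \<sigma>" unfolding topspace_realization by blast
  have "support t \<in> K"
    using faces[OF \<sigma>(1) closed_simplexD(4)[OF \<sigma>(2)] support_nonempty[OF \<sigma>(2)]] .
  then have "finite {g \<in> carrier G. \<alpha> g ` support t = support t}" by (rule finite_isotropy)
  moreover have "stabilizer G \<phi> t \<subseteq> {g \<in> carrier G. \<alpha> g ` support t = support t}"
  proof
    fix g assume "g \<in> stabilizer G \<phi> t"
    then have g: "g \<in> carrier G" "\<phi> g t = t" unfolding stabilizer_def by auto
    moreover have "t \<in> underlying_set K" using \<sigma> by blast
    ultimately have "affine_extension (\<alpha> g) t = t" using \<phi>_eq[of t g] by simp
    then have "\<alpha> g ` support t = support t"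
      using support_affine_extension[OF simplex_finite[OF \<sigma>(1)] \<sigma>(2), of "\<alpha> g"] by simp
    then show "g \<in> {g \<in> carrier G. \<alpha> g ` support t = support t}" using g(1) by simp
  qed
  ultimately show "finite (stabilizer G \<phi> t)" by (rule finite_subset[rotated])
qed

lemma translates_mult_right:
  assumes "g \<in> carrier G"
  shows "(\<lambda>h. f (h \<otimes> g)) ` carrier G = f ` carrier G"
proof
  show "(\<lambda>h. f (h \<otimes> g)) ` carrier G \<subseteq> f ` carrier G" using assms by blast
  show "f ` carrier G \<subseteq> (\<lambda>h. f (h \<otimes> g)) ` carrier G"
  proof (rule image_subsetI)
    fix h assume "h \<in> carrier G"
    then show "f h \<in> (\<lambda>h. f (h \<otimes> g)) ` carrier G"
      using assms by (intro image_eqI[of _ _ "h \<otimes> inv g"]) (simp_all add: m_assoc)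
  qed
qed

text \<open>Every open simplex is in the orbit of one from the finite fundamental set.\<close>

lemma finite_equivariant_cells: "finite (equivariant_cells G (simplicial_cells K) \<phi>)"
proof -
  obtain F where F: "finite F" "F \<subseteq> K" "\<forall>\<sigma>\<in>K. \<exists>g\<in>carrier G. \<exists>\<tau>\<in>F. \<sigma> = \<alpha> g ` \<tau>"
    using cofinite by blast
  have orb: "orbit G (\<lambda>g e. \<phi> g ` e) (open_simplex \<sigma>) =
      (\<lambda>h. open_simplex (\<alpha> h ` \<sigma>)) ` carrier G" if "\<sigma> \<in> K" for \<sigma>
    unfolding orbit_def using \<phi>_open_simplex[OF _ that] by auto
  have "equivariant_cells G (simplicial_cells K) \<phi> \<subseteq>
      (\<lambda>\<tau>. orbit G (\<lambda>g e. \<phi> g ` e) (open_simplex \<tau>)) ` F"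
  proof
    fix O' assume "O' \<in> equivariant_cells G (simplicial_cells K) \<phi>"
    then obtain e where "e \<in> (\<Union>n. simplicial_cells K n)" "O' = orbit G (\<lambda>g e. \<phi> g ` e) e"
      unfolding equivariant_cells_def orbits_def by blast
    then obtain \<sigma> where \<sigma>: "\<sigma> \<in> K" "O' = orbit G (\<lambda>g e. \<phi> g ` e) (open_simplex \<sigma>)"
      unfolding simplicial_cells_def by blast
    obtain g \<tau> where g: "g \<in> carrier G" "\<tau> \<in> F" "\<sigma> = \<alpha> g ` \<tau>" using bspec[OF F(3) \<sigma>(1)] by blast
    have \<tau>: "\<tau> \<in> K" using g F by blast
    have "O' = (\<lambda>h. open_simplex (\<alpha> h ` \<alpha> g ` \<tau>)) ` carrier G"
      using \<sigma>(2) orb[OF \<sigma>(1)] g(3) by simp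
    also have "\<dots> = (\<lambda>h. open_simplex (\<alpha> (h \<otimes> g) ` \<tau>)) ` carrier G"
      using image_mult[OF _ g(1) \<tau>] by (intro image_cong) auto
    also have "\<dots> = (\<lambda>h. open_simplex (\<alpha> h ` \<tau>)) ` carrier G"
      by (rule translates_mult_right[OF g(1)])
    also have "\<dots> = orbit G (\<lambda>g e. \<phi> g ` e) (open_simplex \<tau>)" using orb[OF \<tau>] by simp
    finally show "O' \<in> (\<lambda>\<tau>. orbit G (\<lambda>g e. \<phi> g ` e) (open_simplex \<tau>)) ` F" using g(2) by blast
  qed
  then show ?thesis using finite_imageI[OF F(1)] by (rule finite_subset)
qed

text \<open>The orbit space is the image of the compact union of the closed simplices in the
  fundamental set.\<close>

lemma compact_orbit_space: "compact_space (orbit_space G (realization K) \<phi>)"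
proof -
  let ?X = "realization K" and ?Y = "orbit_space G (realization K) \<phi>"
  obtain F where F: "finite F" "F \<subseteq> K" "\<forall>\<sigma>\<in>K. \<exists>g\<in>carrier G. \<exists>\<tau>\<in>F. \<sigma> = \<alpha> g ` \<tau>"
    using cofinite by blast
  have mem_orbits: "orbit G \<phi> t \<in> orbits G (topspace ?X) \<phi>" if "t \<in> topspace ?X" for t
    using that unfolding orbits_def by blast
  then have "{t \<in> topspace ?X. orbit G \<phi> t \<in> orbits G (topspace ?X) \<phi>} = topspace ?X" by blast
  then have "openin ?Y (orbits G (topspace ?X) \<phi>)" unfolding openin_orbit_space by simp
  moreover have "topspace ?Y \<subseteq> orbits G (topspace ?X) \<phi>"
    using openin_orbit_space[of G ?X \<phi> "topspace ?Y"] by simp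
  ultimately have top: "topspace ?Y = orbits G (topspace ?X) \<phi>"
    using openin_subset by blast
  have cont: "continuous_map ?X ?Y (orbit G \<phi>)"
    unfolding continuous_map_def top using mem_orbits by (simp add: openin_orbit_space)
  have "compact (\<Union>\<tau>\<in>F. closed_simplex \<tau>)"
    using F(1,2) simplex_finite by (intro compact_UN compact_closed_simplex) auto
  then have "compactin ?X (\<Union>\<tau>\<in>F. closed_simplex \<tau>)"
    using F(2) by (auto simp: realization_locally_finite[OF locally_finite] compactin_subtopology)
  then have "compactin ?Y (orbit G \<phi> ` (\<Union>\<tau>\<in>F. closed_simplex \<tau>))"
    using cont by (rule image_compactin)
  moreover have "orbit G \<phi> ` (\<Union>\<tau>\<in>F. closed_simplex \<tau>) = orbits G (topspace ?X) \<phi>"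
  proof
    have "closed_simplex \<tau> \<subseteq> topspace ?X" if "\<tau> \<in> F" for \<tau>
      using that F(2) unfolding topspace_realization by blast
    then show "orbit G \<phi> ` (\<Union>\<tau>\<in>F. closed_simplex \<tau>) \<subseteq> orbits G (topspace ?X) \<phi>"
      using mem_orbits by blast
    show "orbits G (topspace ?X) \<phi> \<subseteq> orbit G \<phi> ` (\<Union>\<tau>\<in>F. closed_simplex \<tau>)"
    proof
      fix O' assume "O' \<in> orbits G (topspace ?X) \<phi>"
      then obtain t \<sigma> where t: "O' = orbit G \<phi> t" "\<sigma> \<in> K" "t \<in> closed_simplex \<sigma>"
        unfolding orbits_def topspace_realization by blast
      obtain g \<tau> where g: "g \<in> carrier G" "\<tau> \<in> F" "\<sigma> = \<alpha> g ` \<tau>" using bspec[OF F(3) t(2)] by blast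
      have \<tau>: "\<tau> \<in> K" using g F by blast
      define s where "s = \<phi> (inv g) t"
      have s: "s \<in> closed_simplex \<tau>"
        using \<phi>_closed_simplex[OF t(2,3), of "inv g"] image_inv(1)[OF g(1) \<tau>] g(3)
        unfolding s_def by simp
      have sK: "s \<in> underlying_set K" using s \<tau> by blast
      have tK: "t \<in> underlying_set K" using t(2,3) by blast
      have "t = \<phi> g s" unfolding s_def by (rule \<phi>_inv(2)[OF g(1) tK, symmetric])
      have "orbit G \<phi> t = (\<lambda>h. \<phi> h (\<phi> g s)) ` carrier G"
        unfolding orbit_def \<open>t = \<phi> g s\<close> by blast
      also have "\<dots> = (\<lambda>h. \<phi> (h \<otimes> g) s) ` carrier G"
        using \<phi>_mult[OF _ g(1) sK] by (intro image_cong) auto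
      also have "\<dots> = (\<lambda>h. \<phi> h s) ` carrier G" by (rule translates_mult_right[OF g(1)])
      also have "\<dots> = orbit G \<phi> s" unfolding orbit_def by blast
      finally show "O' \<in> orbit G \<phi> ` (\<Union>\<tau>\<in>F. closed_simplex \<tau>)" using t(1) s g(2) by blast
    qed
  qed
  ultimately show ?thesis unfolding compact_space_def top by simp
qed

lemma GCW_complex_\<phi>:
  assumes rigid: "\<And>g \<sigma> v. g \<in> carrier G \<Longrightarrow> \<sigma> \<in> K \<Longrightarrow> \<alpha> g ` \<sigma> = \<sigma> \<Longrightarrow> v \<in> \<sigma> \<Longrightarrow> \<alpha> g v = v"
  shows "GCW_complex G (realization K) (simplicial_cells K) \<phi>"
  unfolding GCW_complex_def
proof (intro conjI ballI allI impI)
  show "CW_complex (realization K) (simplicial_cells K)"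
    using locally_finite faces by (rule CW_complex_realization)
  show "group_action G (topspace (realization K)) \<phi>" by (rule group_action_\<phi>)
  show "homeomorphic_map (realization K) (realization K) (\<phi> g)" if "g \<in> carrier G" for g
    using that by (rule homeomorphic_\<phi>)
  fix g n e assume g: "g \<in> carrier G" and "e \<in> simplicial_cells K n"
  then obtain \<sigma> where \<sigma>: "\<sigma> \<in> K" "card \<sigma> = Suc n" "e = open_simplex \<sigma>"
    unfolding simplicial_cells_def by blast
  have image: "\<phi> g ` e = open_simplex (\<alpha> g ` \<sigma>)" using \<phi>_open_simplex[OF g \<sigma>(1)] \<sigma>(3) by simp
  have "card (\<alpha> g ` \<sigma>) = Suc n" using card_image[OF act_inj[OF g \<sigma>(1)]] \<sigma>(2) by simp
  then show "\<phi> g ` e \<in> simplicial_cells K n"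
    unfolding image simplicial_cells_def using translate[OF g \<sigma>(1)] by blast
  fix t assume eq: "\<phi> g ` e = e" and t: "t \<in> e"
  have "open_simplex \<sigma> = open_simplex (\<alpha> g ` \<sigma>)"
    unfolding image[symmetric] eq by (rule \<sigma>(3)[symmetric])
  then have fixed: "\<alpha> g ` \<sigma> = \<sigma>" by (rule open_simplex_inject[OF \<sigma>(1), symmetric])
  have tc: "t \<in> closed_simplex \<sigma>" using t \<sigma>(3) open_simplex_subset_closed by blast
  then have "t \<in> underlying_set K" using \<sigma>(1) by blast
  then have "\<phi> g t = affine_extension (\<alpha> g) t" by (rule \<phi>_eq)
  also have "\<dots> = t"
    using rigid[OF g \<sigma>(1) fixed] by (rule affine_extension_id[OF simplex_finite[OF \<sigma>(1)] tc])
  finally show "\<phi> g t = t" .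
qed

text \<open>The simplices \<open>\<sigma>\<close> and \<open>\<alpha> g ` \<sigma>\<close> both belong to the chain, so one contains the other, and they
  have the same finite cardinality.\<close>

lemma subdivision_rigid:
  assumes g: "g \<in> carrier G" and c: "c \<in> barycentric_subdivision K"
    and fixed: "subdivision_action \<alpha> g ` c = c" and \<sigma>: "\<sigma> \<in> c"
  shows "\<alpha> g ` \<sigma> = \<sigma>"
proof -
  have \<sigma>K: "\<sigma> \<in> K" using bary_chainD(3)[OF c \<sigma>] .
  have "subdivision_action \<alpha> g \<sigma> \<in> subdivision_action \<alpha> g ` c" using \<sigma> by (rule imageI)
  then have mem: "\<alpha> g ` \<sigma> \<in> c" unfolding fixed unfolding subdivision_action_def .
  have fin: "finite \<sigma>" "finite (\<alpha> g ` \<sigma>)" using simplex_finite[OF \<sigma>K] by auto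
  have card: "card (\<alpha> g ` \<sigma>) = card \<sigma>" using act_inj[OF g \<sigma>K] by (rule card_image)
  have "\<alpha> g ` \<sigma> \<subseteq> \<sigma> \<or> \<sigma> \<subseteq> \<alpha> g ` \<sigma>" using bary_chainD(4)[OF c mem \<sigma>] .
  then show ?thesis
    using card_subset_eq[OF fin(1) _ card] card_subset_eq[OF fin(2) _ card[symmetric]] by auto
qed

lemma translate_chain:
  assumes "g \<in> carrier G" "c \<in> barycentric_subdivision K"
  shows "subdivision_action \<alpha> g ` c \<in> barycentric_subdivision K"
  unfolding barycentric_subdivision_def mem_Collect_eq
proof (intro conjI ballI)
  show "subdivision_action \<alpha> g ` c \<subseteq> K"
    unfolding subdivision_action_def
    using translate[OF assms(1) bary_chainD(3)[OF assms(2)]] by (rule image_subsetI)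
  fix \<sigma> \<tau> assume "\<sigma> \<in> subdivision_action \<alpha> g ` c" "\<tau> \<in> subdivision_action \<alpha> g ` c"
  then obtain \<sigma>' \<tau>' where *: "\<sigma>' \<in> c" "\<tau>' \<in> c" "\<sigma> = \<alpha> g ` \<sigma>'" "\<tau> = \<alpha> g ` \<tau>'"
    unfolding subdivision_action_def by blast
  then show "\<sigma> \<subseteq> \<tau> \<or> \<tau> \<subseteq> \<sigma>"
    using bary_chainD(4)[OF assms(2) *(1,2)] by (auto dest: image_mono)
qed (use bary_chainD(1,2)[OF assms(2)] in auto)

text \<open>By rigidity, the isotropy group of a chain is contained in that of each member. A
  fundamental set is formed by the chains that pass through a simplex of the given fundamental
  set, and there are finitely many of them by local finiteness.\<close>

lemma simplicial_action_subdivision: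
  "simplicial_action G (barycentric_subdivision K) (subdivision_action \<alpha>)"
proof unfold_locales
  let ?B = "barycentric_subdivision K" and ?\<beta> = "subdivision_action \<alpha>"
  show lf: "locally_finite_complex ?B" using locally_finite by (rule locally_finite_barycentric_subdivision)
  show "b \<in> ?B" if "c \<in> ?B" "b \<subseteq> c" "b \<noteq> {}" for b c
    using that by (rule bary_subset_closed)
  show "?\<beta> g ` c \<in> ?B" if "g \<in> carrier G" "c \<in> ?B" for g c
    using that by (rule translate_chain)
  show one: "?\<beta> \<one> \<sigma> = \<sigma>" if "c \<in> ?B" "\<sigma> \<in> c" for c \<sigma>
    using image_one[OF bary_chainD(3)[OF that]] by (simp add: subdivision_action_def)
  show mult: "?\<beta> (g \<otimes> h) \<sigma> = ?\<beta> g (?\<beta> h \<sigma>)"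
    if "g \<in> carrier G" "h \<in> carrier G" "c \<in> ?B" "\<sigma> \<in> c" for g h c \<sigma>
    using image_mult[OF that(1,2) bary_chainD(3)[OF that(3,4)]] by (simp add: subdivision_action_def)
  show "finite {g \<in> carrier G. ?\<beta> g ` c = c}" if c: "c \<in> ?B" for c
  proof -
    obtain \<sigma> where \<sigma>: "\<sigma> \<in> c" using bary_chainD(2)[OF c] by blast
    have "{g \<in> carrier G. ?\<beta> g ` c = c} \<subseteq> {g \<in> carrier G. \<alpha> g ` \<sigma> = \<sigma>}"
      using subdivision_rigid[OF _ c _ \<sigma>] by auto
    then show ?thesis using finite_isotropy[OF bary_chainD(3)[OF c \<sigma>]] by (rule finite_subset)
  qed
  obtain F where F: "finite F" "F \<subseteq> K" "\<forall>\<sigma>\<in>K. \<exists>g\<in>carrier G. \<exists>\<tau>\<in>F. \<sigma> = \<alpha> g ` \<tau>"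
    using cofinite by blast
  let ?F = "\<Union>\<tau>\<in>F. {c \<in> ?B. \<tau> \<in> c}"
  have "finite ?F" using F(1) locally_finite_complexD(3)[OF lf] by (rule finite_UN_I)
  moreover have "\<exists>g\<in>carrier G. \<exists>b\<in>?F. c = ?\<beta> g ` b" if c: "c \<in> ?B" for c
  proof -
    obtain \<sigma> where \<sigma>: "\<sigma> \<in> c" "\<sigma> \<in> K" using bary_chainD(2,3)[OF c] by blast
    obtain g \<tau> where g: "g \<in> carrier G" "\<tau> \<in> F" "\<sigma> = \<alpha> g ` \<tau>" using bspec[OF F(3) \<sigma>(2)] by blast
    have \<tau>: "\<tau> \<in> K" using g(2) F(2) by blast
    let ?b = "?\<beta> (inv g) ` c"
    have "?b \<in> ?B" using translate_chain[OF _ c] g(1) by simp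
    moreover have "?\<beta> (inv g) \<sigma> = \<tau>"
      using image_inv(1)[OF g(1) \<tau>] g(3) by (simp add: subdivision_action_def)
    then have "\<tau> \<in> ?b" using \<sigma>(1) by blast
    ultimately have "?b \<in> ?F" using g(2) by blast
    moreover have "c = ?\<beta> g ` ?b"
    proof -
      have "?\<beta> g ` ?b = (\<lambda>\<sigma>. \<sigma>) ` c"
        unfolding image_image
        using image_inv(2)[OF g(1) bary_chainD(3)[OF c]]
        by (intro image_cong) (auto simp: subdivision_action_def)
      then show ?thesis by simp
    qed
    ultimately show ?thesis using g(1) by blast
  qed
  ultimately show "\<exists>F. finite F \<and> F \<subseteq> ?B \<and> (\<forall>c\<in>?B. \<exists>g\<in>carrier G. \<exists>b\<in>F. c = ?\<beta> g ` b)"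
    by (intro exI[of _ ?F]) auto
qed

text \<open>By rigidity, invariant chains of simplices are chains of invariant simplices.\<close>

lemma invariant_chains:
  assumes "H \<subseteq> carrier G"
  shows "{c \<in> barycentric_subdivision K. \<forall>h\<in>H. subdivision_action \<alpha> h ` c = c} =
    barycentric_subdivision {\<sigma> \<in> K. \<forall>h\<in>H. \<alpha> h ` \<sigma> = \<sigma>}"
    (is "?L = ?R")
proof
  show "?L \<subseteq> ?R"
  proof
    fix c assume "c \<in> ?L"
    then have c: "c \<in> barycentric_subdivision K" and fixed: "\<forall>h\<in>H. subdivision_action \<alpha> h ` c = c"
      by auto
    have "c \<subseteq> {\<sigma> \<in> K. \<forall>h\<in>H. \<alpha> h ` \<sigma> = \<sigma>}"
    proof (intro subsetI CollectI conjI ballI)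
      fix \<sigma> assume \<sigma>: "\<sigma> \<in> c"
      show "\<sigma> \<in> K" using bary_chainD(3)[OF c \<sigma>] .
      show "\<alpha> h ` \<sigma> = \<sigma>" if "h \<in> H" for h
        using subsetD[OF assms that] c bspec[OF fixed that] \<sigma> by (rule subdivision_rigid)
    qed
    then show "c \<in> ?R" using c unfolding barycentric_subdivision_def by simp
  qed
  show "?R \<subseteq> ?L"
  proof
    fix c assume c: "c \<in> ?R"
    then have "c \<in> barycentric_subdivision K" unfolding barycentric_subdivision_def by auto
    moreover have "subdivision_action \<alpha> h ` c = c" if h: "h \<in> H" for h
    proof -
      have "subdivision_action \<alpha> h ` c = (\<lambda>\<sigma>. \<sigma>) ` c"
        using bary_chainD(3)[OF c] h by (intro image_cong) (auto simp: subdivision_action_def)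
      then show ?thesis by simp
    qed
    ultimately show "c \<in> ?L" by blast
  qed
qed

text \<open>The support of a fixed point is an invariant simplex; conversely, rigidity makes the
  vertices of an invariant simplex fixed points.\<close>

lemma fixed_points_eq:
  assumes H: "H \<subseteq> carrier G"
    and rigid: "\<And>g \<sigma> v. g \<in> carrier G \<Longrightarrow> \<sigma> \<in> K \<Longrightarrow> \<alpha> g ` \<sigma> = \<sigma> \<Longrightarrow> v \<in> \<sigma> \<Longrightarrow> \<alpha> g v = v"
  shows "fixed_points (realization K) \<phi> H = underlying_set {\<sigma> \<in> K. \<forall>h\<in>H. \<alpha> h ` \<sigma> = \<sigma>}"
    (is "?L = ?R")
proof
  show "?L \<subseteq> ?R"
  proof
    fix t assume "t \<in> ?L"
    then obtain \<sigma> where \<sigma>: "\<sigma> \<in> K" "t \<in> closed_simplex \<sigma>" and fixed: "\<forall>h\<in>H. \<phi> h t = t"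
      unfolding fixed_points_def topspace_realization by blast
    have "support t \<in> K"
      using faces[OF \<sigma>(1) closed_simplexD(4)[OF \<sigma>(2)] support_nonempty[OF \<sigma>(2)]] .
    moreover have "\<alpha> h ` support t = support t" if "h \<in> H" for h
    proof -
      have "t \<in> underlying_set K" using \<sigma> by blast
      then have "affine_extension (\<alpha> h) t = t" using bspec[OF fixed that] by (simp add: \<phi>_eq)
      then show ?thesis
        using support_affine_extension[OF simplex_finite[OF \<sigma>(1)] \<sigma>(2), of "\<alpha> h"] by simp
    qed
    ultimately show "t \<in> ?R"
      using mem_closed_simplex_support(1)[OF simplex_finite[OF \<sigma>(1)] \<sigma>(2)] by blast
  qed
  show "?R \<subseteq> ?L"
  proof
    fix t assume "t \<in> ?R"
    then obtain \<sigma> where \<sigma>: "\<sigma> \<in> K" "\<forall>h\<in>H. \<alpha> h ` \<sigma> = \<sigma>" "t \<in> closed_simplex \<sigma>" by blast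
    have tK: "t \<in> underlying_set K" using \<sigma> by blast
    moreover have "\<phi> h t = t" if "h \<in> H" for h
      unfolding \<phi>_eq[OF tK]
    proof (rule affine_extension_id[OF simplex_finite[OF \<sigma>(1)] \<sigma>(3)])
      show "\<alpha> h v = v" if "v \<in> \<sigma>" for v
        using subsetD[OF H \<open>h \<in> H\<close>] \<sigma>(1) bspec[OF \<sigma>(2) \<open>h \<in> H\<close>] that by (rule rigid)
    qed
    ultimately show "t \<in> ?L" unfolding fixed_points_def topspace_realization by blast
  qed
qed

end


section \<open>The second barycentric subdivision of the Rips complex\<close>

context word_metric_group
begin

text \<open>An element is determined by where it sends one vertex, which gives finite isotropy; and
  every simplex can be translated to one that contains \<open>\<one>\<close>.\<close>

lemma simplicial_action_rips: "simplicial_action G (rips d) (\<lambda>g x. g \<otimes> x)"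
proof unfold_locales
  show "locally_finite_complex (rips d)" by (rule locally_finite_rips)
  show "\<tau> \<in> rips d" if "\<sigma> \<in> rips d" "\<tau> \<subseteq> \<sigma>" "\<tau> \<noteq> {}" for \<sigma> \<tau>
    using that by (rule rips_subset)
  show "(\<otimes>) g ` \<sigma> \<in> rips d" if "g \<in> carrier G" "\<sigma> \<in> rips d" for g \<sigma>
    using that by (rule rips_translate)
  have closed: "x \<in> carrier G" if "\<sigma> \<in> rips d" "x \<in> \<sigma>" for \<sigma> x
    using ripsD(3)[OF that(1)] that(2) by blast
  show "\<one> \<otimes> x = x" if "\<sigma> \<in> rips d" "x \<in> \<sigma>" for \<sigma> x
    using closed[OF that] by simp
  show "(g \<otimes> h) \<otimes> x = g \<otimes> (h \<otimes> x)"
    if "g \<in> carrier G" "h \<in> carrier G" "\<sigma> \<in> rips d" "x \<in> \<sigma>" for g h \<sigma> x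
    using that closed by (simp add: m_assoc)
  show "finite {g \<in> carrier G. (\<otimes>) g ` \<sigma> = \<sigma>}" if \<sigma>: "\<sigma> \<in> rips d" for \<sigma>
  proof -
    obtain x where x: "x \<in> \<sigma>" using ripsD(2)[OF \<sigma>] by blast
    have "inj_on (\<lambda>g. g \<otimes> x) {g \<in> carrier G. (\<otimes>) g ` \<sigma> = \<sigma>}"
      using closed[OF \<sigma> x] by (intro inj_onI) simp
    moreover have "(\<lambda>g. g \<otimes> x) ` {g \<in> carrier G. (\<otimes>) g ` \<sigma> = \<sigma>} \<subseteq> \<sigma>"
      using x by auto
    ultimately show ?thesis using ripsD(1)[OF \<sigma>] by (rule inj_on_finite)
  qed
  let ?F = "{\<sigma> \<in> rips d. \<one> \<in> \<sigma>}"
  have "finite ?F" by (rule locally_finite_complexD(3)[OF locally_finite_rips])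
  moreover have "\<exists>g\<in>carrier G. \<exists>\<tau>\<in>?F. \<sigma> = (\<otimes>) g ` \<tau>" if \<sigma>: "\<sigma> \<in> rips d" for \<sigma>
  proof -
    obtain x where x: "x \<in> \<sigma>" using ripsD(2)[OF \<sigma>] by blast
    have xc: "x \<in> carrier G" using closed[OF \<sigma> x] .
    have "(\<otimes>) (inv x) ` \<sigma> \<in> rips d" using rips_translate[OF inv_closed[OF xc] \<sigma>] .
    moreover have "\<one> \<in> (\<otimes>) (inv x) ` \<sigma>" using x xc by (intro image_eqI[of _ _ x]) simp_all
    moreover have "(\<otimes>) x ` (\<otimes>) (inv x) ` \<sigma> = (\<lambda>y. y) ` \<sigma>"
      unfolding image_image using closed[OF \<sigma>] xc
      by (intro image_cong) (simp_all add: m_assoc[symmetric])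
    ultimately show ?thesis using xc by (intro bexI[of _ x] bexI[of _ "(\<otimes>) (inv x) ` \<sigma>"]) auto
  qed
  ultimately show "\<exists>F. finite F \<and> F \<subseteq> rips d \<and> (\<forall>\<sigma>\<in>rips d. \<exists>g\<in>carrier G. \<exists>\<tau>\<in>F. \<sigma> = (\<otimes>) g ` \<tau>)"
    by (intro exI[of _ ?F]) auto
qed

end

text \<open>The rigidity needed for the equivariant cell structure and for the description of the
  fixed points on \<open>P\<close> is that of chains of simplices in the first subdivision. A second use of it,
  one level down, identifies these fixed points with the twice subdivided poset of invariant
  simplices, to which the contraction applies.\<close>

lemma (in hyperbolic_group) finite_model_second_subdivision:
  assumes d: "32 * \<delta> + 20 \<le> real d"
  defines "P \<equiv> barycentric_subdivision (barycentric_subdivision (rips d))"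
    and "\<alpha> \<equiv> subdivision_action (subdivision_action (\<lambda>g x. g \<otimes> x))"
  shows "finite_model_EG G (realization P) (simplicial_cells P) (realization_action P \<alpha>)"
    and "finite (equivariant_cells G (simplicial_cells P) (realization_action P \<alpha>))"
proof -
  interpret K0: simplicial_action G "rips d" "\<lambda>g x. g \<otimes> x"
    by (rule simplicial_action_rips)
  interpret K1: simplicial_action G "barycentric_subdivision (rips d)" "subdivision_action (\<lambda>g x. g \<otimes> x)"
    by (rule K0.simplicial_action_subdivision)
  interpret K2: simplicial_action G P \<alpha>
    unfolding P_def \<alpha>_def by (rule K1.simplicial_action_subdivision)
  have rigid: "\<alpha> g x = x" if "g \<in> carrier G" "c \<in> P" "\<alpha> g ` c = c" "x \<in> c" for g c x
    using K1.subdivision_rigid[OF that(1) that(2)[unfolded P_def] that(3)[unfolded \<alpha>_def] that(4)]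
    unfolding \<alpha>_def subdivision_action_def .
  have contr: "fixed_points (realization P) K2.\<phi> H \<noteq> {} \<and>
      contractible_space (subtopology (realization P) (fixed_points (realization P) K2.\<phi> H))"
    if H: "subgroup H G" "finite H" for H
  proof -
    have Hc: "H \<subseteq> carrier G" using H(1) by (rule subgroup.subset)
    let ?Q = "invariant_simplices H d" and ?X = "fixed_points (realization P) K2.\<phi> H"
    have Q_sub: "?Q \<subseteq> rips d" unfolding invariant_simplices_def[OF H] by blast
    have "{c \<in> P. \<forall>h\<in>H. \<alpha> h ` c = c} = barycentric_subdivision (barycentric_subdivision ?Q)"
      unfolding P_def \<alpha>_def K1.invariant_chains[OF Hc] invariant_simplices_def[OF H]
        K0.invariant_chains[OF Hc, symmetric] subdivision_action_def ..
    then have X: "?X = underlying_set (barycentric_subdivision (barycentric_subdivision ?Q))"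
      using K2.fixed_points_eq[OF Hc rigid] by simp
    obtain C where C: "monotone_contraction ?Q C"
      using monotone_contraction_invariant_simplices[OF H d] by blast
    have lf: "locally_finite_complex ?Q"
      using locally_finite_rips Q_sub by (rule locally_finite_complex_subset)
    have "contractible ?X"
      unfolding X using Q_sub card_rips_le by (intro contractible_double_subdivision[OF lf _ C]) blast
    moreover have "?X \<subseteq> topspace (realization P)" unfolding fixed_points_def by blast
    moreover have "realization P = top_of_set (underlying_set P)"
      by (rule realization_locally_finite[OF K2.locally_finite])
    ultimately have contractible: "contractible_space (subtopology (realization P) ?X)"
      by (simp add: subtopology_subtopology Int_absorb1)
    have "centre H \<in> ?Q"
      using d delta_nonneg by (intro centre_invariant_simplex[OF H]) linarith
    then have "{{centre H}} \<in> barycentric_subdivision (barycentric_subdivision ?Q)"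
      unfolding barycentric_subdivision_def by auto
    moreover have "(\<lambda>w. of_bool (w = {centre H})) \<in> closed_simplex {{centre H}}"
      by (rule vertex_in_closed_simplex) auto
    ultimately have "?X \<noteq> {}" unfolding X by blast
    then show ?thesis using contractible by simp
  qed
  show "finite (equivariant_cells G (simplicial_cells P) (realization_action P \<alpha>))"
    by (rule K2.finite_equivariant_cells)
  show "finite_model_EG G (realization P) (simplicial_cells P) (realization_action P \<alpha>)"
    unfolding finite_model_EG_def model_EG_def
    using K2.GCW_complex_\<phi>[OF rigid] K2.proper_\<phi> K2.compact_orbit_space contr by simp
qed

theorem theorem1:
  fixes G :: "('a, 'b) monoid_scheme" and S :: "'a set" and \<delta> :: real and d :: nat
  assumes "group G"
    and "finite S" and "S \<subseteq> carrier G" and "generate G S = carrier G"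
    and "(\<lambda>s. inv\<^bsub>G\<^esub> s) ` S = S" and "\<one>\<^bsub>G\<^esub> \<notin> S"
    and "\<delta> \<ge> 0"
    and "hyperbolic (carrier G) (\<lambda>x y. real (word_dist G S x y)) \<delta>"
    and "real d \<ge> 32 * \<delta> + 20"
  shows "let P = barycentric_subdivision (barycentric_subdivision (rips_complex G S d));
             \<phi> = realization_action P
               (subdivision_action (subdivision_action (\<lambda>g x. g \<otimes>\<^bsub>G\<^esub> x)))
         in finite_model_EG G (realization P) (simplicial_cells P) \<phi> \<and>
            finite (equivariant_cells G (simplicial_cells P) \<phi>)"
proof -
  interpret group G by fact
  interpret hyperbolic_group G S \<delta>
    by unfold_locales fact+
  show ?thesis
    unfolding Let_def using finite_model_second_subdivision[OF assms(9)] by simp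
qed

end
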